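(* Let $r\ge1$, let $\mathcal X$ be a Polish space with compatible complete metric $d_{\mathcal X}$ and fixed point $x_0\in\mathcal X$, let $d\in\mathbb N$, let $\mu$ be a continuous (atomless) probability on $\mathcal X$ and $\nu$ a probability on $\mathbb{R}^d$, both with finite $r$-th moments. Let $c:\mathcal X\times\mathbb{R}^d\to\mathbb{R}$ be continuous with at most growth of order $d_{\mathcal X}(x,x_0)^r+|y|^r$. Then \begin{align*} \sup_{\pi\in\Pi(\mu,\nu)}\int c\big(x,b(\pi_x)\big)\,\mu(dx) &=\inf\Big\{\int\phi\,d\mu+\int\psi\,d\nu:\ c(x,y_1)\le\phi(x)+\psi(y_2)+\Delta(y_1)\cdot(y_2-y_1)\ \forall x,y_1,y_2\Big\}\\ &=\inf\Big\{\int\phi\,d\mu+\int\psi\,d\nu:\ c(x,y)\le\phi(x)+\psi(y)\ \forall x,y,\ \psi\text{ convex}\Big\}, \end{align*} where the infima are over continuous $\phi:\mathcal X\to\mathbb{R}$, $\psi:\mathbb{R}^d\to\mathbb{R}$ bounded in absolute value by a multiple of $x\mapsto(1+d_{\mathcal X}(x,x_0))^r$ and $y\mapsto(1+|y|)^r$ respectively, and (in the first infimum) over measurable $\Delta:\mathbb{R}^d\to\mathbb{R}^d$.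
   Context: $\Pi(\mu,\nu)$ denotes the set of couplings of $\mu$ and $\nu$; for $\pi\in\Pi(\mu,\nu)$, $(\pi_x)_{x\in\mathcal X}$ denotes its disintegration with respect to $\mu$; for a probability $p$ on $\mathbb{R}^d$ with finite first moment, $b(p)=\int y\,p(dy)$ denotes its barycenter. *)

theory Defs
  imports "HOL-Probability.Probability"
begin

definition couplings :: "'a::topological_space measure \<Rightarrow> 'b::topological_space measure \<Rightarrow> ('a \<times> 'b) measure set" where
  "couplings \<mu> \<nu> = {\<pi>. prob_space \<pi> \<and> sets \<pi> = sets (borel \<Otimes>\<^sub>M borel) \<and>
      distr \<pi> borel fst = \<mu> \<and> distr \<pi> borel snd = \<nu>}"

definition disintegration :: "'a::topological_space measure \<Rightarrow> ('a \<times> 'b::topological_space) measure \<Rightarrow> ('a \<Rightarrow> 'b measure) \<Rightarrow> bool" where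
  "disintegration \<mu> \<pi> K \<longleftrightarrow> K \<in> \<mu> \<rightarrow>\<^sub>M prob_algebra borel \<and>
     (\<forall>A\<in>sets borel. \<forall>B\<in>sets borel.
        emeasure \<pi> (A \<times> B) = (\<integral>\<^sup>+ x. indicator A x * emeasure (K x) B \<partial>\<mu>))"

definition barycenter :: "'b::euclidean_space measure \<Rightarrow> 'b" where
  "barycenter p = (\<integral> y. y \<partial>p)"

end

theory Submission
  imports Defs
begin

text \<open>Weak duality holds pointwise, by integrating the constraint against \<open>K x\<close>, and an
  approximate subgradient of a convex \<open>\<psi>\<close> serves as \<open>\<Delta>\<close>. It remains to bound the convex
  dual by the primal, and clamping \<open>c\<close> reduces this to bounded costs.

  For bounded \<open>c\<close>, let strategies \<open>s\<close> assign finitely supported probabilities on \<open>'b\<close> to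
  points of \<open>'a\<close>, and relax the constraint that the mean of \<open>s\<close> be \<open>\<nu>\<close>: only the integrals
  of a partition of unity \<open>f i\<close> are controlled, by a quadratic penalty with weight \<open>L\<close>, and
  mass far out is penalised by a multiple of \<open>g y = max 0 (norm y - R)\<close>. Since \<open>\<mu>\<close> is atomless,
  the payoffs of strategies form an approximately convex set, so a near maximiser satisfies a
  first-order condition. It says that the near maximiser is almost optimal for the problem with
  the linear price \<open>\<Sum>i. p i * f i + A * g\<close> on the second coordinate. The convex hull of this price
  and its \<open>c\<close>-conjugate are an admissible dual pair of almost the same value. Finally the mean
  of the near maximiser is close to \<open>\<nu>\<close>, and moving it to \<open>\<nu>\<close> within the small cells of the
  partition yields a coupling whose barycenters hardly change.\<close>

section \<open>Splitting atomless measures\<close>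

text \<open>The functional that sends a coupling to the integral of c(x, b(\<pi>_x)) need not be
  concave, so no minimax argument applies to couplings directly. Atomlessness makes up for this:
  switching between two strategies on a suitable set moves payoffs almost along a segment, but only
  finitely many of them at a time. That is why the constraint that the mean be \<nu> is tested
  against a finite family. The quadratic penalty acts on test integrals that are bounded over all
  strategies. The tail excess is not bounded, so it enters linearly; the summand
  \<open>A * g\<close> of the price then also gives the coercivity that the hull and the conjugate
  rely on. Strategies take probabilities as values because the price is not convex: a random value
  with barycenter y pays, up to a small error, the hull of the price at y. The constants depend on
  each other in one order: stability of the cost integral says how far barycenters may move, this
  fixes \<open>A\<close>, then come \<open>R\<close>, the partition and finally \<open>L\<close>.
  Near maximisers have small mismatch since the dual value is at least \<open>- N\<close>, which
  leaves only a bounded amount for the penalties.\<close>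

lemma norm_integral_le:
  fixes f :: "'a \<Rightarrow> 'b::{banach, second_countable_topology}"
  assumes f: "integrable M f" and g: "integrable M g" and le: "\<And>x. x \<in> space M \<Longrightarrow> norm (f x) \<le> g x"
  shows "norm (\<integral>x. f x \<partial>M) \<le> (\<integral>x. g x \<partial>M)"
proof -
  have "norm (\<integral>x. f x \<partial>M) \<le> (\<integral>x. norm (f x) \<partial>M)" by (rule integral_norm_bound)
  also have "\<dots> \<le> (\<integral>x. g x \<partial>M)" using f g le by (intro integral_mono) auto
  finally show ?thesis .
qed

lemma small_open_neighbourhood:
  fixes x :: "'a::metric_space"
  assumes fin: "finite_measure \<mu>" and sets: "sets \<mu> = sets borel"
    and x: "emeasure \<mu> {x} = 0" and e: "e > 0"
  obtains U where "open U" "x \<in> U" "measure \<mu> U < e"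
proof -
  interpret finite_measure \<mu> by fact
  have "(\<lambda>n. measure \<mu> (ball x (1 / Suc n))) \<longlonglongrightarrow> measure \<mu> (\<Inter>n. ball x (1 / Suc n))"
  proof (rule finite_Lim_measure_decseq)
    show "range (\<lambda>n. ball x (1 / Suc n)) \<subseteq> sets \<mu>" by (auto simp: sets)
    show "decseq (\<lambda>n. ball x (1 / Suc n))"
      by (intro decseq_SucI subset_ball) (simp add: field_simps)
  qed
  moreover have "(\<Inter>n. ball x (1 / Suc n)) = {x}"
  proof (intro equalityI subsetI)
    fix y assume y: "y \<in> (\<Inter>n. ball x (1 / Suc n))"
    have "dist x y < 1 / Suc n" for n using y by auto
    then have "dist x y \<le> 0"
      by (metis nat_approx_posE not_le order_less_asym)
    then show "y \<in> {x}" by simp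
  qed auto
  ultimately have "(\<lambda>n. measure \<mu> (ball x (1 / Suc n))) \<longlonglongrightarrow> 0"
    using x by (simp add: measure_def)
  then have "eventually (\<lambda>n. measure \<mu> (ball x (1 / Suc n)) < e) sequentially"
    using e by (rule order_tendstoD)
  then obtain n where "measure \<mu> (ball x (1 / Suc n)) < e"
    by (auto simp: eventually_sequentially)
  then show thesis by (intro that[of "ball x (1 / Suc n)"]) auto
qed

text \<open>Stands in for measurable selection: a choice that is good at a point and stays good
  nearby is needed only along a sequence, and the index then selects measurably. With small measure
  as \<open>P\<close> it also exhausts an atomless measure in small steps.\<close>

lemma countable_open_cover:
  fixes P :: "'a::second_countable_topology set \<Rightarrow> bool"
  assumes "\<And>x. \<exists>U. open U \<and> x \<in> U \<and> P U"
  obtains U :: "nat \<Rightarrow> 'a set" where "\<forall>n. open (U n)" "\<forall>n. P (U n)" "(\<Union>n. U n) = UNIV"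
proof -
  let ?F = "{U. open U \<and> P U}"
  obtain F' where F': "F' \<subseteq> ?F" "countable F'" "\<Union>F' = \<Union>?F"
    using Lindelof[of ?F] by blast
  have "x \<in> \<Union>?F" for x using assms[of x] by blast
  then have cov: "\<Union>F' = UNIV" using F'(3) by auto
  then have "F' \<noteq> {}" by auto
  then have r: "range (from_nat_into F') = F'" using F'(2) by simp
  then have "open (from_nat_into F' n) \<and> P (from_nat_into F' n)" for n
    using F'(1) by blast
  with r cov that show thesis by metis
qed

text \<open>Cover the space by sets of mass below \<open>e\<close>. The unions of the first
  \<open>n\<close> of them, cut down to \<open>B\<close>, have masses rising from 0 to that of
  \<open>B\<close> in steps below \<open>e\<close>, so one of them comes within \<open>e\<close> of
  any intermediate value.\<close>

lemma atomless_split: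
  fixes \<mu> :: "'a::{metric_space, second_countable_topology} measure"
  assumes fin: "finite_measure \<mu>" and sets: "sets \<mu> = sets borel"
    and atomless: "\<And>x. emeasure \<mu> {x} = 0" and B: "B \<in> sets \<mu>"
    and \<theta>: "0 \<le> \<theta>" "\<theta> \<le> 1" and e: "e > 0"
  obtains A where "A \<in> sets \<mu>" "A \<subseteq> B" "\<bar>measure \<mu> A - \<theta> * measure \<mu> B\<bar> \<le> e"
proof -
  interpret finite_measure \<mu> by fact
  have nb: "\<exists>U. open U \<and> x \<in> U \<and> measure \<mu> U < e" for x
    by (rule small_open_neighbourhood[OF fin sets atomless e, of x]) auto
  obtain U :: "nat \<Rightarrow> 'a set" where U: "\<forall>n. open (U n)" "\<forall>n. measure \<mu> (U n) < e" "(\<Union>n. U n) = UNIV"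
    by (rule countable_open_cover[of "\<lambda>U. measure \<mu> U < e", OF nb])
  have Us[measurable]: "U n \<in> sets \<mu>" for n using U(1) sets by auto
  note B[measurable]
  define V where "V n = B \<inter> (\<Union>i<n. U i)" for n
  have V[measurable]: "V n \<in> sets \<mu>" for n unfolding V_def by measurable
  have "(\<lambda>n. measure \<mu> (V n)) \<longlonglongrightarrow> measure \<mu> (\<Union>n. V n)"
    by (rule finite_Lim_measure_incseq) (auto simp: V_def lessThan_Suc intro!: incseq_SucI)
  moreover have "(\<Union>n. V n) = B" using U(3) unfolding V_def by blast
  ultimately have "(\<lambda>n. measure \<mu> (V n)) \<longlonglongrightarrow> measure \<mu> B" by simp
  moreover have "\<theta> * measure \<mu> B \<le> measure \<mu> B" using \<theta> by (simp add: mult_left_le_one_le)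
  ultimately have "eventually (\<lambda>n. \<theta> * measure \<mu> B - e < measure \<mu> (V n)) sequentially"
    using e by (intro order_tendstoD) auto
  then have ex: "\<exists>n. \<theta> * measure \<mu> B - e < measure \<mu> (V n)"
    by (auto simp: eventually_sequentially)
  \<comment> \<open>The threshold is lowered by \<open>e\<close> because for
    \<open>\<theta> = 1\<close> the target is the limit of the masses, which no \<open>V n\<close>
    need exceed.\<close>
  define n where "n = (LEAST n. \<theta> * measure \<mu> B - e < measure \<mu> (V n))"
  have n1: "\<theta> * measure \<mu> B - e < measure \<mu> (V n)" unfolding n_def by (rule LeastI_ex[OF ex])
  have "measure \<mu> (V n) \<le> \<theta> * measure \<mu> B + e"
  proof (cases n)
    case 0
    then show ?thesis using \<theta> e by (simp add: V_def)
  next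
    case (Suc m)
    then have m: "\<not> \<theta> * measure \<mu> B - e < measure \<mu> (V m)"
      unfolding n_def using not_less_Least[of m] by (metis lessI n_def)
    have "V (Suc m) \<subseteq> V m \<union> U m" by (auto simp: V_def less_Suc_eq)
    then have "measure \<mu> (V (Suc m)) \<le> measure \<mu> (V m \<union> U m)" by (intro finite_measure_mono) auto
    also have "\<dots> \<le> measure \<mu> (V m) + measure \<mu> (U m)" by (rule measure_Un_le) measurable
    finally show ?thesis using m U(2)[rule_format, of m] e unfolding Suc by linarith
  qed
  with n1 have "\<bar>measure \<mu> (V n) - \<theta> * measure \<mu> B\<bar> \<le> e" by linarith
  then show thesis by (intro that[of "V n"]) (auto simp: V_def)
qed

text \<open>An approximate form of Lyapunov's convexity theorem. On each cell where all the
  \<^term>\<open>G j\<close> are nearly constant it suffices to split the measure.\<close>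

lemma approx_lyapunov:
  fixes \<mu> :: "'a::{metric_space, second_countable_topology} measure" and G :: "'j \<Rightarrow> 'a \<Rightarrow> real"
  assumes prob: "prob_space \<mu>" and sets: "sets \<mu> = sets borel"
    and atomless: "\<And>x. emeasure \<mu> {x} = 0"
    and J: "finite J" and G[measurable]: "\<And>j. j \<in> J \<Longrightarrow> G j \<in> borel_measurable \<mu>"
    and B: "\<And>j x. j \<in> J \<Longrightarrow> \<bar>G j x\<bar> \<le> B"
    and \<theta>: "0 \<le> \<theta>" "\<theta> \<le> 1" and e: "e > 0"
  obtains A where "A \<in> sets \<mu>"
    "\<forall>j\<in>J. \<bar>(\<integral>x. indicator A x * G j x \<partial>\<mu>) - \<theta> * (\<integral>x. G j x \<partial>\<mu>)\<bar> \<le> e"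
proof -
  interpret prob_space \<mu> by fact
  have sp[simp]: "space \<mu> = UNIV" using sets_eq_imp_space_eq[OF sets] by simp
  \<comment> \<open>A third of \<open>e\<close> each for rounding \<open>G j\<close> on
    \<open>A\<close>, for rounding it on the whole space, and for splitting the cells.\<close>
  define d where "d = e / 3"
  have d: "d > 0" using e by (simp add: d_def)
  define t where "t x = (\<lambda>j\<in>J. \<lfloor>G j x / d\<rfloor>)" for x
  define M where "M = \<lceil>\<bar>B\<bar> / d\<rceil> + 1"
  have fl: "\<lfloor>G j x / d\<rfloor> \<in> {-M..M}" if "j \<in> J" for j x
  proof -
    have "\<bar>G j x / d\<bar> \<le> \<bar>B\<bar> / d" using B[OF that, of x] d by (simp add: divide_right_mono)
    then have "G j x / d \<le> \<bar>B\<bar> / d" "- (\<bar>B\<bar> / d) \<le> G j x / d" by linarith+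
    then show ?thesis unfolding M_def atLeastAtMost_iff by linarith
  qed
  have fint: "finite (range t)"
    by (rule finite_subset[of _ "J \<rightarrow>\<^sub>E {-M..M}"]) (use fl J in \<open>auto simp: t_def intro!: finite_PiE\<close>)
  define C where "C v = t -` {v}" for v
  have Cm[measurable]: "C v \<in> sets \<mu>" if "v \<in> range t" for v
  proof -
    obtain x where v: "v = t x" using \<open>v \<in> range t\<close> by auto
    have "C v = {y\<in>space \<mu>. \<forall>j\<in>J. \<lfloor>G j y / d\<rfloor> = \<lfloor>G j x / d\<rfloor>}"
      unfolding C_def v by (auto simp: t_def fun_eq_iff restrict_def) meson
    also have "\<dots> \<in> sets \<mu>" using J by measurable
    finally show ?thesis .
  qed
  \<comment> \<open>\<open>W\<close> bounds the rounded values and \<open>k\<close> exceeds the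
    number of cells, so errors of at most \<open>\<delta>\<close> per cell add up to at most
    \<open>k * (W * \<delta>) = e / 3\<close>.\<close>
  define W where "W = \<bar>d\<bar> * (\<bar>real_of_int M\<bar> + 1)"
  define k where "k = real (card (range t)) + 1"
  define \<delta> where "\<delta> = e / (3 * (k * W))"
  have W: "W > 0" using d unfolding W_def by (intro mult_pos_pos) auto
  have k: "k > 0" unfolding k_def by (simp add: add_nonneg_pos)
  have \<delta>: "\<delta> > 0" using e W k unfolding \<delta>_def by (intro divide_pos_pos mult_pos_pos) auto
  have "\<forall>v\<in>range t. \<exists>A. A \<in> sets \<mu> \<and> A \<subseteq> C v \<and> \<bar>measure \<mu> A - \<theta> * measure \<mu> (C v)\<bar> \<le> \<delta>"
    using atomless_split[OF finite_measure_axioms sets atomless Cm \<theta> \<delta>] by metis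
  then obtain S where S: "\<And>v. v \<in> range t \<Longrightarrow> S v \<in> sets \<mu>" "\<And>v. v \<in> range t \<Longrightarrow> S v \<subseteq> C v"
    "\<And>v. v \<in> range t \<Longrightarrow> \<bar>measure \<mu> (S v) - \<theta> * measure \<mu> (C v)\<bar> \<le> \<delta>"
    by metis
  define A where "A = (\<Union>v\<in>range t. S v)"
  have Am[measurable]: "A \<in> sets \<mu>" unfolding A_def using fint S(1) by (intro sets.finite_UN) auto
  have AC: "indicator A x = (indicator (S (t x)) x :: real)" for x
  proof -
    have "x \<in> A \<longleftrightarrow> x \<in> S (t x)"
    proof
      assume "x \<in> A"
      then obtain v where v: "v \<in> range t" "x \<in> S v" unfolding A_def by blast
      then have "t x = v" using S(2)[OF v(1)] unfolding C_def by blast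
      then show "x \<in> S (t x)" using v by simp
    qed (unfold A_def, blast)
    then show ?thesis by (simp add: indicator_def)
  qed
  have intb: "integrable \<mu> f" if "f \<in> borel_measurable \<mu>" "\<And>x. \<bar>f x\<bar> \<le> \<bar>B\<bar> + d" for f :: "'a \<Rightarrow> real"
    using that by (intro integrable_const_bound[where B="\<bar>B\<bar> + d"]) auto
  have main: "\<bar>(\<integral>x. indicator A x * G j x \<partial>\<mu>) - \<theta> * (\<integral>x. G j x \<partial>\<mu>)\<bar> \<le> e" if j: "j \<in> J" for j
  proof -
    \<comment> \<open>\<open>G j\<close> rounded down to a multiple of \<open>d\<close>. It is
      constant on each cell, so its integrals over \<open>A\<close> and over the whole space involve
      only the masses of the sets \<open>S v\<close> and \<open>C v\<close>.\<close>
    define H where "H x = d * of_int \<lfloor>G j x / d\<rfloor>" for x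
    have [measurable]: "H \<in> borel_measurable \<mu>" "G j \<in> borel_measurable \<mu>"
      unfolding H_def using j by measurable
    have HG: "\<bar>G j x - H x\<bar> \<le> d" for x
    proof -
      define g where "g = G j x / d"
      have G: "G j x = d * g" using d by (simp add: g_def)
      have "d * of_int \<lfloor>g\<rfloor> \<le> d * g" "d * g \<le> d * (of_int \<lfloor>g\<rfloor> + 1)"
        using d by (intro mult_left_mono; linarith)+
      then have "H x \<le> G j x" "G j x \<le> H x + d"
        unfolding H_def g_def[symmetric] unfolding G by (simp_all add: distrib_left)
      then show ?thesis using d by linarith
    qed
    have HB: "\<bar>H x\<bar> \<le> \<bar>B\<bar> + d" for x using HG[of x] B[OF j, of x] by linarith
    have Hv: "H x = d * of_int (t x j)" for x using j by (simp add: H_def t_def)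
    have vM: "\<bar>d * of_int (v j)\<bar> \<le> W" if "v \<in> range t" for v
    proof -
      obtain x where "v = t x" using \<open>v \<in> range t\<close> by auto
      then have "v j \<in> {-M..M}" using fl[OF j, of x] by (simp add: t_def j)
      then have "\<bar>real_of_int (v j)\<bar> \<le> \<bar>real_of_int M\<bar> + 1" by auto
      then show ?thesis by (simp add: abs_mult mult_left_mono W_def)
    qed
    have Hsum: "H x = (\<Sum>v\<in>range t. d * of_int (v j) * indicator (C v) x)" for x
    proof -
      have "(\<Sum>v\<in>range t. d * of_int (v j) * indicator (C v) x) = (\<Sum>v\<in>range t. if v = t x then d * of_int (v j) else 0)"
        by (rule sum.cong) (simp_all add: C_def indicator_def eq_commute)
      also have "\<dots> = H x" using fint by (simp add: Hv)
      finally show ?thesis by simp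
    qed
    have AHsum: "indicator A x * H x = (\<Sum>v\<in>range t. d * of_int (v j) * indicator (S v) x)" for x
    proof -
      have "(\<Sum>v\<in>range t. d * of_int (v j) * indicator (S v) x) = (\<Sum>v\<in>range t. if v = t x then d * of_int (v j) * indicator (S (t x)) x else 0)"
      proof (rule sum.cong[OF refl])
        fix v assume "v \<in> range t"
        from S(2)[OF this] have "x \<in> S v \<Longrightarrow> t x = v" unfolding C_def by blast
        then show "d * of_int (v j) * indicator (S v) x = (if v = t x then d * of_int (v j) * indicator (S (t x)) x else (0::real))"
          by (auto simp: indicator_def)
      qed
      also have "\<dots> = indicator A x * H x" using fint by (subst sum.delta) (simp_all add: Hv AC mult.commute)
      finally show ?thesis by simp
    qed
    have iH: "(\<integral>x. H x \<partial>\<mu>) = (\<Sum>v\<in>range t. d * of_int (v j) * measure \<mu> (C v))"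
      unfolding Hsum
    proof (subst Bochner_Integration.integral_sum)
      show "integrable \<mu> (\<lambda>x. d * of_int (v j) * indicator (C v) x)" if "v \<in> range t" for v
        using Cm[OF that] by (intro integrable_mult_right) (simp add: integrable_indicator_iff less_top[symmetric])
    qed simp
    have iAH: "(\<integral>x. indicator A x * H x \<partial>\<mu>) = (\<Sum>v\<in>range t. d * of_int (v j) * measure \<mu> (S v))"
      unfolding AHsum
    proof (subst Bochner_Integration.integral_sum)
      show "integrable \<mu> (\<lambda>x. d * of_int (v j) * indicator (S v) x)" if "v \<in> range t" for v
        using S(1)[OF that] by (intro integrable_mult_right) (simp add: integrable_indicator_iff less_top[symmetric])
    qed simp
    have "\<bar>(\<integral>x. indicator A x * H x \<partial>\<mu>) - \<theta> * (\<integral>x. H x \<partial>\<mu>)\<bar>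
        = \<bar>\<Sum>v\<in>range t. d * of_int (v j) * (measure \<mu> (S v) - \<theta> * measure \<mu> (C v))\<bar>"
      unfolding iH iAH by (simp add: right_diff_distrib sum_subtractf sum_distrib_left mult.left_commute)
    also have "\<dots> \<le> (\<Sum>v\<in>range t. \<bar>d * of_int (v j)\<bar> * \<bar>measure \<mu> (S v) - \<theta> * measure \<mu> (C v)\<bar>)"
      by (rule order_trans[OF sum_abs]) (simp add: abs_mult)
    also have "\<dots> \<le> (\<Sum>v\<in>range t. W * \<delta>)"
      using W by (intro sum_mono mult_mono vM S(3)) auto
    also have "\<dots> = (card (range t)) * (W * \<delta>)" by simp
    also have "\<dots> \<le> k * (W * \<delta>)"
      using \<delta> W by (intro mult_right_mono) (auto simp: k_def)
    also have "\<dots> = e / 3" using W k by (simp add: \<delta>_def)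
    finally have 1: "\<bar>(\<integral>x. indicator A x * H x \<partial>\<mu>) - \<theta> * (\<integral>x. H x \<partial>\<mu>)\<bar> \<le> e / 3" .
    have ints: "integrable \<mu> H" "integrable \<mu> (G j)" "integrable \<mu> (\<lambda>x. indicator A x * H x)"
      "integrable \<mu> (\<lambda>x. indicator A x * G j x)"
    proof -
      have GB: "\<bar>G j x\<bar> \<le> \<bar>B\<bar> + d" for x using B[OF j, of x] d by linarith
      have B0: "0 \<le> \<bar>B\<bar> + d" using d by linarith
      show "integrable \<mu> H" by (rule intb) (use HB in simp_all)
      show "integrable \<mu> (G j)" by (rule intb) (use GB in simp_all)
      show "integrable \<mu> (\<lambda>x. indicator A x * H x)"
        by (rule intb) (use HB B0 in \<open>simp_all add: indicator_def\<close>)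
      show "integrable \<mu> (\<lambda>x. indicator A x * G j x)"
        by (rule intb) (use GB B0 in \<open>simp_all add: indicator_def\<close>)
    qed
    have AHG: "\<bar>indicator A x * G j x - indicator A x * H x\<bar> \<le> d" for x
      using HG[of x] d by (cases "x \<in> A") auto
    have ic: "(\<integral>x. d \<partial>\<mu>) = d" using prob_space by simp
    have "norm (\<integral>x. indicator A x * G j x - indicator A x * H x \<partial>\<mu>) \<le> (\<integral>x. d \<partial>\<mu>)"
      by (rule norm_integral_le) (use AHG ints in simp_all)
    then have 2: "\<bar>(\<integral>x. indicator A x * G j x \<partial>\<mu>) - (\<integral>x. indicator A x * H x \<partial>\<mu>)\<bar> \<le> d"
      unfolding ic Bochner_Integration.integral_diff[OF ints(4,3)] by simp
    have "norm (\<integral>x. G j x - H x \<partial>\<mu>) \<le> (\<integral>x. d \<partial>\<mu>)"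
      by (rule norm_integral_le) (use HG ints in simp_all)
    then have "\<bar>(\<integral>x. G j x \<partial>\<mu>) - (\<integral>x. H x \<partial>\<mu>)\<bar> \<le> d"
      unfolding ic Bochner_Integration.integral_diff[OF ints(2,1)] by simp
    then have 3: "\<bar>\<theta> * (\<integral>x. G j x \<partial>\<mu>) - \<theta> * (\<integral>x. H x \<partial>\<mu>)\<bar> \<le> d"
      using \<theta> mult_mono[of \<theta> 1 "\<bar>(\<integral>x. G j x \<partial>\<mu>) - (\<integral>x. H x \<partial>\<mu>)\<bar>" d]
      by (simp only: right_diff_distrib[symmetric] abs_mult abs_of_nonneg) simp
    have "3 * d = e" by (simp add: d_def)
    then show ?thesis using 1 2 3 by linarith
  qed
  show thesis using that[of A] Am main by blast
qed

section \<open>Convex hulls and conjugates\<close>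

abbreviation bary :: "'b::euclidean_space pmf \<Rightarrow> 'b" where
  "bary \<kappa> \<equiv> barycenter (measure_pmf \<kappa>)"

abbreviation pexp :: "'b pmf \<Rightarrow> ('b \<Rightarrow> real) \<Rightarrow> real" where
  "pexp \<kappa> f \<equiv> measure_pmf.expectation \<kappa> f"

lemma norm_bary_le: "norm (bary \<kappa>) \<le> pexp \<kappa> norm"
  unfolding barycenter_def by (rule integral_norm_bound)

lemma pexp_mono:
  assumes "finite (set_pmf \<kappa>)" "\<And>y. f y \<le> g y"
  shows "pexp \<kappa> f \<le> pexp \<kappa> g"
  using assms by (intro integral_mono integrable_measure_pmf_finite) auto

lemma bary_return [simp]: "bary (return_pmf y) = y"
  by (simp add: barycenter_def integral_measure_pmf[where A="{y}"])

lemma pexp_return [simp]: "pexp (return_pmf y) f = f y"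
  by (simp add: integral_measure_pmf[where A="{y}"])

lemma pmf_mixture:
  fixes \<kappa>1 \<kappa>2 :: "'b::euclidean_space pmf"
  assumes "finite (set_pmf \<kappa>1)" "finite (set_pmf \<kappa>2)" "0 \<le> u" "u \<le> 1"
  obtains \<kappa> where "finite (set_pmf \<kappa>)" "bary \<kappa> = (1 - u) *\<^sub>R bary \<kappa>1 + u *\<^sub>R bary \<kappa>2"
    "\<And>f. pexp \<kappa> f = (1 - u) * pexp \<kappa>1 f + u * pexp \<kappa>2 f"
proof -
  define \<kappa> where "\<kappa> = bind_pmf (bernoulli_pmf u) (\<lambda>b. if b then \<kappa>2 else \<kappa>1)"
  have E: "measure_pmf.expectation \<kappa> f = (1 - u) *\<^sub>R measure_pmf.expectation \<kappa>1 f + u *\<^sub>R measure_pmf.expectation \<kappa>2 f"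
    for f :: "'b \<Rightarrow> 'c::{banach, second_countable_topology}"
    unfolding \<kappa>_def using assms by (subst pmf_expectation_bind[where A=UNIV]) (auto simp: UNIV_bool)
  show thesis
  proof (rule that)
    show "finite (set_pmf \<kappa>)" using assms by (simp add: \<kappa>_def)
  qed (simp_all add: E barycenter_def)
qed

text \<open>The convex envelope. Convex combinations are encoded as finitely supported pmfs so that
  a near optimal one can serve as the value of a strategy. The infimum is a real one; the lower
  bound assumed in the next context keeps it meaningful.\<close>

definition convex_hull_fun :: "('b::euclidean_space \<Rightarrow> real) \<Rightarrow> 'b \<Rightarrow> real" where
  "convex_hull_fun \<psi> y = (INF \<kappa>\<in>{\<kappa>. finite (set_pmf \<kappa>) \<and> bary \<kappa> = y}. pexp \<kappa> \<psi>)"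

context
  fixes \<psi> :: "'b::euclidean_space \<Rightarrow> real" and \<alpha> \<beta> :: real
  assumes \<alpha>: "\<alpha> > 0" and lower: "\<And>y. \<alpha> * norm y - \<beta> \<le> \<psi> y"
begin

text \<open>Jensen's inequality for the norm lets the coercive bound pass from points to
  barycenters, so that the hull inherits it.\<close>

lemma pexp_lower:
  assumes "finite (set_pmf \<kappa>)"
  shows "\<alpha> * norm (bary \<kappa>) - \<beta> \<le> pexp \<kappa> \<psi>"
proof -
  have "\<alpha> * norm (bary \<kappa>) - \<beta> \<le> \<alpha> * pexp \<kappa> norm - \<beta>"
    using norm_bary_le[of \<kappa>] \<alpha> by simp
  also have "\<dots> = pexp \<kappa> (\<lambda>y. \<alpha> * norm y - \<beta>)"
    using integrable_measure_pmf_finite[OF assms, of norm]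
    by (simp add: measure_pmf.prob_space)
  also have "\<dots> \<le> pexp \<kappa> \<psi>" by (rule pexp_mono[OF assms lower])
  finally show ?thesis .
qed

lemma bdd_below_pexp: "bdd_below ((\<lambda>\<kappa>. pexp \<kappa> \<psi>) ` {\<kappa>. finite (set_pmf \<kappa>) \<and> bary \<kappa> = y})"
  by (rule bdd_belowI2[where m="\<alpha> * norm y - \<beta>"]) (use pexp_lower in auto)

lemma convex_hull_fun_le_pexp: "finite (set_pmf \<kappa>) \<Longrightarrow> convex_hull_fun \<psi> (bary \<kappa>) \<le> pexp \<kappa> \<psi>"
  unfolding convex_hull_fun_def by (rule cINF_lower[OF bdd_below_pexp]) auto

lemma convex_hull_fun_le: "convex_hull_fun \<psi> y \<le> \<psi> y"
  using convex_hull_fun_le_pexp[of "return_pmf y"] by simp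

lemma convex_hull_fun_ge: "\<alpha> * norm y - \<beta> \<le> convex_hull_fun \<psi> y"
  unfolding convex_hull_fun_def
  by (rule cINF_greatest) (use pexp_lower in \<open>auto intro!: exI[of _ "return_pmf y"]\<close>)

lemma convex_hull_fun_approx:
  assumes "e > 0"
  obtains \<kappa> where "finite (set_pmf \<kappa>)" "bary \<kappa> = y" "pexp \<kappa> \<psi> < convex_hull_fun \<psi> y + e"
proof -
  have "\<exists>\<kappa>\<in>{\<kappa>. finite (set_pmf \<kappa>) \<and> bary \<kappa> = y}. pexp \<kappa> \<psi> < convex_hull_fun \<psi> y + e"
    using assms unfolding convex_hull_fun_def
    by (subst cINF_less_iff[OF _ bdd_below_pexp, symmetric]) (auto intro!: exI[of _ "return_pmf y"])
  then show thesis using that by blast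
qed

text \<open>A mixture of near optimal pmfs for two points is a competitor at the intermediate
  point.\<close>

lemma convex_on_convex_hull_fun: "convex_on UNIV (convex_hull_fun \<psi>)"
proof (rule convex_onI)
  fix t :: real and x y :: 'b
  assume t: "0 < t" "t < 1"
  show "convex_hull_fun \<psi> ((1 - t) *\<^sub>R x + t *\<^sub>R y)
      \<le> (1 - t) * convex_hull_fun \<psi> x + t * convex_hull_fun \<psi> y"
  proof (rule field_le_epsilon)
    fix e :: real assume e: "e > 0"
    obtain \<kappa>1 where \<kappa>1: "finite (set_pmf \<kappa>1)" "bary \<kappa>1 = x" "pexp \<kappa>1 \<psi> < convex_hull_fun \<psi> x + e"
      using convex_hull_fun_approx[OF e] by blast
    obtain \<kappa>2 where \<kappa>2: "finite (set_pmf \<kappa>2)" "bary \<kappa>2 = y" "pexp \<kappa>2 \<psi> < convex_hull_fun \<psi> y + e"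
      using convex_hull_fun_approx[OF e] by blast
    obtain \<kappa> where \<kappa>: "finite (set_pmf \<kappa>)" "bary \<kappa> = (1 - t) *\<^sub>R x + t *\<^sub>R y"
      "\<And>f. pexp \<kappa> f = (1 - t) * pexp \<kappa>1 f + t * pexp \<kappa>2 f"
      using pmf_mixture[OF \<kappa>1(1) \<kappa>2(1), of t] t \<kappa>1(2) \<kappa>2(2) by auto
    have "convex_hull_fun \<psi> ((1 - t) *\<^sub>R x + t *\<^sub>R y) \<le> pexp \<kappa> \<psi>"
      using convex_hull_fun_le_pexp[OF \<kappa>(1)] \<kappa>(2) by simp
    also have "\<dots> \<le> (1 - t) * (convex_hull_fun \<psi> x + e) + t * (convex_hull_fun \<psi> y + e)"
      unfolding \<kappa>(3) using \<kappa>1(3) \<kappa>2(3) t by (intro add_mono mult_left_mono) auto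
    finally show "convex_hull_fun \<psi> ((1 - t) *\<^sub>R x + t *\<^sub>R y)
      \<le> (1 - t) * convex_hull_fun \<psi> x + t * convex_hull_fun \<psi> y + e" by (simp add: algebra_simps)
  qed
qed simp

lemma continuous_on_convex_hull_fun: "continuous_on UNIV (convex_hull_fun \<psi>)"
  by (rule convex_on_continuous[OF open_UNIV convex_on_convex_hull_fun])

end

text \<open>The \<open>c\<close>-transform, that is, where the supremum is finite, the least
  \<open>\<phi>\<close> with \<open>c (x, y) \<le> \<phi> x + \<psi> y\<close> for all
  \<open>y\<close>.\<close>

definition conjugate_cost :: "('a \<times> 'b \<Rightarrow> real) \<Rightarrow> ('b \<Rightarrow> real) \<Rightarrow> 'a \<Rightarrow> real" where
  "conjugate_cost c \<psi> x = (SUP y. c (x, y) - \<psi> y)"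

context
  fixes c :: "'a::topological_space \<times> 'b::euclidean_space \<Rightarrow> real" and \<psi> :: "'b \<Rightarrow> real" and N \<alpha> \<beta> :: real
  assumes c_cont: "continuous_on UNIV c" and c_bound: "\<And>z. \<bar>c z\<bar> \<le> N"
    and \<alpha>: "\<alpha> > 0" and lower: "\<And>y. \<alpha> * norm y - \<beta> \<le> \<psi> y" and upper: "\<psi> 0 \<le> \<beta>"
begin

lemma bdd_above_cost: "bdd_above (range (\<lambda>y. c (x, y) - \<psi> y))"
proof (rule bdd_aboveI2)
  fix y :: 'b
  have "0 \<le> \<alpha> * norm y" using \<alpha> by simp
  then show "c (x, y) - \<psi> y \<le> N + \<beta>" using c_bound[of "(x, y)"] lower[of y] by linarith
qed

lemma conjugate_cost_ge: "c (x, y) - \<psi> y \<le> conjugate_cost c \<psi> x"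
  unfolding conjugate_cost_def by (rule cSUP_upper[OF _ bdd_above_cost]) simp

lemma conjugate_cost_bound: "\<bar>conjugate_cost c \<psi> x\<bar> \<le> N + \<beta>"
proof -
  have "conjugate_cost c \<psi> x \<le> N + \<beta>"
    unfolding conjugate_cost_def
  proof (rule cSUP_least)
    fix y :: 'b
    have "0 \<le> \<alpha> * norm y" using \<alpha> by simp
    then show "c (x, y) - \<psi> y \<le> N + \<beta>" using c_bound[of "(x, y)"] lower[of y] by linarith
  qed simp
  moreover have "- (N + \<beta>) \<le> conjugate_cost c \<psi> x"
    using conjugate_cost_ge[of x 0] c_bound[of "(x, 0)"] upper by linarith
  ultimately show ?thesis by linarith
qed

lemma conjugate_cost_approx:
  assumes "e > 0"
  obtains y where "conjugate_cost c \<psi> x - e < c (x, y) - \<psi> y"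
proof -
  have "\<exists>y\<in>UNIV. conjugate_cost c \<psi> x - e < c (x, y) - \<psi> y"
    using assms unfolding conjugate_cost_def
    by (subst less_cSUP_iff[OF _ bdd_above_cost, symmetric]) auto
  then show thesis using that by blast
qed

text \<open>Coercivity of \<^term>\<open>\<psi>\<close> confines near maximisers to a fixed ball, over which
  \<^term>\<open>c\<close> is equicontinuous in its first argument.\<close>

lemma continuous_on_conjugate_cost: "continuous_on UNIV (conjugate_cost c \<psi>)"
proof -
  \<comment> \<open>If \<open>y\<close> is within 1 of the supremum, then \<open>\<psi> y\<close> is
    at most \<open>N + (N + \<beta>) + 1\<close>, and the lower bound on \<open>\<psi>\<close> turns
    this into a bound on \<open>norm y\<close>.\<close>
  define B where "B = (2 * N + 2 * \<beta> + 1) / \<alpha>"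
  have near: "norm y \<le> B" if "conjugate_cost c \<psi> x - 1 < c (x, y) - \<psi> y" for x y
  proof -
    have "\<alpha> * norm y \<le> 2 * N + 2 * \<beta> + 1"
      using that conjugate_cost_bound[of x] c_bound[of "(x, y)"] lower[of y] by linarith
    then show ?thesis using \<alpha> by (simp add: B_def pos_le_divide_eq mult.commute)
  qed
  have step: "conjugate_cost c \<psi> x \<le> conjugate_cost c \<psi> x' + e"
    if e: "0 < e" and d: "\<forall>y\<in>cball 0 B. c (x, y) \<le> c (x', y) + e" for x x' e
  proof (rule field_le_epsilon)
    fix e' :: real assume e': "e' > 0"
    \<comment> \<open>The slack is capped at 1 so that \<open>near\<close> places \<open>y\<close>
      in the ball.\<close>
    obtain y where y: "conjugate_cost c \<psi> x - min 1 e' < c (x, y) - \<psi> y"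
      using conjugate_cost_approx[of "min 1 e'"] e' by auto
    then have "y \<in> cball 0 B" using near[of x y] by auto
    then have "c (x, y) \<le> c (x', y) + e" using d by blast
    then show "conjugate_cost c \<psi> x \<le> conjugate_cost c \<psi> x' + e + e'"
      using y conjugate_cost_ge[of x' y] by linarith
  qed
  show ?thesis
    unfolding continuous_on_def
  proof (intro ballI)
    fix x0
    show "(conjugate_cost c \<psi> \<longlongrightarrow> conjugate_cost c \<psi> x0) (at x0)"
      unfolding tendsto_iff
    proof (intro allI impI)
      fix e :: real assume e: "e > 0"
      obtain X0 where X0: "x0 \<in> X0" "open X0"
        "\<forall>x\<in>X0 \<inter> UNIV. \<forall>t\<in>cball 0 B. dist (c (x, t)) (c (x0, t)) \<le> e / 2"
        using continuous_on_prod_compactE[of UNIV "cball 0 B" c x0 "e / 2"] c_cont e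
        by (metis UNIV_I compact_cball continuous_on_subset half_gt_zero subset_UNIV)
      have "dist (conjugate_cost c \<psi> x) (conjugate_cost c \<psi> x0) < e" if "x \<in> X0" for x
      proof -
        have d: "\<bar>c (x, t) - c (x0, t)\<bar> \<le> e / 2" if "t \<in> cball 0 B" for t
          using X0(3) \<open>x \<in> X0\<close> that by (auto simp: dist_real_def)
        have d1: "c (x, t) \<le> c (x0, t) + e / 2" and d2: "c (x0, t) \<le> c (x, t) + e / 2"
          if "t \<in> cball 0 B" for t using d[OF that] by linarith+
        have "conjugate_cost c \<psi> x \<le> conjugate_cost c \<psi> x0 + e / 2"
          using e d1 by (intro step ballI) simp_all
        moreover have "conjugate_cost c \<psi> x0 \<le> conjugate_cost c \<psi> x + e / 2"
          using e d2 by (intro step ballI) simp_all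
        ultimately show ?thesis using e by (simp add: dist_real_def)
      qed
      then show "\<forall>\<^sub>F x in at x0. dist (conjugate_cost c \<psi> x) (conjugate_cost c \<psi> x0) < e"
        using X0(1,2) unfolding eventually_at_topological by blast
    qed
  qed
qed

end

section \<open>Strategies\<close>

text \<open>Finitely many values, each of finite support: no measurable structure on pmfs is
  involved, and every integral of a function against the values is bounded in \<open>x\<close>, even
  for unbounded functions.\<close>

definition strategies :: "'a measure \<Rightarrow> ('a \<Rightarrow> 'b pmf) set" where
  "strategies \<mu> = {s. simple_function \<mu> s \<and> (\<forall>x. finite (set_pmf (s x)))}"

lemma strategies_If:
  assumes "s \<in> strategies \<mu>" "s' \<in> strategies \<mu>" "A \<in> sets \<mu>"
  shows "(\<lambda>x. if x \<in> A then s x else s' x) \<in> strategies \<mu>"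
  using assms by (auto simp: strategies_def intro!: simple_function_If_set)

text \<open>The strategy is constant on each of finitely many measurable pieces, so measurability of
  \<open>F\<close> for each fixed pmf suffices.\<close>

lemma measurable_strategy:
  assumes s: "s \<in> strategies \<mu>" and F: "\<And>\<kappa>. (\<lambda>x. F x \<kappa>) \<in> \<mu> \<rightarrow>\<^sub>M M"
  shows "(\<lambda>x. F x (s x)) \<in> \<mu> \<rightarrow>\<^sub>M M"
proof -
  have fin: "finite (s ` space \<mu>)" and "s \<in> \<mu> \<rightarrow>\<^sub>M count_space UNIV"
    using s by (auto simp: strategies_def simple_functionD measurable_simple_function)
  then have "s \<in> \<mu> \<rightarrow>\<^sub>M count_space (s ` space \<mu>)"
    using s by (auto simp: measurable_count_space_eq2 strategies_def simple_functionD)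
  from measurable_compose_countable'[OF F this countable_finite[OF fin]]
  show ?thesis .
qed

lemma integrable_pexp_strategy:
  assumes \<mu>: "finite_measure \<mu>" and s: "s \<in> strategies \<mu>"
  shows "integrable \<mu> (\<lambda>x. pexp (s x) f)"
proof -
  interpret finite_measure \<mu> by fact
  have fin: "finite (s ` space \<mu>)" using s by (auto simp: strategies_def simple_functionD)
  show ?thesis
  proof (rule integrable_const_bound)
    show "AE x in \<mu>. norm (pexp (s x) f) \<le> Max ((\<lambda>\<kappa>. norm (pexp \<kappa> f)) ` s ` space \<mu>)"
      using fin by (intro AE_I2) auto
    show "(\<lambda>x. pexp (s x) f) \<in> borel_measurable \<mu>"
      by (rule measurable_strategy[OF s]) simp
  qed
qed

lemma bounded_pexp_strategy:
  assumes s: "s \<in> strategies \<mu>" and "space \<mu> = UNIV"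
  obtains K where "\<And>x. \<bar>pexp (s x) f\<bar> \<le> K"
proof -
  have fin: "finite (range s)" using assms by (auto simp: strategies_def simple_functionD dest!: simple_functionD(1))
  have "\<bar>pexp (s x) f\<bar> \<le> Max ((\<lambda>\<kappa>. \<bar>pexp \<kappa> f\<bar>) ` range s)" for x
    using fin by (intro Max_ge) auto
  then show thesis by (rule that)
qed

text \<open>First-order optimality of a near maximiser of the penalised payoff
  \<open>U - L * (\<Sum>i. (m i)\<^sup>2)\<close> over an approximately convex set. It replaces
  a minimax theorem, the multipliers being \<open>2 * L * m i s\<close>.\<close>

lemma penalised_first_order:
  fixes U :: "'s \<Rightarrow> real" and m :: "'i \<Rightarrow> 's \<Rightarrow> real"
  assumes J: "finite J" and S: "s0 \<in> S"
    and conv: "\<And>s s' \<theta> e. s \<in> S \<Longrightarrow> s' \<in> S \<Longrightarrow> 0 \<le> \<theta> \<Longrightarrow> \<theta> \<le> 1 \<Longrightarrow> e > 0 \<Longrightarrow>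
      \<exists>t\<in>S. \<bar>U t - (U s + \<theta> * (U s' - U s))\<bar> \<le> e \<and>
        (\<forall>i\<in>J. \<bar>m i t - (m i s + \<theta> * (m i s' - m i s))\<bar> \<le> e)"
    and U: "\<And>s. s \<in> S \<Longrightarrow> U s \<le> N"
    and m: "\<And>s i. s \<in> S \<Longrightarrow> i \<in> J \<Longrightarrow> \<bar>m i s\<bar> \<le> 1"
    and L: "L \<ge> 0" and \<delta>: "\<delta> > 0"
  obtains t where "t \<in> S"
    "\<And>s. s \<in> S \<Longrightarrow> U s - (\<Sum>i\<in>J. 2 * L * m i t * m i s) \<le> U t - 2 * L * (\<Sum>i\<in>J. (m i t)\<^sup>2) + \<delta>"
proof -
  define n where "n = real (card J)"
  have n: "n \<ge> 0" by (simp add: n_def)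
  define H where "H s = U s - L * (\<Sum>i\<in>J. (m i s)\<^sup>2)" for s
  \<comment> \<open>The step length from \<open>t\<close> towards a competitor \<open>s\<close>.
    Squared differences of the \<open>m i\<close> are at most 4, so curvature costs at most
    \<open>\<theta>\<^sup>2 * 4 * (L * n)\<close>, which after division by \<open>\<theta>\<close>
    is at most \<open>\<delta> / 2\<close>.\<close>
  define \<theta> where "\<theta> = min 1 (\<delta> / (8 * (L * n) + 1))"
  have Ln: "L * n \<ge> 0" using L n by simp
  have \<theta>: "0 < \<theta>" "\<theta> \<le> 1" using \<delta> Ln by (auto simp: \<theta>_def)
  have "\<theta> * (8 * (L * n) + 1) \<le> \<delta>"
    using pos_le_divide_eq[of "8 * (L * n) + 1" \<theta> \<delta>] Ln unfolding \<theta>_def by simp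
  then have \<theta>L: "\<theta> * (4 * (L * n)) \<le> \<delta> / 2" using \<theta> by (simp add: algebra_simps)
  \<comment> \<open>The gap to the supremum must be of order \<open>\<theta>\<close>, because it too
    is divided by \<open>\<theta>\<close> at the end; \<open>2 * \<epsilon>\<close> then becomes the
    other \<open>\<delta> / 2\<close>.\<close>
  define \<epsilon> where "\<epsilon> = \<theta> * \<delta> / 4"
  have \<epsilon>: "\<epsilon> > 0" using \<theta> \<delta> by (simp add: \<epsilon>_def)
  have HN: "H s \<le> N" if "s \<in> S" for s
    using U[OF that] L by (simp add: H_def) (smt (verit) sum_nonneg zero_le_power2 mult_nonneg_nonneg)
  have bdd: "bdd_above (H ` S)" using HN by (intro bdd_aboveI2)
  have "\<exists>t\<in>S. (SUP s\<in>S. H s) - \<epsilon> < H t"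
    using S \<epsilon> by (subst less_cSUP_iff[OF _ bdd, symmetric]) auto
  then obtain t where t: "t \<in> S" "(SUP s\<in>S. H s) - \<epsilon> < H t" by blast
  have opt: "H s \<le> H t + \<epsilon>" if "s \<in> S" for s
    using cSUP_upper[OF that bdd] t(2) by linarith
  have "U s - (\<Sum>i\<in>J. 2 * L * m i t * m i s) \<le> U t - 2 * L * (\<Sum>i\<in>J. (m i t)\<^sup>2) + \<delta>" if s: "s \<in> S" for s
  proof -
    define M where "M i = m i t + \<theta> * (m i s - m i t)" for i
    \<comment> \<open>An error \<open>e\<close> in every coordinate raises each square by at most
      \<open>3 * e\<close>, so it lowers \<open>H\<close> by at most
      \<open>e * (1 + 3 * (L * n))\<close>, which this choice keeps below
      \<open>\<epsilon>\<close>.\<close>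
    define e where "e = min 1 (\<epsilon> / (1 + 3 * (L * n)))"
    have e: "e > 0" "e \<le> 1" using \<epsilon> Ln by (auto simp: e_def)
    have eL: "e * (1 + 3 * (L * n)) \<le> \<epsilon>" using pos_le_divide_eq[of "1 + 3 * (L * n)" e \<epsilon>] Ln unfolding e_def by simp
    obtain r where r: "r \<in> S" "\<bar>U r - (U t + \<theta> * (U s - U t))\<bar> \<le> e"
      "\<And>i. i \<in> J \<Longrightarrow> \<bar>m i r - M i\<bar> \<le> e"
      using conv[OF t(1) s, of \<theta> e] \<theta> e unfolding M_def by auto
    have sq: "(m i r)\<^sup>2 \<le> (M i)\<^sup>2 + 3 * e" if i: "i \<in> J" for i
    proof -
      have "\<bar>M i\<bar> = \<bar>(1 - \<theta>) * m i t + \<theta> * m i s\<bar>" by (simp add: M_def algebra_simps)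
      also have "\<dots> \<le> (1 - \<theta>) * \<bar>m i t\<bar> + \<theta> * \<bar>m i s\<bar>"
        using \<theta> by (intro order_trans[OF abs_triangle_ineq]) (simp add: abs_mult)
      also have "\<dots> \<le> (1 - \<theta>) * 1 + \<theta> * 1"
        using \<theta> m[OF t(1) i] m[OF s i] by (intro add_mono mult_left_mono) auto
      finally have M1: "\<bar>M i\<bar> \<le> 1" by simp
      have "(m i r)\<^sup>2 = (M i)\<^sup>2 + (m i r - M i) * (2 * M i + (m i r - M i))"
        by (simp add: power2_eq_square algebra_simps)
      also have "(m i r - M i) * (2 * M i + (m i r - M i)) \<le> \<bar>m i r - M i\<bar> * \<bar>2 * M i + (m i r - M i)\<bar>"
        by (metis abs_ge_self abs_mult)
      also have "\<dots> \<le> e * 3" using r(3)[OF i] M1 e by (intro mult_mono) auto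
      finally show ?thesis by simp
    qed
    have "(\<Sum>i\<in>J. (m i r)\<^sup>2) \<le> (\<Sum>i\<in>J. (M i)\<^sup>2 + 3 * e)" by (intro sum_mono sq)
    also have "\<dots> = (\<Sum>i\<in>J. (M i)\<^sup>2) + n * (3 * e)" by (simp add: sum.distrib n_def)
    finally have "L * (\<Sum>i\<in>J. (m i r)\<^sup>2) \<le> L * ((\<Sum>i\<in>J. (M i)\<^sup>2) + n * (3 * e))"
      using L by (rule mult_left_mono)
    then have "L * (\<Sum>i\<in>J. (m i r)\<^sup>2) \<le> L * (\<Sum>i\<in>J. (M i)\<^sup>2) + e * (3 * (L * n))"
      by (simp add: algebra_simps)
    then have "U t + \<theta> * (U s - U t) - L * (\<Sum>i\<in>J. (M i)\<^sup>2) \<le> H r + e * (1 + 3 * (L * n))"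
      using r(2) unfolding H_def by (simp add: algebra_simps)
    also have "\<dots> \<le> H t + 2 * \<epsilon>" using opt[OF r(1)] eL by linarith
    finally have 1: "\<theta> * (U s - U t) - L * (\<Sum>i\<in>J. (M i)\<^sup>2) \<le> - L * (\<Sum>i\<in>J. (m i t)\<^sup>2) + 2 * \<epsilon>"
      unfolding H_def by simp
    \<comment> \<open>Expansion of the squares at \<open>t\<close>. The linear term survives
      division by \<open>\<theta>\<close> and produces the multipliers.\<close>
    have "(\<Sum>i\<in>J. (M i)\<^sup>2) \<le> (\<Sum>i\<in>J. (m i t)\<^sup>2 + \<theta> * (2 * (m i t * (m i s - m i t))) + \<theta>\<^sup>2 * 4)"
    proof (rule sum_mono)
      fix i assume i: "i \<in> J"
      have "\<bar>m i s - m i t\<bar> \<le> 2" using m[OF t(1) i] m[OF s i] by linarith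
      then have "(m i s - m i t)\<^sup>2 \<le> 4" using abs_le_square_iff[of "m i s - m i t" 2] by simp
      then have "\<theta>\<^sup>2 * (m i s - m i t)\<^sup>2 \<le> \<theta>\<^sup>2 * 4" by (intro mult_left_mono) auto
      then show "(M i)\<^sup>2 \<le> (m i t)\<^sup>2 + \<theta> * (2 * (m i t * (m i s - m i t))) + \<theta>\<^sup>2 * 4"
        unfolding M_def by (simp add: power2_eq_square algebra_simps)
    qed
    also have "\<dots> = (\<Sum>i\<in>J. (m i t)\<^sup>2) + \<theta> * (2 * (\<Sum>i\<in>J. m i t * (m i s - m i t))) + n * (\<theta>\<^sup>2 * 4)"
      by (simp add: sum.distrib n_def sum_distrib_left)
    finally have "L * (\<Sum>i\<in>J. (M i)\<^sup>2) \<le> L * ((\<Sum>i\<in>J. (m i t)\<^sup>2) + \<theta> * (2 * (\<Sum>i\<in>J. m i t * (m i s - m i t))) + n * (\<theta>\<^sup>2 * 4))"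
      using L by (rule mult_left_mono)
    with 1 have "\<theta> * (U s - U t) \<le> 2 * \<epsilon> + L * (\<theta> * (2 * (\<Sum>i\<in>J. m i t * (m i s - m i t))) + n * (\<theta>\<^sup>2 * 4))"
      by (simp add: algebra_simps)
    also have "\<dots> = \<theta> * (\<delta> / 2 + 2 * L * (\<Sum>i\<in>J. m i t * (m i s - m i t)) + \<theta> * (4 * (L * n)))"
      by (simp add: \<epsilon>_def power2_eq_square algebra_simps)
    also have "\<dots> \<le> \<theta> * (\<delta> / 2 + 2 * L * (\<Sum>i\<in>J. m i t * (m i s - m i t)) + \<delta> / 2)"
      using \<theta>(1) \<theta>L by (intro mult_left_mono[OF add_left_mono]) auto
    finally have "U s - U t \<le> \<delta> / 2 + 2 * L * (\<Sum>i\<in>J. m i t * (m i s - m i t)) + \<delta> / 2"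
      using \<theta> by simp
    moreover have "2 * L * (\<Sum>i\<in>J. m i t * (m i s - m i t)) = (\<Sum>i\<in>J. 2 * L * m i t * m i s) - 2 * L * (\<Sum>i\<in>J. (m i t)\<^sup>2)"
      by (simp add: sum_distrib_left sum_subtractf right_diff_distrib power2_eq_square mult.assoc)
    ultimately show ?thesis by linarith
  qed
  with t(1) show thesis by (intro that)
qed

section \<open>Payoffs of strategies and the dual pair obtained from a near maximiser\<close>

lemma continuous_on_slice:
  assumes "continuous_on UNIV (c :: 'a::topological_space \<times> 'b::topological_space \<Rightarrow> real)"
  shows "continuous_on UNIV (\<lambda>x. c (x, y))"
  by (rule continuous_on_compose2[OF assms]) (auto intro!: continuous_intros)

lemma measurable_cost_slice:
  assumes c: "continuous_on UNIV (c :: 'a::topological_space \<times> 'b::topological_space \<Rightarrow> real)" and "sets \<mu> = sets borel"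
  shows "(\<lambda>x. c (x, y)) \<in> borel_measurable \<mu>"
proof -
  have "(\<lambda>x. c (x, y)) \<in> borel_measurable borel"
    by (rule borel_measurable_continuous_onI[OF continuous_on_slice[OF c]])
  then show ?thesis using assms(2) by (simp cong: measurable_cong_sets)
qed

lemma integrable_bounded:
  assumes "finite_measure \<mu>" "f \<in> borel_measurable \<mu>" "\<And>x. \<bar>f x\<bar> \<le> (K::real)"
  shows "integrable \<mu> f"
  using assms by (intro finite_measure.integrable_const_bound[where B=K]) auto

lemma integrable_cost_strategy:
  fixes c :: "'a::topological_space \<times> 'b::euclidean_space \<Rightarrow> real"
  assumes "finite_measure \<mu>" "sets \<mu> = sets borel" "continuous_on UNIV c" "\<And>z. \<bar>c z\<bar> \<le> N" "s \<in> strategies \<mu>"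
  shows "integrable \<mu> (\<lambda>x. c (x, bary (s x)))"
  using assms by (intro integrable_bounded[where K=N] measurable_strategy[OF assms(5), where F="\<lambda>x \<kappa>. c (x, bary \<kappa>)"]
      measurable_cost_slice) auto

text \<open>At each \<open>x\<close> take \<open>y\<close> near optimal for the conjugate and a pmf
  near optimal for the hull at \<open>y\<close>. For a fixed pmf, being good is an open condition on
  \<open>x\<close>, because the conjugate and \<open>c\<close> are continuous; hence countably many
  pmfs serve everywhere and finitely many serve outside a set of small measure. The point mass at 0
  is used there, with a bounded loss. The randomness of strategies thus attains the hull while only
  \<open>\<psi>\<close> itself is paid.\<close>

lemma conjugate_cost_selection:
  fixes c :: "'a::{metric_space, second_countable_topology} \<times> 'b::euclidean_space \<Rightarrow> real"
  assumes \<mu>: "prob_space \<mu>" "sets \<mu> = sets borel"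
    and c_cont: "continuous_on UNIV c" and c_bound: "\<And>z. \<bar>c z\<bar> \<le> N"
    and \<alpha>: "\<alpha> > 0" and lower: "\<And>y. \<alpha> * norm y - \<beta> \<le> \<psi> y" and upper: "\<And>y. \<psi> y \<le> \<beta> * (1 + norm y)"
    and e: "e > 0"
  obtains s where "s \<in> strategies \<mu>"
    "(\<integral>x. conjugate_cost c (convex_hull_fun \<psi>) x \<partial>\<mu>) \<le> (\<integral>x. c (x, bary (s x)) - pexp (s x) \<psi> \<partial>\<mu>) + e"
proof -
  interpret prob_space \<mu> by fact
  have sp[simp]: "space \<mu> = UNIV" using sets_eq_imp_space_eq[OF \<mu>(2)] by simp
  note hull = convex_hull_fun_le[OF \<alpha> lower] convex_hull_fun_ge[OF \<alpha> lower]
    continuous_on_convex_hull_fun[OF \<alpha> lower] convex_hull_fun_approx[OF \<alpha> lower]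
  have hull0: "convex_hull_fun \<psi> 0 \<le> \<beta>" using hull(1)[of 0] upper[of 0] by simp
  note conj = c_cont c_bound \<alpha> hull(2) hull0
  define \<phi> where "\<phi> = conjugate_cost c (convex_hull_fun \<psi>)"
  have \<phi>c: "continuous_on UNIV \<phi>" unfolding \<phi>_def by (rule continuous_on_conjugate_cost[OF conj])
  have \<phi>b: "\<bar>\<phi> x\<bar> \<le> N + \<beta>" for x unfolding \<phi>_def by (rule conjugate_cost_bound[OF conj])
  define good where "good x \<kappa> \<longleftrightarrow> \<phi> x - e / 2 < c (x, bary \<kappa>) - pexp \<kappa> \<psi>" for x \<kappa>
  have "\<exists>U. open U \<and> x \<in> U \<and> (\<exists>\<kappa>. finite (set_pmf \<kappa>) \<and> (\<forall>x\<in>U. good x \<kappa>))" for x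
  proof -
    obtain y where y: "\<phi> x - e / 4 < c (x, y) - convex_hull_fun \<psi> y"
      using conjugate_cost_approx[OF conj, of "e / 4" x] e unfolding \<phi>_def by auto
    obtain \<kappa> where \<kappa>: "finite (set_pmf \<kappa>)" "bary \<kappa> = y" "pexp \<kappa> \<psi> < convex_hull_fun \<psi> y + e / 4"
      using hull(4)[of "e / 4" y] e by auto
    have "good x \<kappa>" unfolding good_def using y \<kappa> by simp
    moreover have "open {x. good x \<kappa>}" unfolding good_def
      by (intro open_Collect_less continuous_intros \<phi>c continuous_on_slice[OF c_cont])
    ultimately show ?thesis using \<kappa>(1) by (intro exI[of _ "{x. good x \<kappa>}"]) blast
  qed
  then obtain U :: "nat \<Rightarrow> 'a set" where U: "\<forall>n. open (U n)"
      "\<forall>n. \<exists>\<kappa>. finite (set_pmf \<kappa>) \<and> (\<forall>x\<in>U n. good x \<kappa>)" "(\<Union>n. U n) = UNIV"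
    by (rule countable_open_cover[of "\<lambda>U. \<exists>\<kappa>. finite (set_pmf \<kappa>) \<and> (\<forall>x\<in>U. good x \<kappa>)"])
  then obtain \<kappa> where \<kappa>: "\<And>n. finite (set_pmf (\<kappa> n))" "\<And>n x. x \<in> U n \<Longrightarrow> good x (\<kappa> n)" by metis
  have Um[measurable]: "U n \<in> sets \<mu>" for n using U(1) \<mu>(2) by auto
  define V where "V n = (\<Union>i<n. U i)" for n
  have Vm[measurable]: "V n \<in> sets \<mu>" for n unfolding V_def by measurable
  have "(\<lambda>n. measure \<mu> (V n)) \<longlonglongrightarrow> measure \<mu> (\<Union>n. V n)"
    by (rule finite_Lim_measure_incseq) (auto simp: V_def lessThan_Suc intro!: incseq_SucI)
  moreover have "(\<Union>n. V n) = UNIV" using U(3) unfolding V_def by blast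
  ultimately have lim: "(\<lambda>n. measure \<mu> (V n)) \<longlonglongrightarrow> 1" using prob_space by simp
  have N\<beta>: "0 \<le> N + \<beta>" using \<phi>b[of undefined] by linarith
  define W where "W = N + \<beta> + 1"
  have W: "W > 0" using N\<beta> by (simp add: W_def)
  \<comment> \<open>On the uncovered set the loss is at most \<open>2 * (N + \<beta>)\<close>, so
    mass \<open>d\<close> contributes at most \<open>2 * W * d = e / 2\<close>.\<close>
  define d where "d = e / (4 * W)"
  have d: "d > 0" using e W unfolding d_def by (intro divide_pos_pos) auto
  have "eventually (\<lambda>n. 1 - d < measure \<mu> (V n)) sequentially"
    using lim d by (intro order_tendstoD) auto
  then obtain n where n: "1 - d < measure \<mu> (V n)" by (auto simp: eventually_sequentially)
  \<comment> \<open>Later sets override earlier ones, which is harmless because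
    \<open>\<kappa> n\<close> is good on all of \<open>U n\<close>.\<close>
  have "\<exists>s\<in>strategies \<mu>. (\<forall>x\<in>V n. good x (s x)) \<and> (\<forall>x. x \<notin> V n \<longrightarrow> s x = return_pmf 0)" for n
  proof (induction n)
    case 0
    show ?case by (rule bexI[of _ "\<lambda>_. return_pmf 0"]) (auto simp: V_def strategies_def)
  next
    case (Suc n)
    then obtain s where s: "s \<in> strategies \<mu>" "\<forall>x\<in>V n. good x (s x)" "\<forall>x. x \<notin> V n \<longrightarrow> s x = return_pmf 0" by blast
    have "(\<lambda>_. \<kappa> n) \<in> strategies \<mu>" using \<kappa>(1) by (simp add: strategies_def)
    from strategies_If[OF this s(1) Um[of n]] s(2,3) \<kappa>(2)[of _ n] show ?case
      by (intro bexI[of _ "\<lambda>x. if x \<in> U n then \<kappa> n else s x"]) (auto simp: V_def lessThan_Suc)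
  qed
  then obtain s where s: "s \<in> strategies \<mu>" "\<And>x. x \<in> V n \<Longrightarrow> good x (s x)" "\<And>x. x \<notin> V n \<Longrightarrow> s x = return_pmf 0" by metis
  have ints: "integrable \<mu> (\<lambda>x. c (x, bary (s x)) - pexp (s x) \<psi>)"
    by (intro Bochner_Integration.integrable_diff integrable_cost_strategy[OF finite_measure_axioms \<mu>(2) c_cont c_bound s(1)]
        integrable_pexp_strategy[OF finite_measure_axioms s(1)])
  have \<phi>m: "\<phi> \<in> borel_measurable \<mu>"
    using borel_measurable_continuous_onI[OF \<phi>c] \<mu>(2) by (simp cong: measurable_cong_sets)
  have \<phi>i: "integrable \<mu> \<phi>"
    by (rule integrable_bounded[OF finite_measure_axioms \<phi>m \<phi>b])
  have Vc[measurable]: "UNIV - V n \<in> sets \<mu>" using Vm[of n] by (metis sets.compl_sets sp)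
  have le: "\<phi> x \<le> (c (x, bary (s x)) - pexp (s x) \<psi>) + (e / 2 + 2 * (N + \<beta>) * indicator (UNIV - V n) x)" for x
  proof (cases "x \<in> V n")
    case True
    then show ?thesis using s(2)[OF True] by (simp add: good_def)
  next
    case False
    then have "s x = return_pmf 0" by (rule s(3))
    then have "c (x, bary (s x)) - pexp (s x) \<psi> \<ge> - (N + \<beta>)"
      using c_bound[of "(x, 0)"] upper[of 0] by simp
    then show ?thesis using False \<phi>b[of x] e by simp
  qed
  have "(\<integral>x. \<phi> x \<partial>\<mu>) \<le> (\<integral>x. (c (x, bary (s x)) - pexp (s x) \<psi>) + (e / 2 + 2 * (N + \<beta>) * indicator (UNIV - V n) x) \<partial>\<mu>)"
    by (intro integral_mono \<phi>i Bochner_Integration.integrable_add ints le)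
       (auto intro!: integrable_mult_right integrable_real_indicator simp: less_top[symmetric])
  also have "\<dots> = (\<integral>x. c (x, bary (s x)) - pexp (s x) \<psi> \<partial>\<mu>) + (e / 2 + 2 * (N + \<beta>) * measure \<mu> (UNIV - V n))"
  proof -
    have i: "integrable \<mu> (\<lambda>x. 2 * (N + \<beta>) * indicator (UNIV - V n) x)"
      by (auto intro!: integrable_mult_right integrable_real_indicator simp: less_top[symmetric])
    have "(\<integral>x. e / 2 + 2 * (N + \<beta>) * indicator (UNIV - V n) x \<partial>\<mu>) = e / 2 + 2 * (N + \<beta>) * measure \<mu> (UNIV - V n)"
      using prob_space by (subst Bochner_Integration.integral_add[OF _ i]) auto
    then show ?thesis using i by (subst Bochner_Integration.integral_add[OF ints]) auto
  qed
  also have "measure \<mu> (UNIV - V n) = 1 - measure \<mu> (V n)" using prob_compl[OF Vm, of n] by simp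
  also have "2 * (N + \<beta>) * (1 - measure \<mu> (V n)) \<le> 2 * W * d"
    using n N\<beta> d by (intro mult_mono) (auto simp: W_def)
  also have "2 * W * d = e / 2" using W by (simp add: d_def)
  finally show thesis using that[OF s(1)] unfolding \<phi>_def by simp
qed

text \<open>Replacing \<open>s\<close> by \<open>s'\<close> on a set \<open>A\<close> changes the
  integral of \<open>F j\<close> by the integral of the difference \<open>G j\<close> over
  \<open>A\<close>. One set from \<open>approx_lyapunov\<close> makes this close to the fraction
  \<open>\<theta>\<close> for all \<open>j\<close> at once. This is where atomlessness enters the
  duality.\<close>

lemma strategies_approx_convex:
  fixes \<mu> :: "'a::{metric_space, second_countable_topology} measure" and F :: "'j \<Rightarrow> 'a \<Rightarrow> 'b pmf \<Rightarrow> real"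
  assumes \<mu>: "prob_space \<mu>" "sets \<mu> = sets borel" and atomless: "\<And>x. emeasure \<mu> {x} = 0"
    and J: "finite J" and F: "\<And>j \<kappa>. j \<in> J \<Longrightarrow> (\<lambda>x. F j x \<kappa>) \<in> borel_measurable \<mu>"
    and s: "s \<in> strategies \<mu>" "s' \<in> strategies \<mu>"
    and K: "\<And>j x. j \<in> J \<Longrightarrow> \<bar>F j x (s x)\<bar> \<le> K j" "\<And>j x. j \<in> J \<Longrightarrow> \<bar>F j x (s' x)\<bar> \<le> K j"
    and \<theta>: "0 \<le> \<theta>" "\<theta> \<le> 1" and e: "e > 0"
  shows "\<exists>t\<in>strategies \<mu>. \<forall>j\<in>J. \<bar>(\<integral>x. F j x (t x) \<partial>\<mu>)
    - ((\<integral>x. F j x (s x) \<partial>\<mu>) + \<theta> * ((\<integral>x. F j x (s' x) \<partial>\<mu>) - (\<integral>x. F j x (s x) \<partial>\<mu>)))\<bar> \<le> e"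
proof -
  interpret prob_space \<mu> by fact
  define G where "G j x = F j x (s' x) - F j x (s x)" for j x
  have m: "(\<lambda>x. F j x (s x)) \<in> borel_measurable \<mu>" "(\<lambda>x. F j x (s' x)) \<in> borel_measurable \<mu>" if "j \<in> J" for j
    using measurable_strategy[OF s(1), of "F j"] measurable_strategy[OF s(2), of "F j"] F[OF that] by auto
  have i: "integrable \<mu> (\<lambda>x. F j x (s x))" "integrable \<mu> (\<lambda>x. F j x (s' x))" if "j \<in> J" for j
    using m[OF that] K[OF that] by (auto intro!: integrable_bounded finite_measure_axioms)
  have Gm: "G j \<in> borel_measurable \<mu>" if "j \<in> J" for j
    unfolding G_def using m[OF that] by simp
  have K0: "0 \<le> K j" if "j \<in> J" for j using K(1)[OF that, of undefined] by linarith
  have GB: "\<bar>G j x\<bar> \<le> 2 * (\<Sum>j\<in>J. K j)" if "j \<in> J" for j x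
  proof -
    have "\<bar>G j x\<bar> \<le> 2 * K j" unfolding G_def using K[OF that, of x] by linarith
    also have "K j \<le> (\<Sum>j\<in>J. K j)" using J K0 that by (intro member_le_sum) auto
    finally show ?thesis by simp
  qed
  obtain A where A: "A \<in> sets \<mu>"
    "\<forall>j\<in>J. \<bar>(\<integral>x. indicator A x * G j x \<partial>\<mu>) - \<theta> * (\<integral>x. G j x \<partial>\<mu>)\<bar> \<le> e"
    by (rule approx_lyapunov[OF \<mu> atomless J Gm GB \<theta> e])
  define t where "t x = (if x \<in> A then s' x else s x)" for x
  have "\<bar>(\<integral>x. F j x (t x) \<partial>\<mu>)
    - ((\<integral>x. F j x (s x) \<partial>\<mu>) + \<theta> * ((\<integral>x. F j x (s' x) \<partial>\<mu>) - (\<integral>x. F j x (s x) \<partial>\<mu>)))\<bar> \<le> e" if j: "j \<in> J" for j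
  proof -
    have Gi: "integrable \<mu> (\<lambda>x. indicator A x * G j x)"
    proof (rule integrable_bounded[OF finite_measure_axioms])
      show "(\<lambda>x. indicator A x * G j x) \<in> borel_measurable \<mu>" using Gm[OF j] A(1) by measurable
      show "\<bar>indicator A x * G j x\<bar> \<le> 2 * (\<Sum>j\<in>J. K j)" for x
        using GB[OF j, of x] by (cases "x \<in> A") auto
    qed
    have "(\<integral>x. F j x (t x) \<partial>\<mu>) = (\<integral>x. F j x (s x) + indicator A x * G j x \<partial>\<mu>)"
      by (rule Bochner_Integration.integral_cong) (auto simp: t_def G_def)
    also have "\<dots> = (\<integral>x. F j x (s x) \<partial>\<mu>) + (\<integral>x. indicator A x * G j x \<partial>\<mu>)"
      by (rule Bochner_Integration.integral_add[OF i(1)[OF j] Gi])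
    moreover have "(\<integral>x. G j x \<partial>\<mu>) = (\<integral>x. F j x (s' x) \<partial>\<mu>) - (\<integral>x. F j x (s x) \<partial>\<mu>)"
      unfolding G_def by (rule Bochner_Integration.integral_diff[OF i(2,1)[OF j]])
    ultimately show ?thesis using A(2)[rule_format, OF j] by simp
  qed
  moreover have "t \<in> strategies \<mu>" unfolding t_def by (rule strategies_If[OF s(2,1) A(1)])
  ultimately show ?thesis by blast
qed

text \<open>The first-order condition at the near maximiser \<open>t\<close> is applied to a
  strategy \<open>s\<close> that nearly attains the conjugate for the price. The negative terms kept
  in the conclusion are what later forces the tail excess and the mismatches of \<open>t\<close> to
  be small.\<close>

lemma penalised_duality:
  fixes c :: "'a::{metric_space, second_countable_topology} \<times> 'b::euclidean_space \<Rightarrow> real"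
    and f :: "'i \<Rightarrow> 'b \<Rightarrow> real" and g :: "'b \<Rightarrow> real"
  assumes \<mu>: "prob_space \<mu>" "sets \<mu> = sets borel" and atomless: "\<And>x. emeasure \<mu> {x} = 0"
    and \<nu>: "prob_space \<nu>" "sets \<nu> = sets borel" "integrable \<nu> norm"
    and c_cont: "continuous_on UNIV c" and c_bound: "\<And>z. \<bar>c z\<bar> \<le> N"
    and g_cont: "continuous_on UNIV g" and g: "\<And>y. 0 \<le> g y" "\<And>y. norm y - R \<le> g y" "\<And>y. g y \<le> norm y"
    and J: "finite J" and f_cont: "\<And>i. i \<in> J \<Longrightarrow> continuous_on UNIV (f i)"
    and f: "\<And>i y. i \<in> J \<Longrightarrow> 0 \<le> f i y" "\<And>i y. i \<in> J \<Longrightarrow> f i y \<le> 1"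
    and A: "A > 0" and L: "L \<ge> 0" and \<delta>: "\<delta> > 0"
  obtains s \<phi> \<psi> C where "s \<in> strategies \<mu>"
    "continuous_on UNIV \<phi>" "\<And>x. \<bar>\<phi> x\<bar> \<le> C"
    "continuous_on UNIV \<psi>" "convex_on UNIV \<psi>" "\<And>y. \<bar>\<psi> y\<bar> \<le> C * (1 + norm y)"
    "\<And>x y. c (x, y) \<le> \<phi> x + \<psi> y"
    "(\<integral>x. \<phi> x \<partial>\<mu>) + (\<integral>y. \<psi> y \<partial>\<nu>) \<le> (\<integral>x. c (x, bary (s x)) \<partial>\<mu>) - A * (\<integral>x. pexp (s x) g \<partial>\<mu>)
      + A * (\<integral>y. g y \<partial>\<nu>) - 2 * L * (\<Sum>i\<in>J. ((\<integral>x. pexp (s x) (f i) \<partial>\<mu>) - (\<integral>y. f i y \<partial>\<nu>))\<^sup>2) + \<delta>"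
proof -
  interpret prob_space \<mu> by fact
  interpret N: prob_space \<nu> by fact
  have sp[simp]: "space \<mu> = UNIV" using sets_eq_imp_space_eq[OF \<mu>(2)] by simp
  have bm: "h \<in> borel_measurable \<nu>" if "continuous_on UNIV h" for h :: "'b \<Rightarrow> real"
    using borel_measurable_continuous_onI[OF that] \<nu>(2) by (simp cong: measurable_cong_sets)
  have fi: "integrable \<nu> (f i)" if "i \<in> J" for i
    using f[OF that] bm[OF f_cont[OF that]]
    by (intro integrable_bounded[where K=1] N.finite_measure_axioms) (auto simp: abs_le_iff intro: order_trans)
  have gi: "integrable \<nu> g"
    using bm[OF g_cont] g by (intro Bochner_Integration.integrable_bound[OF \<nu>(3)]) auto
  define w where "w i = (\<integral>y. f i y \<partial>\<nu>)" for i
  have w: "0 \<le> w i" "w i \<le> 1" if "i \<in> J" for i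
  proof -
    show "0 \<le> w i" unfolding w_def using f(1)[OF that] by simp
    have "w i \<le> (\<integral>y. 1 \<partial>\<nu>)" unfolding w_def using f(2)[OF that] fi[OF that] by (intro integral_mono) auto
    then show "w i \<le> 1" using N.prob_space by simp
  qed
  \<comment> \<open>One index set for everything that must move along a segment: \<open>None\<close>
    for the payoff with its linear tail penalty, \<open>Some i\<close> for the test
    integrals.\<close>
  define F where "F k x \<kappa> = (case k of None \<Rightarrow> c (x, bary \<kappa>) - A * pexp \<kappa> g | Some i \<Rightarrow> pexp \<kappa> (f i))" for k x \<kappa>
  define U where "U s = (\<integral>x. F None x (s x) \<partial>\<mu>)" for s
  define m where "m i s = (\<integral>x. F (Some i) x (s x) \<partial>\<mu>) - w i" for i s
  have Fm: "(\<lambda>x. F k x \<kappa>) \<in> borel_measurable \<mu>" for k \<kappa>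
    unfolding F_def using measurable_cost_slice[OF c_cont \<mu>(2)] by (cases k) auto
  note Ui = integrable_cost_strategy[OF finite_measure_axioms \<mu>(2) c_cont c_bound]
    and Pi = integrable_pexp_strategy[OF finite_measure_axioms]
  have Ueq: "U s = (\<integral>x. c (x, bary (s x)) \<partial>\<mu>) - A * (\<integral>x. pexp (s x) g \<partial>\<mu>)" if "s \<in> strategies \<mu>" for s
    unfolding U_def F_def using Ui[OF that] Pi[OF that] by simp
  have pexp01: "0 \<le> pexp \<kappa> (f i)" "pexp \<kappa> (f i) \<le> 1" if "finite (set_pmf \<kappa>)" "i \<in> J" for i \<kappa>
    using f[OF that(2)] pexp_mono[OF that(1), of "f i" "\<lambda>_. 1"] by (auto simp: measure_pmf.prob_space)
  have fins: "finite (set_pmf (s x))" if "s \<in> strategies \<mu>" for s :: "'a \<Rightarrow> 'b pmf" and x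
    using that by (simp add: strategies_def)
  have bound: "\<exists>K. \<forall>x. \<bar>F k x (s x)\<bar> \<le> K" if s: "s \<in> strategies \<mu>" for s k
  proof (cases k)
    case None
    obtain K where K: "\<And>x. \<bar>pexp (s x) g\<bar> \<le> K" using bounded_pexp_strategy[OF s sp] by blast
    have "\<bar>F k x (s x)\<bar> \<le> N + A * K" for x
    proof -
      have "\<bar>F k x (s x)\<bar> \<le> \<bar>c (x, bary (s x))\<bar> + A * \<bar>pexp (s x) g\<bar>"
        using abs_triangle_ineq4[of "c (x, bary (s x))" "A * pexp (s x) g"] A by (simp add: F_def None abs_mult)
      also have "\<dots> \<le> N + A * K" using A K by (intro add_mono c_bound mult_left_mono) auto
      finally show ?thesis .
    qed
    then show ?thesis by blast
  next
    case (Some i)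
    obtain K where K: "\<And>x. \<bar>pexp (s x) (f i)\<bar> \<le> K" using bounded_pexp_strategy[OF s sp] by blast
    then show ?thesis by (auto simp: F_def Some)
  qed
  have conv: "\<exists>t\<in>strategies \<mu>. \<bar>U t - (U s + \<theta> * (U s' - U s))\<bar> \<le> e \<and>
        (\<forall>i\<in>J. \<bar>m i t - (m i s + \<theta> * (m i s' - m i s))\<bar> \<le> e)"
    if s: "s \<in> strategies \<mu>" "s' \<in> strategies \<mu>" and \<theta>: "0 \<le> \<theta>" "\<theta> \<le> 1" and e: "e > 0" for s s' \<theta> e
  proof -
    obtain K1 where K1: "\<And>k x. \<bar>F k x (s x)\<bar> \<le> K1 k" using bound[OF s(1)] by metis
    obtain K2 where K2: "\<And>k x. \<bar>F k x (s' x)\<bar> \<le> K2 k" using bound[OF s(2)] by metis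
    have K: "\<bar>F k x (s x)\<bar> \<le> max (K1 k) (K2 k)" "\<bar>F k x (s' x)\<bar> \<le> max (K1 k) (K2 k)" for k x
      using K1[of k x] K2[of k x] by linarith+
    obtain t where t: "t \<in> strategies \<mu>" "\<And>k. k \<in> insert None (Some ` J) \<Longrightarrow> \<bar>(\<integral>x. F k x (t x) \<partial>\<mu>)
      - ((\<integral>x. F k x (s x) \<partial>\<mu>) + \<theta> * ((\<integral>x. F k x (s' x) \<partial>\<mu>) - (\<integral>x. F k x (s x) \<partial>\<mu>)))\<bar> \<le> e"
      using strategies_approx_convex[where F=F and J="insert None (Some ` J)", OF \<mu> atomless _ Fm s K \<theta> e] J by blast
    have "\<bar>U t - (U s + \<theta> * (U s' - U s))\<bar> \<le> e" unfolding U_def by (rule t(2)) simp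
    moreover have "\<bar>m i t - (m i s + \<theta> * (m i s' - m i s))\<bar> \<le> e" if "i \<in> J" for i
      using t(2)[of "Some i"] that unfolding m_def by simp
    ultimately show ?thesis using t(1) by blast
  qed
  have UN: "U s \<le> N" if s: "s \<in> strategies \<mu>" for s
  proof -
    have "U s \<le> (\<integral>x. N \<partial>\<mu>)"
      unfolding U_def F_def option.case
    proof (rule integral_mono)
      fix x
      have "0 \<le> A * pexp (s x) g" using A g(1) by simp
      then show "c (x, bary (s x)) - A * pexp (s x) g \<le> N" using c_bound[of "(x, bary (s x))"] by linarith
    qed (use Ui[OF s] Pi[OF s] in auto)
    then show ?thesis using prob_space by simp
  qed
  have m1: "\<bar>m i s\<bar> \<le> 1" if s: "s \<in> strategies \<mu>" and i: "i \<in> J" for i s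
  proof -
    have "0 \<le> (\<integral>x. pexp (s x) (f i) \<partial>\<mu>)" using pexp01[OF fins[OF s] i] by simp
    moreover have "(\<integral>x. pexp (s x) (f i) \<partial>\<mu>) \<le> (\<integral>x. 1 \<partial>\<mu>)"
      using pexp01[OF fins[OF s] i] Pi[OF s] by (intro integral_mono) auto
    ultimately show ?thesis using w[OF i] prob_space unfolding m_def F_def by simp
  qed
  have s0: "(\<lambda>_. return_pmf 0) \<in> strategies \<mu>" by (simp add: strategies_def)
  obtain t where t: "t \<in> strategies \<mu>"
    "\<And>s. s \<in> strategies \<mu> \<Longrightarrow> U s - (\<Sum>i\<in>J. 2 * L * m i t * m i s) \<le> U t - 2 * L * (\<Sum>i\<in>J. (m i t)\<^sup>2) + \<delta> / 2"
    using penalised_first_order[OF J s0 conv UN m1 L, of "\<delta> / 2"] \<delta> by auto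
  define p where "p i = 2 * L * m i t" for i
  define \<psi> where "\<psi> y = (\<Sum>i\<in>J. p i * f i y) + A * g y" for y
  define P where "P = (\<Sum>i\<in>J. \<bar>p i\<bar>)"
  have P: "0 \<le> P" by (auto simp: P_def intro: sum_nonneg)
  have pf: "\<bar>\<Sum>i\<in>J. p i * f i y\<bar> \<le> P" for y
    unfolding P_def by (rule order_trans[OF sum_abs sum_mono]) (use f in \<open>auto simp: abs_mult mult_left_le\<close>)
  \<comment> \<open>\<open>P\<close> bounds the part of the price built from the \<open>f i\<close>.
    The other summand serves twice: it absorbs the loss caused by \<open>R\<close> in the coercive
    lower bound, and the slope \<open>A\<close> in the upper bound.\<close>
  define \<beta> where "\<beta> = P + A * (1 + \<bar>R\<bar>)"
  have \<beta>P: "P + A \<le> \<beta>" using A by (simp add: \<beta>_def algebra_simps)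
  have lower: "A * norm y - \<beta> \<le> \<psi> y" for y
  proof -
    have "A * (norm y - \<bar>R\<bar> - 1) \<le> A * g y" using g(2)[of y] A by (intro mult_left_mono) auto
    then show ?thesis using pf[of y] unfolding \<psi>_def \<beta>_def by (simp add: algebra_simps)
  qed
  have upper: "\<psi> y \<le> \<beta> * (1 + norm y)" for y
  proof -
    have "A * g y \<le> A * norm y" using g(3) A by simp
    then have "\<psi> y \<le> P * 1 + A * norm y" using pf[of y] unfolding \<psi>_def by linarith
    also have "\<dots> \<le> P * (1 + norm y) + A * (1 + norm y)" using P A by (intro add_mono mult_left_mono) auto
    also have "\<dots> = (P + A) * (1 + norm y)" by (simp add: algebra_simps)
    also have "\<dots> \<le> \<beta> * (1 + norm y)" using \<beta>P by (intro mult_right_mono) auto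
    finally show ?thesis .
  qed
  have \<psi>i: "integrable \<nu> \<psi>" unfolding \<psi>_def using fi gi by (intro Bochner_Integration.integrable_add integrable_mult_right
        Bochner_Integration.integrable_sum) auto
  define \<psi>' where "\<psi>' = convex_hull_fun \<psi>"
  define \<phi> where "\<phi> = conjugate_cost c \<psi>'"
  have h: "\<psi>' y \<le> \<psi> y" "A * norm y - \<beta> \<le> \<psi>' y" for y unfolding \<psi>'_def
    using convex_hull_fun_le[OF A lower] convex_hull_fun_ge[OF A lower] by auto
  have hc: "continuous_on UNIV \<psi>'" unfolding \<psi>'_def by (rule continuous_on_convex_hull_fun[OF A lower])
  have "\<psi>' 0 \<le> \<beta>" using h(1)[of 0] upper[of 0] by simp
  note conj = c_cont c_bound A h(2) this
  obtain s where s: "s \<in> strategies \<mu>"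
    "(\<integral>x. \<phi> x \<partial>\<mu>) \<le> (\<integral>x. c (x, bary (s x)) - pexp (s x) \<psi> \<partial>\<mu>) + \<delta> / 2"
    using conjugate_cost_selection[OF \<mu> c_cont c_bound A lower upper, of "\<delta> / 2"] \<delta> unfolding \<phi>_def \<psi>'_def by auto
  have growth: "\<bar>\<psi>' y\<bar> \<le> \<beta> * (1 + norm y)" for y
  proof -
    have "0 \<le> \<beta>" using P A \<beta>P by linarith
    then have "0 \<le> \<beta> * norm y" "0 \<le> A * norm y" using A by auto
    then show ?thesis using h[of y] upper[of y] by (simp add: algebra_simps abs_le_iff)
  qed
  have \<psi>'i: "integrable \<nu> \<psi>'"
  proof (rule Bochner_Integration.integrable_bound)
    show "integrable \<nu> (\<lambda>y. \<beta> * (1 + norm y))" using \<nu>(3) by auto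
    show "AE y in \<nu>. norm (\<psi>' y) \<le> norm (\<beta> * (1 + norm y))" using growth by (intro AE_I2) (simp, smt (verit))
  qed (rule bm[OF hc])
  have pexp\<psi>: "pexp \<kappa> \<psi> = (\<Sum>i\<in>J. p i * pexp \<kappa> (f i)) + A * pexp \<kappa> g" if "finite (set_pmf \<kappa>)" for \<kappa>
  proof -
    note [simp] = integrable_measure_pmf_finite[OF that]
    show ?thesis unfolding \<psi>_def by (simp add: Bochner_Integration.integral_sum)
  qed
  \<comment> \<open>The sum of the \<open>p i * w i\<close> that is split off here cancels when
    \<open>\<psi>\<close> is integrated against \<open>\<nu>\<close>. What remains is the expression
    that the first-order condition bounds.\<close>
  have "(\<integral>x. c (x, bary (s x)) - pexp (s x) \<psi> \<partial>\<mu>)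
      = (\<integral>x. c (x, bary (s x)) \<partial>\<mu>) - ((\<Sum>i\<in>J. p i * (\<integral>x. pexp (s x) (f i) \<partial>\<mu>)) + A * (\<integral>x. pexp (s x) g \<partial>\<mu>))"
    unfolding pexp\<psi>[OF fins[OF s(1)]] using Ui[OF s(1)] Pi[OF s(1)] by (simp add: Bochner_Integration.integral_sum)
  also have "\<dots> = U s - (\<Sum>i\<in>J. p i * m i s) - (\<Sum>i\<in>J. p i * w i)"
    unfolding Ueq[OF s(1)] m_def F_def by (simp add: algebra_simps sum_subtractf)
  finally have e1: "(\<integral>x. \<phi> x \<partial>\<mu>) \<le> U s - (\<Sum>i\<in>J. p i * m i s) - (\<Sum>i\<in>J. p i * w i) + \<delta> / 2" using s(2) by simp
  have "(\<integral>y. \<psi>' y \<partial>\<nu>) \<le> (\<integral>y. \<psi> y \<partial>\<nu>)" using \<psi>'i \<psi>i h(1) by (intro integral_mono) auto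
  also have "\<dots> = (\<Sum>i\<in>J. p i * w i) + A * (\<integral>y. g y \<partial>\<nu>)"
    unfolding \<psi>_def w_def using fi gi by (simp add: Bochner_Integration.integral_sum)
  finally have "(\<integral>x. \<phi> x \<partial>\<mu>) + (\<integral>y. \<psi>' y \<partial>\<nu>) \<le> U s - (\<Sum>i\<in>J. p i * m i s) + A * (\<integral>y. g y \<partial>\<nu>) + \<delta> / 2"
    using e1 by linarith
  also have "U s - (\<Sum>i\<in>J. p i * m i s) \<le> U t - 2 * L * (\<Sum>i\<in>J. (m i t)\<^sup>2) + \<delta> / 2"
    using t(2)[OF s(1)] unfolding p_def .
  finally have main: "(\<integral>x. \<phi> x \<partial>\<mu>) + (\<integral>y. \<psi>' y \<partial>\<nu>) \<le> (\<integral>x. c (x, bary (t x)) \<partial>\<mu>) - A * (\<integral>x. pexp (t x) g \<partial>\<mu>)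
      + A * (\<integral>y. g y \<partial>\<nu>) - 2 * L * (\<Sum>i\<in>J. ((\<integral>x. pexp (t x) (f i) \<partial>\<mu>) - (\<integral>y. f i y \<partial>\<nu>))\<^sup>2) + \<delta>"
    unfolding Ueq[OF t(1)] m_def F_def w_def by simp
  have N0: "0 \<le> N" using c_bound[of undefined] by linarith
  show thesis
  proof (rule that[OF t(1) _ _ hc _ _ _ main])
    show "continuous_on UNIV \<phi>" unfolding \<phi>_def by (rule continuous_on_conjugate_cost[OF conj])
    show "\<bar>\<phi> x\<bar> \<le> N + \<beta>" for x unfolding \<phi>_def by (rule conjugate_cost_bound[OF conj])
    show "convex_on UNIV \<psi>'" unfolding \<psi>'_def by (rule convex_on_convex_hull_fun[OF A lower])
    have "\<beta> * (1 + norm y) \<le> (N + \<beta>) * (1 + norm y)" for y :: 'b using N0 by (intro mult_right_mono) auto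
    then show "\<bar>\<psi>' y\<bar> \<le> (N + \<beta>) * (1 + norm y)" for y using growth[of y] by (rule order_trans[rotated])
    show "c (x, y) \<le> \<phi> x + \<psi>' y" for x y
      using conjugate_cost_ge[OF conj, of x y] unfolding \<phi>_def by linarith
  qed
qed

section \<open>Rounding strategies to couplings\<close>

text \<open>Each \<^term>\<open>q i\<close> is scaled down to total mass at most \<^term>\<open>w i\<close>, and the mass
  freed at \<^term>\<open>x\<close> is redistributed in proportion to the remaining deficits.\<close>

lemma rebalance_weights:
  fixes q :: "'i \<Rightarrow> 'a \<Rightarrow> real" and w :: "'i \<Rightarrow> real"
  assumes \<mu>: "prob_space \<mu>" and J: "finite J"
    and qm: "\<And>i. i \<in> J \<Longrightarrow> q i \<in> borel_measurable \<mu>" and q0: "\<And>i x. i \<in> J \<Longrightarrow> 0 \<le> q i x"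
    and q1: "\<And>x. (\<Sum>i\<in>J. q i x) = 1" and w0: "\<And>i. i \<in> J \<Longrightarrow> 0 \<le> w i" and w1: "(\<Sum>i\<in>J. w i) = 1"
  obtains k where "\<forall>i\<in>J. k i \<in> borel_measurable \<mu>" "\<forall>i\<in>J. \<forall>x. 0 \<le> k i x" "\<forall>x. (\<Sum>i\<in>J. k i x) = 1"
    "\<forall>i\<in>J. (\<integral>x. k i x \<partial>\<mu>) = w i" "\<forall>i\<in>J. w i = 0 \<longrightarrow> (\<forall>x. k i x = 0)"
    "(\<Sum>i\<in>J. \<integral>x. \<bar>k i x - q i x\<bar> \<partial>\<mu>) \<le> (\<Sum>i\<in>J. \<bar>(\<integral>x. q i x \<partial>\<mu>) - w i\<bar>)"
proof -
  interpret prob_space \<mu> by fact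
  have qle: "q i x \<le> 1" if "i \<in> J" for i x
    using member_le_sum[of i J "\<lambda>i. q i x"] that J q0 q1 by auto
  have qi: "integrable \<mu> (q i)" if "i \<in> J" for i
    using qm[OF that] q0[OF that] qle[OF that] by (intro integrable_bounded[where K=1] finite_measure_axioms) (auto simp: abs_le_iff intro: order_trans)
  define v where "v i = (\<integral>x. q i x \<partial>\<mu>)" for i
  have v0: "0 \<le> v i" if "i \<in> J" for i unfolding v_def using q0[OF that] by simp
  have v1: "(\<Sum>i\<in>J. v i) = 1"
  proof -
    have "(\<Sum>i\<in>J. v i) = (\<integral>x. (\<Sum>i\<in>J. q i x) \<partial>\<mu>)"
      unfolding v_def using qi by (subst Bochner_Integration.integral_sum) auto
    then show ?thesis using q1 prob_space by simp
  qed
  \<comment> \<open>For \<open>v i = 0\<close> division by zero gives \<open>a i = 0\<close>, in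
    agreement with \<open>a i * v i = min (w i) (v i)\<close>.\<close>
  define a where "a i = min 1 (w i / v i)" for i
  define d where "d i = w i - min (w i) (v i)" for i
  define D where "D = (\<Sum>i\<in>J. d i)"
  \<comment> \<open>With no deficit there is nothing to be proportional to; \<open>w\<close> is then
    a probability vector that still vanishes where \<open>w i = 0\<close>.\<close>
  define t where "t i = (if D = 0 then w i else d i / D)" for i
  define r where "r x = 1 - (\<Sum>i\<in>J. a i * q i x)" for x
  define k where "k i x = a i * q i x + r x * t i" for i x
  have d0: "0 \<le> d i" for i by (simp add: d_def)
  have D0: "0 \<le> D" unfolding D_def by (rule sum_nonneg) (simp add: d0)
  have a: "0 \<le> a i" "a i \<le> 1" if "i \<in> J" for i using w0[OF that] v0[OF that] by (auto simp: a_def)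
  have av: "a i * v i = min (w i) (v i)" if "i \<in> J" for i
    using w0[OF that] v0[OF that] by (cases "v i = 0") (auto simp: a_def min_def field_simps)
  have t0: "0 \<le> t i" if "i \<in> J" for i using w0[OF that] d0 D0 by (simp add: t_def)
  have t1: "(\<Sum>i\<in>J. t i) = 1" using w1 by (cases "D = 0") (auto simp: t_def D_def sum_divide_distrib[symmetric])
  have Dt: "D * t i = d i" if "i \<in> J" for i
    using sum_nonneg_eq_0_iff[OF J, of d] d0 that by (cases "D = 0") (auto simp: t_def D_def)
  have r0: "0 \<le> r x" for x
  proof -
    have "(\<Sum>i\<in>J. a i * q i x) \<le> (\<Sum>i\<in>J. q i x)"
      using a q0 by (intro sum_mono) (simp add: mult_left_le_one_le)
    then show ?thesis using q1 by (simp add: r_def)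
  qed
  have rm: "r \<in> borel_measurable \<mu>" unfolding r_def using qm by measurable
  have ri: "integrable \<mu> r" unfolding r_def using qi by auto
  \<comment> \<open>Since \<open>v\<close> and \<open>w\<close> both have total 1, the mass freed
    equals the total deficit.\<close>
  have rD: "(\<integral>x. r x \<partial>\<mu>) = D"
  proof -
    have "(\<integral>x. r x \<partial>\<mu>) = 1 - (\<Sum>i\<in>J. a i * v i)"
      unfolding r_def v_def using qi prob_space by (simp add: Bochner_Integration.integral_sum)
    also have "\<dots> = (\<Sum>i\<in>J. w i) - (\<Sum>i\<in>J. min (w i) (v i))" using av w1 by simp
    also have "\<dots> = D" by (simp add: D_def d_def sum_subtractf)
    finally show ?thesis .
  qed
  have km: "\<forall>i\<in>J. k i \<in> borel_measurable \<mu>" 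
  proof
    fix i assume "i \<in> J"
    note [measurable] = qm[OF this] rm
    show "k i \<in> borel_measurable \<mu>" unfolding k_def by measurable
  qed
  have k0: "\<forall>i\<in>J. \<forall>x. 0 \<le> k i x" unfolding k_def using a q0 r0 t0 by simp
  have k1: "\<forall>x. (\<Sum>i\<in>J. k i x) = 1"
  proof
    fix x
    have "(\<Sum>i\<in>J. k i x) = (\<Sum>i\<in>J. a i * q i x) + r x * (\<Sum>i\<in>J. t i)"
      unfolding k_def by (simp add: sum.distrib sum_distrib_left)
    then show "(\<Sum>i\<in>J. k i x) = 1" using t1 by (simp add: r_def)
  qed
  have kw: "\<forall>i\<in>J. (\<integral>x. k i x \<partial>\<mu>) = w i"
  proof
    fix i assume i: "i \<in> J"
    have "(\<integral>x. k i x \<partial>\<mu>) = a i * v i + D * t i"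
      unfolding k_def using qi[OF i] ri by (simp add: v_def rD)
    then show "(\<integral>x. k i x \<partial>\<mu>) = w i" using av[OF i] Dt[OF i] by (simp add: d_def)
  qed
  have kz: "\<forall>i\<in>J. w i = 0 \<longrightarrow> (\<forall>x. k i x = 0)"
  proof (intro ballI impI allI)
    fix i x assume i: "i \<in> J" and "w i = 0"
    moreover have "t i = 0" using \<open>w i = 0\<close> v0[OF i] by (simp add: t_def d_def)
    ultimately show "k i x = 0" by (simp add: k_def a_def)
  qed
  \<comment> \<open>The mass removed from \<open>q i\<close> integrates to
    \<open>v i - min (w i) (v i)\<close>, the mass added to \<open>w i - min (w i) (v i)\<close>.
    One of them is 0, so their sum is the absolute difference.\<close>
  have "(\<Sum>i\<in>J. \<integral>x. \<bar>k i x - q i x\<bar> \<partial>\<mu>) \<le> (\<Sum>i\<in>J. \<bar>v i - w i\<bar>)"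
  proof (rule sum_mono)
    fix i assume i: "i \<in> J"
    have ki: "integrable \<mu> (k i)" unfolding k_def using qi[OF i] ri by auto
    have "(\<integral>x. \<bar>k i x - q i x\<bar> \<partial>\<mu>) \<le> (\<integral>x. (1 - a i) * q i x + r x * t i \<partial>\<mu>)"
    proof (rule integral_mono)
      fix x
      have "0 \<le> (1 - a i) * q i x" "0 \<le> r x * t i" using a[OF i] q0[OF i] r0 t0[OF i] by auto
      then show "\<bar>k i x - q i x\<bar> \<le> (1 - a i) * q i x + r x * t i" unfolding k_def by (simp add: algebra_simps abs_le_iff)
    qed (use ki qi[OF i] ri in auto)
    also have "\<dots> = (1 - a i) * v i + D * t i" using qi[OF i] ri by (simp add: v_def rD)
    also have "\<dots> = \<bar>v i - w i\<bar>" using av[OF i] Dt[OF i] by (simp add: d_def left_diff_distrib)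
    finally show "(\<integral>x. \<bar>k i x - q i x\<bar> \<partial>\<mu>) \<le> \<bar>v i - w i\<bar>" .
  qed
  then show thesis using that[of k] km k0 k1 kw kz unfolding v_def by blast
qed

text \<open>Draw a cell \<open>i\<close> with probability \<open>k i x\<close>, then
  \<open>y\<close> from \<open>\<nu>\<close> weighted by \<open>f i\<close> and normalised by
  \<open>w i\<close>; \<open>h\<close> is the resulting density with respect to the product measure.
  Cells with \<open>w i = 0\<close> drop out through division by zero: \<open>kz\<close> makes this
  harmless for every \<open>x\<close>, as a kernel of probabilities requires, while in
  \<open>y\<close> it is harmless almost everywhere.\<close>

lemma density_coupling:
  fixes \<mu> :: "'a::second_countable_topology measure" and \<nu> :: "'b::euclidean_space measure"
    and k :: "'i \<Rightarrow> 'a \<Rightarrow> real" and f :: "'i \<Rightarrow> 'b \<Rightarrow> real"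
  assumes \<mu>: "prob_space \<mu>" "sets \<mu> = sets borel" and \<nu>: "prob_space \<nu>" "sets \<nu> = sets borel" "integrable \<nu> norm"
    and J: "finite J" and fm: "\<And>i. i \<in> J \<Longrightarrow> f i \<in> borel_measurable \<nu>"
    and f0: "\<And>i y. i \<in> J \<Longrightarrow> 0 \<le> f i y" and f1: "\<And>y. (\<Sum>i\<in>J. f i y) = 1"
    and w: "\<And>i. i \<in> J \<Longrightarrow> w i = (\<integral>y. f i y \<partial>\<nu>)"
    and km: "\<And>i. i \<in> J \<Longrightarrow> k i \<in> borel_measurable \<mu>" and k0: "\<And>i x. i \<in> J \<Longrightarrow> 0 \<le> k i x"
    and k1: "\<And>x. (\<Sum>i\<in>J. k i x) = 1" and kw: "\<And>i. i \<in> J \<Longrightarrow> (\<integral>x. k i x \<partial>\<mu>) = w i"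
    and kz: "\<And>i x. i \<in> J \<Longrightarrow> w i = 0 \<Longrightarrow> k i x = 0"
  obtains \<pi> K where "\<pi> \<in> couplings \<mu> \<nu>" "disintegration \<mu> \<pi> K"
    "\<forall>x. barycenter (K x) = (\<Sum>i\<in>J. (k i x / w i) *\<^sub>R (\<integral>y. f i y *\<^sub>R y \<partial>\<nu>))"
proof -
  interpret M: prob_space \<mu> by fact
  interpret N: prob_space \<nu> by fact
  interpret MN: pair_sigma_finite \<mu> \<nu> ..
  note [measurable_cong] = \<mu>(2) \<nu>(2)
  have sp[simp]: "space \<mu> = UNIV" "space \<nu> = UNIV"
    using sets_eq_imp_space_eq[OF \<mu>(2)] sets_eq_imp_space_eq[OF \<nu>(2)] by simp_all
  have fle: "f i y \<le> 1" if "i \<in> J" for i y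
    using member_le_sum[of i J "\<lambda>i. f i y"] that J f0 f1 by auto
  have kle: "k i x \<le> 1" if "i \<in> J" for i x
    using member_le_sum[of i J "\<lambda>i. k i x"] that J k0 k1 by auto
  have fi: "integrable \<nu> (f i)" if "i \<in> J" for i
    using fm[OF that] f0[OF that] fle[OF that] by (intro integrable_bounded[where K=1] N.finite_measure_axioms) (auto simp: abs_le_iff intro: order_trans)
  have ki: "integrable \<mu> (k i)" if "i \<in> J" for i
    using km[OF that] k0[OF that] kle[OF that] by (intro integrable_bounded[where K=1] M.finite_measure_axioms) (auto simp: abs_le_iff intro: order_trans)
  have w0: "0 \<le> w i" if "i \<in> J" for i unfolding w[OF that] using f0[OF that] by simp
  define h where "h x y = (\<Sum>i\<in>J. k i x * f i y / w i)" for x y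
  have h0: "0 \<le> h x y" for x y unfolding h_def using k0 f0 w0 by (intro sum_nonneg) auto
  note [measurable] = fm km
  have hm[measurable]: "(\<lambda>z. h (fst z) (snd z)) \<in> borel_measurable (\<mu> \<Otimes>\<^sub>M \<nu>)" unfolding h_def by measurable
  have hmx: "(\<lambda>y. h x y) \<in> borel_measurable \<nu>" for x unfolding h_def by measurable
  have hmy: "(\<lambda>x. h x y) \<in> borel_measurable \<mu>" for y unfolding h_def by measurable
  have hx: "(\<integral>\<^sup>+y. ennreal (h x y) \<partial>\<nu>) = 1" for x
  proof -
    have i: "integrable \<nu> (\<lambda>y. h x y)" unfolding h_def using fi by auto
    have "(\<integral>y. h x y \<partial>\<nu>) = (\<Sum>i\<in>J. k i x * w i / w i)"
      unfolding h_def using fi w by (simp add: Bochner_Integration.integral_sum)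
    also have "\<dots> = (\<Sum>i\<in>J. k i x)" using kz by (intro sum.cong) auto
    finally show ?thesis using nn_integral_eq_integral[OF i] h0 k1 by simp
  qed
  \<comment> \<open>A nonnegative \<open>f i\<close> of integral 0 vanishes almost everywhere, so
    such cells may be left out of the sum equal to 1.\<close>
  have "AE y in \<nu>. \<forall>i\<in>J. w i = 0 \<longrightarrow> f i y = 0"
  proof (rule AE_finite_allI[OF J])
    fix i assume i: "i \<in> J"
    show "AE y in \<nu>. w i = 0 \<longrightarrow> f i y = 0"
    proof (cases "w i = 0")
      case True
      then show ?thesis using integral_nonneg_eq_0_iff_AE[OF fi[OF i]] f0[OF i] w[OF i] by auto
    qed simp
  qed
  then have hy: "AE y in \<nu>. (\<integral>\<^sup>+x. ennreal (h x y) \<partial>\<mu>) = 1"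
  proof eventually_elim
    case (elim y)
    have i: "integrable \<mu> (\<lambda>x. h x y)" unfolding h_def using ki by auto
    have "(\<integral>x. h x y \<partial>\<mu>) = (\<Sum>i\<in>J. w i * f i y / w i)"
      unfolding h_def using ki kw by (simp add: Bochner_Integration.integral_sum)
    also have "\<dots> = (\<Sum>i\<in>J. f i y)" using elim by (intro sum.cong) auto
    finally show ?case using nn_integral_eq_integral[OF i] h0 f1 by simp
  qed
  define K where "K x = density \<nu> (\<lambda>y. ennreal (h x y))" for x
  define \<pi> where "\<pi> = density (\<mu> \<Otimes>\<^sub>M \<nu>) (\<lambda>z. ennreal (h (fst z) (snd z)))"
  have Kprob: "prob_space (K x)" for x
    by (rule prob_spaceI) (use hx[of x] hmx[of x] in \<open>simp add: K_def emeasure_density\<close>)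
  have Ksets: "sets (K x) = sets borel" for x using \<nu>(2) by (simp add: K_def)
  have Kem: "emeasure (K x) B = (\<integral>\<^sup>+y. ennreal (h x y) * indicator B y \<partial>\<nu>)" if "B \<in> sets borel" for x B
    unfolding K_def using hmx[of x] that \<nu>(2) by (subst emeasure_density) auto
  have Km: "K \<in> \<mu> \<rightarrow>\<^sub>M prob_algebra borel"
  proof (intro measurable_prob_algebraI measurable_subprob_algebra)
    show "prob_space (K x)" "subprob_space (K x)" for x
      using Kprob by (auto intro: prob_space_imp_subprob_space)
    show "(\<lambda>x. emeasure (K x) B) \<in> borel_measurable \<mu>" if [measurable]: "B \<in> sets borel" for B
      unfolding Kem[OF that] h_def by measurable
  qed (simp_all add: Ksets)
  have \<pi>em: "emeasure \<pi> (A \<times> B) = (\<integral>\<^sup>+x. indicator A x * emeasure (K x) B \<partial>\<mu>)"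
    if A[measurable]: "A \<in> sets borel" and B[measurable]: "B \<in> sets borel" for A B
  proof -
    have "A \<times> B \<in> sets (\<mu> \<Otimes>\<^sub>M \<nu>)" using A B \<mu>(2) \<nu>(2) by auto
    then have "emeasure \<pi> (A \<times> B) = (\<integral>\<^sup>+z. ennreal (h (fst z) (snd z)) * indicator (A \<times> B) z \<partial>(\<mu> \<Otimes>\<^sub>M \<nu>))"
      unfolding \<pi>_def by (subst emeasure_density) auto
    also have "\<dots> = (\<integral>\<^sup>+x. \<integral>\<^sup>+y. ennreal (h x y) * indicator (A \<times> B) (x, y) \<partial>\<nu> \<partial>\<mu>)"
      by (subst N.nn_integral_fst[symmetric]) auto
    also have "\<dots> = (\<integral>\<^sup>+x. indicator A x * emeasure (K x) B \<partial>\<mu>)"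
    proof (rule nn_integral_cong)
      fix x
      have "(\<integral>\<^sup>+y. ennreal (h x y) * indicator (A \<times> B) (x, y) \<partial>\<nu>) = (\<integral>\<^sup>+y. indicator A x * (ennreal (h x y) * indicator B y) \<partial>\<nu>)"
        by (rule nn_integral_cong) (simp add: indicator_def)
      also have "\<dots> = indicator A x * emeasure (K x) B"
        using hmx[of x] unfolding Kem[OF B] by (subst nn_integral_cmult) auto
      finally show "(\<integral>\<^sup>+y. ennreal (h x y) * indicator (A \<times> B) (x, y) \<partial>\<nu>) = indicator A x * emeasure (K x) B" .
    qed
    finally show ?thesis .
  qed
  have \<pi>sets: "sets \<pi> = sets (borel \<Otimes>\<^sub>M borel)"
    unfolding \<pi>_def using sets_pair_measure_cong[OF \<mu>(2) \<nu>(2)] by simp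
  have \<pi>space: "space \<pi> = UNIV" using sets_eq_imp_space_eq[OF \<pi>sets] by (simp add: space_pair_measure)
  have K1: "emeasure (K x) UNIV = 1" for x
    using prob_space.emeasure_space_1[OF Kprob[of x]] by (simp add: K_def)
  have fst: "distr \<pi> borel fst = \<mu>"
  proof (rule measure_eqI)
    fix A assume "A \<in> sets (distr \<pi> borel fst)"
    then have A: "A \<in> sets borel" by simp
    have "fst \<in> \<pi> \<rightarrow>\<^sub>M borel" using measurable_fst by (simp cong: measurable_cong_sets add: \<pi>sets)
    then have "emeasure (distr \<pi> borel fst) A = emeasure \<pi> (A \<times> UNIV)"
      using A by (subst emeasure_distr) (auto simp: \<pi>space vimage_fst)
    also have "\<dots> = emeasure \<mu> A" using A \<mu>(2) by (subst \<pi>em) (auto simp: K1)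
    finally show "emeasure (distr \<pi> borel fst) A = emeasure \<mu> A" .
  qed (simp add: \<mu>(2))
  have snd: "distr \<pi> borel snd = \<nu>"
  proof (rule measure_eqI)
    fix B assume "B \<in> sets (distr \<pi> borel snd)"
    then have B[measurable]: "B \<in> sets borel" by simp
    have "snd \<in> \<pi> \<rightarrow>\<^sub>M borel" using measurable_snd by (simp cong: measurable_cong_sets add: \<pi>sets)
    then have "emeasure (distr \<pi> borel snd) B = emeasure \<pi> (UNIV \<times> B)"
      using B by (subst emeasure_distr) (auto simp: \<pi>space vimage_snd)
    also have "\<dots> = (\<integral>\<^sup>+z. ennreal (h (fst z) (snd z)) * indicator B (snd z) \<partial>(\<mu> \<Otimes>\<^sub>M \<nu>))"
    proof -
      have "UNIV \<times> B \<in> sets (\<mu> \<Otimes>\<^sub>M \<nu>)" using B \<mu>(2) \<nu>(2) by auto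
      then show ?thesis unfolding \<pi>_def
        by (subst emeasure_density) (auto intro!: nn_integral_cong simp: indicator_def)
    qed
    also have "\<dots> = (\<integral>\<^sup>+y. \<integral>\<^sup>+x. ennreal (h x y) * indicator B y \<partial>\<mu> \<partial>\<nu>)"
      by (subst MN.nn_integral_snd[symmetric]) auto
    also have "\<dots> = (\<integral>\<^sup>+y. (\<integral>\<^sup>+x. ennreal (h x y) \<partial>\<mu>) * indicator B y \<partial>\<nu>)"
      using hmy by (intro nn_integral_cong nn_integral_multc) auto
    also have "\<dots> = (\<integral>\<^sup>+y. indicator B y \<partial>\<nu>)"
      using hy by (intro nn_integral_cong_AE) auto
    also have "\<dots> = emeasure \<nu> B" using \<nu>(2) by simp
    finally show "emeasure (distr \<pi> borel snd) B = emeasure \<nu> B" .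
  qed (simp add: \<nu>(2))
  have "prob_space \<pi>"
  proof (rule prob_spaceI)
    have "emeasure \<pi> (UNIV \<times> UNIV) = 1" using M.emeasure_space_1 by (subst \<pi>em) (auto simp: K1)
    then show "emeasure \<pi> (space \<pi>) = 1" by (simp add: \<pi>space)
  qed
  with \<pi>sets fst snd have "\<pi> \<in> couplings \<mu> \<nu>" by (simp add: couplings_def)
  moreover have "disintegration \<mu> \<pi> K" using Km \<pi>em by (simp add: disintegration_def)
  moreover have "barycenter (K x) = (\<Sum>i\<in>J. (k i x / w i) *\<^sub>R (\<integral>y. f i y *\<^sub>R y \<partial>\<nu>))" for x
  proof -
    have fyi: "integrable \<nu> (\<lambda>y. f i y *\<^sub>R y)" if "i \<in> J" for i
    proof (rule Bochner_Integration.integrable_bound[OF \<nu>(3)])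
      show "(\<lambda>y. f i y *\<^sub>R y) \<in> borel_measurable \<nu>" using fm[OF that] by measurable
      show "AE y in \<nu>. norm (f i y *\<^sub>R y) \<le> norm (norm y)"
        using f0[OF that] fle[OF that] by (intro AE_I2) (simp add: mult_left_le_one_le)
    qed
    have "barycenter (K x) = (\<integral>y. h x y *\<^sub>R y \<partial>\<nu>)"
      unfolding barycenter_def K_def using hmx[of x] h0 by (subst integral_density) auto
    also have "\<dots> = (\<integral>y. (\<Sum>i\<in>J. (k i x / w i) *\<^sub>R (f i y *\<^sub>R y)) \<partial>\<nu>)"
      unfolding h_def by (simp add: scaleR_sum_left)
    also have "\<dots> = (\<Sum>i\<in>J. (k i x / w i) *\<^sub>R (\<integral>y. f i y *\<^sub>R y \<partial>\<nu>))"
      by (subst Bochner_Integration.integral_sum)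
         (simp_all only: integral_scaleR_right integrable_scaleR_right fyi)
    finally show ?thesis .
  qed
  ultimately show thesis using that by blast
qed

text \<open>Both barycenters are written as a weighted sum of the centres \<open>z i\<close> plus
  displacements within the cells. The displacements under \<open>\<nu>\<close> and under
  \<open>s x\<close> are controlled by \<open>\<epsilon>\<close>. The weights \<open>k i\<close> and
  \<open>q i\<close> differ in mean by no more than the two sets of cell masses do, thanks to
  \<open>rebalance_weights\<close>, and each unit of difference costs at most
  \<open>Z\<close>.\<close>

lemma strategy_rounding:
  fixes \<mu> :: "'a::second_countable_topology measure" and \<nu> :: "'b::euclidean_space measure"
    and f :: "'i \<Rightarrow> 'b \<Rightarrow> real" and z :: "'i \<Rightarrow> 'b"
  assumes \<mu>: "prob_space \<mu>" "sets \<mu> = sets borel" and \<nu>: "prob_space \<nu>" "sets \<nu> = sets borel" "integrable \<nu> norm"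
    and J: "finite J" and f_cont: "\<And>i. i \<in> J \<Longrightarrow> continuous_on UNIV (f i)"
    and f0: "\<And>i y. i \<in> J \<Longrightarrow> 0 \<le> f i y" and f1: "\<And>y. (\<Sum>i\<in>J. f i y) = 1"
    and near: "\<And>y. (\<Sum>i\<in>J. f i y * norm (y - z i)) \<le> \<epsilon> y" and \<epsilon>: "integrable \<nu> \<epsilon>"
    and Z: "\<And>i. i \<in> J \<Longrightarrow> norm (z i) \<le> Z"
    and s: "s \<in> strategies \<mu>"
  obtains \<pi> K where "\<pi> \<in> couplings \<mu> \<nu>" "disintegration \<mu> \<pi> K"
    "integrable \<mu> (\<lambda>x. norm (barycenter (K x) - bary (s x)))"
    "(\<integral>x. norm (barycenter (K x) - bary (s x)) \<partial>\<mu>) \<le> (\<integral>y. \<epsilon> y \<partial>\<nu>) + (\<integral>x. pexp (s x) \<epsilon> \<partial>\<mu>)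
      + Z * (\<Sum>i\<in>J. \<bar>(\<integral>x. pexp (s x) (f i) \<partial>\<mu>) - (\<integral>y. f i y \<partial>\<nu>)\<bar>)"
proof -
  interpret M: prob_space \<mu> by fact
  interpret N: prob_space \<nu> by fact
  have fm: "f i \<in> borel_measurable \<nu>" if "i \<in> J" for i
    using borel_measurable_continuous_onI[OF f_cont[OF that]] \<nu>(2) by (simp cong: measurable_cong_sets)
  have fle: "f i y \<le> 1" if "i \<in> J" for i y
    using member_le_sum[of i J "\<lambda>i. f i y"] that J f0 f1 by auto
  have fi: "integrable \<nu> (f i)" if "i \<in> J" for i
    using fm[OF that] f0[OF that] fle[OF that] by (intro integrable_bounded[where K=1] N.finite_measure_axioms) (auto simp: abs_le_iff intro: order_trans)
  have idm[measurable]: "(\<lambda>y. y) \<in> borel_measurable \<nu>" using measurable_ident_sets[OF \<nu>(2)] .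
  have fyi: "integrable \<nu> (\<lambda>y. f i y *\<^sub>R (y - z i))" if "i \<in> J" for i
  proof (rule Bochner_Integration.integrable_bound)
    show "integrable \<nu> (\<lambda>y. norm y + norm (z i))" using \<nu>(3) by simp
    show "(\<lambda>y. f i y *\<^sub>R (y - z i)) \<in> borel_measurable \<nu>" using fm[OF that] by measurable
    show "AE y in \<nu>. norm (f i y *\<^sub>R (y - z i)) \<le> norm (norm y + norm (z i))"
    proof (intro AE_I2)
      fix y
      have "norm (f i y *\<^sub>R (y - z i)) \<le> norm (y - z i)"
        using f0[OF that] fle[OF that] by (simp add: mult_left_le_one_le)
      also have "\<dots> \<le> norm (norm y + norm (z i))" using norm_triangle_ineq4[of y "z i"] by simp
      finally show "norm (f i y *\<^sub>R (y - z i)) \<le> norm (norm y + norm (z i))" .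
    qed
  qed
  have fins: "finite (set_pmf (s x))" for x using s by (simp add: strategies_def)
  note pi = integrable_measure_pmf_finite[OF fins]
  define w where "w i = (\<integral>y. f i y \<partial>\<nu>)" for i
  define q where "q i x = pexp (s x) (f i)" for i x
  have qm: "q i \<in> borel_measurable \<mu>" for i unfolding q_def by (rule measurable_strategy[OF s]) simp
  have q0: "0 \<le> q i x" if "i \<in> J" for i x unfolding q_def using f0[OF that] by simp
  have q1: "(\<Sum>i\<in>J. q i x) = 1" for x
  proof -
    have "(\<Sum>i\<in>J. q i x) = pexp (s x) (\<lambda>y. \<Sum>i\<in>J. f i y)"
      unfolding q_def by (rule Bochner_Integration.integral_sum[symmetric]) (rule pi)
    then show ?thesis using f1 by (simp add: measure_pmf.prob_space)
  qed
  have w0: "0 \<le> w i" if "i \<in> J" for i unfolding w_def using f0[OF that] by simp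
  have w1: "(\<Sum>i\<in>J. w i) = 1"
  proof -
    have "(\<Sum>i\<in>J. w i) = (\<integral>y. (\<Sum>i\<in>J. f i y) \<partial>\<nu>)"
      unfolding w_def by (rule Bochner_Integration.integral_sum[symmetric]) (rule fi)
    then show ?thesis using f1 N.prob_space by simp
  qed
  obtain k where k: "\<forall>i\<in>J. k i \<in> borel_measurable \<mu>" "\<forall>i\<in>J. \<forall>x. 0 \<le> k i x" "\<forall>x. (\<Sum>i\<in>J. k i x) = 1"
    "\<forall>i\<in>J. (\<integral>x. k i x \<partial>\<mu>) = w i" "\<forall>i\<in>J. w i = 0 \<longrightarrow> (\<forall>x. k i x = 0)"
    "(\<Sum>i\<in>J. \<integral>x. \<bar>k i x - q i x\<bar> \<partial>\<mu>) \<le> (\<Sum>i\<in>J. \<bar>(\<integral>x. q i x \<partial>\<mu>) - w i\<bar>)"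
    by (rule rebalance_weights[OF \<mu>(1) J qm q0 q1 w0 w1])
  obtain \<pi> K where \<pi>: "\<pi> \<in> couplings \<mu> \<nu>" "disintegration \<mu> \<pi> K"
    and bK: "\<forall>x. barycenter (K x) = (\<Sum>i\<in>J. (k i x / w i) *\<^sub>R (\<integral>y. f i y *\<^sub>R y \<partial>\<nu>))"
    by (rule density_coupling[OF \<mu> \<nu> J fm f0 f1, of w k]) (use k w_def in auto)
  have kle: "k i x \<le> 1" if "i \<in> J" for i x
    using member_le_sum[of i J "\<lambda>i. k i x"] that J k(2,3) by auto
  have ki: "integrable \<mu> (k i)" if "i \<in> J" for i
    using k(1,2) that kle[OF that] by (intro integrable_bounded[where K=1] M.finite_measure_axioms) (auto simp: abs_le_iff intro: order_trans)
  have qi: "integrable \<mu> (q i)" if "i \<in> J" for i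
    unfolding q_def by (rule integrable_pexp_strategy[OF M.finite_measure_axioms s])
  define D where "D i = (\<integral>y. f i y * norm (y - z i) \<partial>\<nu>)" for i
  have D0: "0 \<le> D i" if "i \<in> J" for i unfolding D_def using f0[OF that] by simp
  have fni: "integrable \<nu> (\<lambda>y. f i y * norm (y - z i))" if "i \<in> J" for i
    using integrable_norm[OF fyi[OF that]] f0[OF that] by simp
  have D: "(\<Sum>i\<in>J. D i) \<le> (\<integral>y. \<epsilon> y \<partial>\<nu>)"
  proof -
    have "(\<Sum>i\<in>J. D i) = (\<integral>y. (\<Sum>i\<in>J. f i y * norm (y - z i)) \<partial>\<nu>)"
      unfolding D_def by (rule Bochner_Integration.integral_sum[symmetric]) (rule fni)
    also have "\<dots> \<le> (\<integral>y. \<epsilon> y \<partial>\<nu>)" using near \<epsilon> fni by (intro integral_mono) auto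
    finally show ?thesis .
  qed
  have fz: "(\<integral>y. f i y *\<^sub>R y \<partial>\<nu>) = (\<integral>y. f i y *\<^sub>R (y - z i) \<partial>\<nu>) + w i *\<^sub>R z i" if i: "i \<in> J" for i
  proof -
    have "(\<integral>y. f i y *\<^sub>R y \<partial>\<nu>) = (\<integral>y. f i y *\<^sub>R (y - z i) + f i y *\<^sub>R z i \<partial>\<nu>)"
      by (simp add: algebra_simps)
    also have "\<dots> = (\<integral>y. f i y *\<^sub>R (y - z i) \<partial>\<nu>) + (\<integral>y. f i y *\<^sub>R z i \<partial>\<nu>)"
      using fyi[OF i] fi[OF i] by (intro Bochner_Integration.integral_add integrable_scaleR_left)
    finally show ?thesis unfolding w_def using fi[OF i] by simp
  qed
  have bs: "bary (s x) = measure_pmf.expectation (s x) (\<lambda>y. \<Sum>i\<in>J. f i y *\<^sub>R (y - z i)) + (\<Sum>i\<in>J. q i x *\<^sub>R z i)" for x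
  proof -
    have "y = (\<Sum>i\<in>J. f i y *\<^sub>R (y - z i)) + (\<Sum>i\<in>J. f i y *\<^sub>R z i)" for y
      using f1[of y] by (simp add: scaleR_diff_right sum_subtractf scaleR_sum_left[symmetric])
    then have "bary (s x) = measure_pmf.expectation (s x) (\<lambda>y. (\<Sum>i\<in>J. f i y *\<^sub>R (y - z i)) + (\<Sum>i\<in>J. f i y *\<^sub>R z i))"
      unfolding barycenter_def by simp
    also have "\<dots> = measure_pmf.expectation (s x) (\<lambda>y. \<Sum>i\<in>J. f i y *\<^sub>R (y - z i)) + measure_pmf.expectation (s x) (\<lambda>y. \<Sum>i\<in>J. f i y *\<^sub>R z i)"
      by (intro Bochner_Integration.integral_add pi)
    also have "measure_pmf.expectation (s x) (\<lambda>y. \<Sum>i\<in>J. f i y *\<^sub>R z i) = (\<Sum>i\<in>J. q i x *\<^sub>R z i)"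
      unfolding q_def by (subst Bochner_Integration.integral_sum) (simp_all add: pi)
    finally show ?thesis .
  qed
  define B where "B x = (\<Sum>i\<in>J. k i x / w i * D i) + Z * (\<Sum>i\<in>J. \<bar>k i x - q i x\<bar>) + pexp (s x) \<epsilon>" for x
  have le: "norm (barycenter (K x) - bary (s x)) \<le> B x" for x
  proof -
    have "barycenter (K x) = (\<Sum>i\<in>J. (k i x / w i) *\<^sub>R (\<integral>y. f i y *\<^sub>R (y - z i) \<partial>\<nu>) + k i x *\<^sub>R z i)"
      unfolding bK[rule_format] using k(5) by (intro sum.cong) (auto simp: fz scaleR_add_right)
    then have "barycenter (K x) - bary (s x) = (\<Sum>i\<in>J. (k i x / w i) *\<^sub>R (\<integral>y. f i y *\<^sub>R (y - z i) \<partial>\<nu>))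
        + (\<Sum>i\<in>J. (k i x - q i x) *\<^sub>R z i) - measure_pmf.expectation (s x) (\<lambda>y. \<Sum>i\<in>J. f i y *\<^sub>R (y - z i))"
      unfolding bs by (simp add: sum.distrib scaleR_diff_left sum_subtractf)
    also have "norm \<dots> \<le> norm (\<Sum>i\<in>J. (k i x / w i) *\<^sub>R (\<integral>y. f i y *\<^sub>R (y - z i) \<partial>\<nu>))
        + norm (\<Sum>i\<in>J. (k i x - q i x) *\<^sub>R z i) + norm (measure_pmf.expectation (s x) (\<lambda>y. \<Sum>i\<in>J. f i y *\<^sub>R (y - z i)))"
      by (rule order_trans[OF norm_triangle_ineq4 add_right_mono[OF norm_triangle_ineq]])
    also have "\<dots> \<le> B x"
      unfolding B_def
    proof (intro add_mono)
      show "norm (\<Sum>i\<in>J. (k i x / w i) *\<^sub>R (\<integral>y. f i y *\<^sub>R (y - z i) \<partial>\<nu>)) \<le> (\<Sum>i\<in>J. k i x / w i * D i)"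
      proof (rule order_trans[OF norm_sum sum_mono])
        fix i assume i: "i \<in> J"
        have "norm (\<integral>y. f i y *\<^sub>R (y - z i) \<partial>\<nu>) \<le> D i"
          unfolding D_def using f0[OF i] by (intro norm_integral_le fyi[OF i] fni[OF i]) simp
        then have "k i x / w i * norm (\<integral>y. f i y *\<^sub>R (y - z i) \<partial>\<nu>) \<le> k i x / w i * D i"
          using k(2) i w0[OF i] by (intro mult_left_mono) auto
        then show "norm ((k i x / w i) *\<^sub>R (\<integral>y. f i y *\<^sub>R (y - z i) \<partial>\<nu>)) \<le> k i x / w i * D i"
          using k(2) i w0[OF i] by simp
      qed
      have "norm (\<Sum>i\<in>J. (k i x - q i x) *\<^sub>R z i) \<le> (\<Sum>i\<in>J. \<bar>k i x - q i x\<bar> * Z)"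
        using Z by (intro order_trans[OF norm_sum sum_mono]) (auto intro!: mult_left_mono)
      then show "norm (\<Sum>i\<in>J. (k i x - q i x) *\<^sub>R z i) \<le> Z * (\<Sum>i\<in>J. \<bar>k i x - q i x\<bar>)"
        by (simp add: sum_distrib_left mult.commute)
      have "norm (\<Sum>i\<in>J. f i y *\<^sub>R (y - z i)) \<le> \<epsilon> y" for y
        using f0 by (intro order_trans[OF norm_sum order_trans[OF sum_mono near]]) auto
      then show "norm (measure_pmf.expectation (s x) (\<lambda>y. \<Sum>i\<in>J. f i y *\<^sub>R (y - z i))) \<le> pexp (s x) \<epsilon>"
        by (intro norm_integral_le pi)
    qed
    finally show ?thesis .
  qed
  have \<epsilon>i: "integrable \<mu> (\<lambda>x. pexp (s x) \<epsilon>)" by (rule integrable_pexp_strategy[OF M.finite_measure_axioms s])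
  have Bi: "integrable \<mu> B" unfolding B_def using ki qi \<epsilon>i by auto
  have Bint: "(\<integral>x. B x \<partial>\<mu>) = (\<Sum>i\<in>J. w i / w i * D i) + Z * (\<Sum>i\<in>J. \<integral>x. \<bar>k i x - q i x\<bar> \<partial>\<mu>) + (\<integral>x. pexp (s x) \<epsilon> \<partial>\<mu>)"
  proof -
    have "(\<integral>x. B x \<partial>\<mu>) = (\<integral>x. (\<Sum>i\<in>J. k i x / w i * D i) \<partial>\<mu>) + (\<integral>x. Z * (\<Sum>i\<in>J. \<bar>k i x - q i x\<bar>) \<partial>\<mu>) + (\<integral>x. pexp (s x) \<epsilon> \<partial>\<mu>)"
      unfolding B_def using ki qi \<epsilon>i by (subst Bochner_Integration.integral_add; (subst Bochner_Integration.integral_add)?) auto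
    also have "(\<integral>x. (\<Sum>i\<in>J. k i x / w i * D i) \<partial>\<mu>) = (\<Sum>i\<in>J. w i / w i * D i)"
      using ki k(4) by (subst Bochner_Integration.integral_sum) (auto intro!: sum.cong)
    also have "(\<integral>x. Z * (\<Sum>i\<in>J. \<bar>k i x - q i x\<bar>) \<partial>\<mu>) = Z * (\<Sum>i\<in>J. \<integral>x. \<bar>k i x - q i x\<bar> \<partial>\<mu>)"
      using ki qi by (subst Bochner_Integration.integral_mult_right_zero, subst Bochner_Integration.integral_sum) auto
    finally show ?thesis .
  qed
  have "J \<noteq> {}" using f1 by auto
  then obtain i0 where "i0 \<in> J" by blast
  then have Z0: "0 \<le> Z" using Z[of i0] norm_ge_zero[of "z i0"] by linarith
  \<comment> \<open>The quotient is 1, or 0 for a cell of mass 0, hence only an inequality.\<close>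
  have "(\<Sum>i\<in>J. w i / w i * D i) \<le> (\<Sum>i\<in>J. D i)" using D0 by (intro sum_mono) auto
  moreover have "Z * (\<Sum>i\<in>J. \<integral>x. \<bar>k i x - q i x\<bar> \<partial>\<mu>) \<le> Z * (\<Sum>i\<in>J. \<bar>(\<integral>x. q i x \<partial>\<mu>) - w i\<bar>)"
    using Z0 k(6) by (intro mult_left_mono)
  ultimately have BI: "(\<integral>x. B x \<partial>\<mu>) \<le> (\<integral>y. \<epsilon> y \<partial>\<nu>) + (\<integral>x. pexp (s x) \<epsilon> \<partial>\<mu>) + Z * (\<Sum>i\<in>J. \<bar>(\<integral>x. q i x \<partial>\<mu>) - w i\<bar>)"
    unfolding Bint using D by linarith
  have m: "(\<lambda>x. norm (barycenter (K x) - bary (s x))) \<in> borel_measurable \<mu>"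
  proof -
    have [measurable]: "(\<lambda>x. bary (s x)) \<in> borel_measurable \<mu>"
      by (rule measurable_strategy[OF s]) simp
    have [measurable]: "k i \<in> borel_measurable \<mu>" if "i \<in> J" for i using k(1) that by blast
    show ?thesis unfolding bK[rule_format] by measurable
  qed
  have ni: "integrable \<mu> (\<lambda>x. norm (barycenter (K x) - bary (s x)))"
    by (rule Bochner_Integration.integrable_bound[OF Bi m]) (use le in \<open>auto intro!: AE_I2 intro: order_trans[OF _ abs_ge_self]\<close>)
  have "(\<integral>x. norm (barycenter (K x) - bary (s x)) \<partial>\<mu>) \<le> (\<integral>x. B x \<partial>\<mu>)"
    by (intro integral_mono ni Bi le)
  with BI \<pi> ni show thesis using that unfolding q_def w_def by force
qed

section \<open>Kernels and weak duality\<close>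

text \<open>Writing the second marginal as a monadic bind makes the integration rules of the Giry
  monad available for the kernel.\<close>

lemma coupling_kernel_bind:
  fixes \<mu> :: "'a::topological_space measure" and \<nu> :: "'b::euclidean_space measure"
  assumes \<mu>: "prob_space \<mu>" "sets \<mu> = sets borel" and \<nu>: "sets \<nu> = sets borel"
    and \<pi>: "\<pi> \<in> couplings \<mu> \<nu>" and K: "disintegration \<mu> \<pi> K"
  shows "\<nu> = \<mu> \<bind> K" "K \<in> \<mu> \<rightarrow>\<^sub>M subprob_algebra borel"
proof -
  interpret prob_space \<mu> by fact
  show Km: "K \<in> \<mu> \<rightarrow>\<^sub>M subprob_algebra borel"
    using K by (auto simp: disintegration_def intro: measurable_prob_algebraD)
  have \<pi>sets: "sets \<pi> = sets (borel \<Otimes>\<^sub>M borel)" and snd: "distr \<pi> borel snd = \<nu>"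
    using \<pi> by (auto simp: couplings_def)
  have \<pi>space: "space \<pi> = UNIV" using sets_eq_imp_space_eq[OF \<pi>sets] by (simp add: space_pair_measure)
  show "\<nu> = \<mu> \<bind> K"
  proof (rule measure_eqI)
    show "sets \<nu> = sets (\<mu> \<bind> K)" using \<nu> by (simp add: sets_bind[OF sets_kernel[OF Km] not_empty])
    fix B assume "B \<in> sets \<nu>"
    then have B: "B \<in> sets borel" using \<nu> by simp
    have "snd \<in> \<pi> \<rightarrow>\<^sub>M borel" using measurable_snd by (simp cong: measurable_cong_sets add: \<pi>sets)
    then have "emeasure \<nu> B = emeasure \<pi> (UNIV \<times> B)"
      using B unfolding snd[symmetric] by (subst emeasure_distr) (auto simp: \<pi>space vimage_snd)
    also have "\<dots> = (\<integral>\<^sup>+x. emeasure (K x) B \<partial>\<mu>)"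
      using K B by (auto simp: disintegration_def)
    also have "\<dots> = emeasure (\<mu> \<bind> K) B" by (rule emeasure_bind[OF not_empty Km B, symmetric])
    finally show "emeasure \<nu> B = emeasure (\<mu> \<bind> K) B" .
  qed
qed

lemma kernel_integral_nonneg:
  fixes f :: "'b::euclidean_space \<Rightarrow> real"
  assumes \<nu>: "\<nu> = \<mu> \<bind> K" "K \<in> \<mu> \<rightarrow>\<^sub>M subprob_algebra borel" "sets \<nu> = sets borel"
    and f: "integrable \<nu> f" "\<And>y. 0 \<le> f y"
  shows "AE x in \<mu>. integrable (K x) f" "integrable \<mu> (\<lambda>x. \<integral>y. f y \<partial>K x)"
    "(\<integral>x. \<integral>y. f y \<partial>K x \<partial>\<mu>) = (\<integral>y. f y \<partial>\<nu>)"
proof -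
  have fb[measurable]: "f \<in> borel_measurable borel"
    using f(1) \<nu>(3) by (auto simp: integrable_iff_bounded cong: measurable_cong_sets)
  have Ks: "sets (K x) = sets borel" if "x \<in> space \<mu>" for x using sets_kernel[OF \<nu>(2) that] .
  note Km[measurable] = \<nu>(2)
  define F where "F x = (\<integral>\<^sup>+y. ennreal (f y) \<partial>K x)" for x
  have Fm[measurable]: "F \<in> borel_measurable \<mu>" unfolding F_def by measurable
  have Fint: "(\<integral>\<^sup>+x. F x \<partial>\<mu>) = (\<integral>\<^sup>+y. ennreal (f y) \<partial>\<nu>)"
    unfolding F_def \<nu>(1) by (rule nn_integral_bind[symmetric, OF _ \<nu>(2)]) simp
  have fin: "(\<integral>\<^sup>+y. ennreal (f y) \<partial>\<nu>) = ennreal (\<integral>y. f y \<partial>\<nu>)"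
    using f by (intro nn_integral_eq_integral) auto
  then have AEfin: "AE x in \<mu>. F x \<noteq> \<infinity>"
    using Fint by (intro nn_integral_PInf_AE) auto
  have fK: "f \<in> borel_measurable (K x)" if "x \<in> space \<mu>" for x
    using fb Ks[OF that] by (simp cong: measurable_cong_sets)
  have eq: "(\<integral>y. f y \<partial>K x) = enn2real (F x)" if "x \<in> space \<mu>" for x
    unfolding F_def using f(2) fK[OF that] by (intro integral_eq_nn_integral) auto
  show "AE x in \<mu>. integrable (K x) f"
    using AEfin
  proof (rule AE_mp[OF _ AE_I2], intro impI)
    fix x assume "x \<in> space \<mu>" "F x \<noteq> \<infinity>"
    then show "integrable (K x) f"
      using fK[of x] f(2) by (simp add: integrable_iff_bounded F_def less_top)
  qed
  \<comment> \<open>Where \<open>F x\<close> is infinite the Bochner integral is 0 by convention;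
    that set is null.\<close>
  have AE2: "AE x in \<mu>. ennreal (\<integral>y. f y \<partial>K x) = F x"
    using AEfin by (rule AE_mp[OF _ AE_I2]) (auto simp: eq ennreal_enn2real_if)
  have m: "(\<lambda>x. \<integral>y. f y \<partial>K x) \<in> borel_measurable \<mu>" by measurable
  have nn: "(\<integral>\<^sup>+x. ennreal (\<integral>y. f y \<partial>K x) \<partial>\<mu>) = ennreal (\<integral>y. f y \<partial>\<nu>)"
    using nn_integral_cong_AE[OF AE2] Fint fin by simp
  have pos: "0 \<le> (\<integral>y. f y \<partial>K x)" for x using f(2) by simp
  show "integrable \<mu> (\<lambda>x. \<integral>y. f y \<partial>K x)"
    using nn m pos by (intro integrableI_nonneg) auto
  show "(\<integral>x. \<integral>y. f y \<partial>K x \<partial>\<mu>) = (\<integral>y. f y \<partial>\<nu>)"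
    using nn m pos f(2) by (subst integral_eq_nn_integral) auto
qed

lemma kernel_integral:
  fixes f :: "'b::euclidean_space \<Rightarrow> real"
  assumes \<nu>: "\<nu> = \<mu> \<bind> K" "K \<in> \<mu> \<rightarrow>\<^sub>M subprob_algebra borel" "sets \<nu> = sets borel"
    and f: "integrable \<nu> f"
  shows "AE x in \<mu>. integrable (K x) f" "integrable \<mu> (\<lambda>x. \<integral>y. f y \<partial>K x)"
    "(\<integral>x. \<integral>y. f y \<partial>K x \<partial>\<mu>) = (\<integral>y. f y \<partial>\<nu>)"
proof -
  define p where "p y = max 0 (f y)" for y
  define n where "n y = max 0 (- f y)" for y
  have f_eq: "f y = p y - n y" for y by (simp add: p_def n_def)
  have pi: "integrable \<nu> p" and ni: "integrable \<nu> n" unfolding p_def n_def using f by auto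
  note P = kernel_integral_nonneg[OF \<nu> pi] and N = kernel_integral_nonneg[OF \<nu> ni]
  have p0: "\<And>y. 0 \<le> p y" and n0: "\<And>y. 0 \<le> n y" by (auto simp: p_def n_def)
  note P = P[OF p0] and N = N[OF n0]
  show i: "AE x in \<mu>. integrable (K x) f"
    using P(1) N(1) unfolding f_eq by eventually_elim (rule Bochner_Integration.integrable_diff)
  have eq: "AE x in \<mu>. (\<integral>y. f y \<partial>K x) = (\<integral>y. p y \<partial>K x) - (\<integral>y. n y \<partial>K x)"
    using P(1) N(1) unfolding f_eq by eventually_elim (rule Bochner_Integration.integral_diff)
  have fb[measurable]: "f \<in> borel_measurable borel"
    using f \<nu>(3) by (auto simp: integrable_iff_bounded cong: measurable_cong_sets)
  note Km[measurable] = \<nu>(2)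
  have m: "(\<lambda>x. \<integral>y. f y \<partial>K x) \<in> borel_measurable \<mu>" by measurable
  have d: "integrable \<mu> (\<lambda>x. (\<integral>y. p y \<partial>K x) - (\<integral>y. n y \<partial>K x))" using P(2) N(2) by simp
  show "integrable \<mu> (\<lambda>x. \<integral>y. f y \<partial>K x)"
    using integrable_cong_AE[OF m borel_measurable_integrable[OF d] eq] d by simp
  have "(\<integral>x. \<integral>y. f y \<partial>K x \<partial>\<mu>) = (\<integral>x. (\<integral>y. p y \<partial>K x) - (\<integral>y. n y \<partial>K x) \<partial>\<mu>)"
    by (rule integral_cong_AE[OF m borel_measurable_integrable[OF d] eq])
  also have "\<dots> = (\<integral>y. p y \<partial>\<nu>) - (\<integral>y. n y \<partial>\<nu>)" using P N by simp
  also have "\<dots> = (\<integral>y. f y \<partial>\<nu>)" unfolding f_eq using pi ni by simp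
  finally show "(\<integral>x. \<integral>y. f y \<partial>K x \<partial>\<mu>) = (\<integral>y. f y \<partial>\<nu>)" .
qed

lemma measurable_barycenter_kernel:
  assumes "K \<in> \<mu> \<rightarrow>\<^sub>M subprob_algebra (borel :: 'b::euclidean_space measure)"
  shows "(\<lambda>x. barycenter (K x)) \<in> borel_measurable \<mu>"
  unfolding barycenter_def using assms by measurable

lemma integral_norm_barycenter_le:
  fixes \<mu> :: "'a::topological_space measure" and \<nu> :: "'b::euclidean_space measure"
  assumes \<mu>: "prob_space \<mu>" "sets \<mu> = sets borel" and \<nu>: "sets \<nu> = sets borel" "integrable \<nu> norm"
    and \<pi>: "\<pi> \<in> couplings \<mu> \<nu>" and K: "disintegration \<mu> \<pi> K"
  shows "integrable \<mu> (\<lambda>x. norm (barycenter (K x)))" "(\<integral>x. norm (barycenter (K x)) \<partial>\<mu>) \<le> (\<integral>y. norm y \<partial>\<nu>)"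
proof -
  note b = coupling_kernel_bind[OF \<mu> \<nu>(1) \<pi> K]
  note k = kernel_integral[OF b \<nu>]
  have m: "(\<lambda>x. norm (barycenter (K x))) \<in> borel_measurable \<mu>"
    using measurable_barycenter_kernel[OF b(2)] by measurable
  have le: "norm (barycenter (K x)) \<le> (\<integral>y. norm y \<partial>K x)" for x
    unfolding barycenter_def by (rule integral_norm_bound)
  show i: "integrable \<mu> (\<lambda>x. norm (barycenter (K x)))"
    by (rule Bochner_Integration.integrable_bound[OF k(2) m]) (use le in \<open>auto intro!: AE_I2 intro: order_trans[OF _ abs_ge_self]\<close>)
  show "(\<integral>x. norm (barycenter (K x)) \<partial>\<mu>) \<le> (\<integral>y. norm y \<partial>\<nu>)"
    unfolding k(3)[symmetric] by (intro integral_mono i k(2) le)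
qed

text \<open>Integration against \<open>K x\<close> annihilates
  \<open>D \<bullet> (y - barycenter (K x))\<close>. The quantifiers over \<open>t\<close> and
  \<open>D\<close> stand inside the almost-everywhere statement, so one null set serves all slopes
  and \<open>D\<close> may depend on \<open>x\<close> arbitrarily. Weak duality and Jensen's
  inequality are both instances.\<close>

lemma AE_affine_minorant_le_integral_kernel:
  fixes \<mu> :: "'a::topological_space measure" and \<nu> :: "'b::euclidean_space measure"
  assumes \<mu>: "prob_space \<mu>" "sets \<mu> = sets borel" and \<nu>: "sets \<nu> = sets borel" "integrable \<nu> norm"
    and \<pi>: "\<pi> \<in> couplings \<mu> \<nu>" and K: "disintegration \<mu> \<pi> K" and \<psi>: "integrable \<nu> \<psi>"
  shows "AE x in \<mu>. \<forall>t D. (\<forall>y. t \<le> \<psi> y + D \<bullet> (y - barycenter (K x))) \<longrightarrow> t \<le> (\<integral>y. \<psi> y \<partial>K x)"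
proof -
  note b = coupling_kernel_bind[OF \<mu> \<nu>(1) \<pi> K]
  note k\<psi> = kernel_integral[OF b \<nu>(1) \<psi>] and kn = kernel_integral[OF b \<nu>]
  have Kp: "prob_space (K x) \<and> sets (K x) = sets borel" if "x \<in> space \<mu>" for x
    using measurable_space[of K \<mu> "prob_algebra borel" x] K that
    by (auto simp: disintegration_def space_prob_algebra)
  have "AE x in \<mu>. x \<in> space \<mu>" by (rule AE_space)
  with k\<psi>(1) kn(1) show ?thesis
  proof eventually_elim
    case (elim x)
    interpret p: prob_space "K x" using Kp[OF elim(3)] by simp
    have idm: "(\<lambda>y. y) \<in> borel_measurable (K x)" using measurable_ident_sets[of "K x" borel] Kp[OF elim(3)] by simp
    have idi: "integrable (K x) (\<lambda>y. y)" using integrable_norm_cancel[OF elim(2) idm] .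
    define m where "m = barycenter (K x)"
    have "t \<le> (\<integral>y. \<psi> y \<partial>K x)" if t: "\<And>y. t \<le> \<psi> y + D \<bullet> (y - m)" for t D
    proof -
      have i: "integrable (K x) (\<lambda>y. D \<bullet> (y - m))" using idi by simp
      have "(\<integral>y. D \<bullet> (y - m) \<partial>K x) = 0"
        using idi p.prob_space by (simp add: m_def barycenter_def)
      then have "(\<integral>y. \<psi> y + D \<bullet> (y - m) \<partial>K x) = (\<integral>y. \<psi> y \<partial>K x)"
        using elim(1) i by simp
      moreover have "(\<integral>y. t \<partial>K x) \<le> (\<integral>y. \<psi> y + D \<bullet> (y - m) \<partial>K x)"
        using elim(1) i t by (intro integral_mono) auto
      ultimately show ?thesis using p.prob_space by simp
    qed
    then show ?case unfolding m_def by blast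
  qed
qed

lemma weak_duality:
  fixes \<mu> :: "'a::topological_space measure" and \<nu> :: "'b::euclidean_space measure"
  assumes \<mu>: "prob_space \<mu>" "sets \<mu> = sets borel" and \<nu>: "sets \<nu> = sets borel" "integrable \<nu> norm"
    and \<pi>: "\<pi> \<in> couplings \<mu> \<nu>" and K: "disintegration \<mu> \<pi> K"
    and \<phi>: "integrable \<mu> \<phi>" and \<psi>: "integrable \<nu> \<psi>"
    and c: "integrable \<mu> (\<lambda>x. c (x, barycenter (K x)))"
    and le: "\<And>x y1 y2. c (x, y1) \<le> \<phi> x + \<psi> y2 + \<Delta> y1 \<bullet> (y2 - y1)"
  shows "(\<integral>x. c (x, barycenter (K x)) \<partial>\<mu>) \<le> (\<integral>x. \<phi> x \<partial>\<mu>) + (\<integral>y. \<psi> y \<partial>\<nu>)"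
proof -
  note k\<psi> = kernel_integral[OF coupling_kernel_bind[OF \<mu> \<nu>(1) \<pi> K] \<nu>(1) \<psi>]
  from AE_affine_minorant_le_integral_kernel[OF \<mu> \<nu> \<pi> K \<psi>]
  have "AE x in \<mu>. c (x, barycenter (K x)) \<le> \<phi> x + (\<integral>y. \<psi> y \<partial>K x)"
  proof eventually_elim
    case (elim x)
    have "\<forall>y. c (x, barycenter (K x)) - \<phi> x \<le> \<psi> y + \<Delta> (barycenter (K x)) \<bullet> (y - barycenter (K x))"
      using le[of x "barycenter (K x)"] by (auto simp: algebra_simps)
    from elim[rule_format, OF this[rule_format]] show ?case by simp
  qed
  then have "(\<integral>x. c (x, barycenter (K x)) \<partial>\<mu>) \<le> (\<integral>x. \<phi> x + (\<integral>y. \<psi> y \<partial>K x) \<partial>\<mu>)"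
    using c \<phi> k\<psi>(2) by (intro integral_mono_AE) auto
  also have "\<dots> = (\<integral>x. \<phi> x \<partial>\<mu>) + (\<integral>y. \<psi> y \<partial>\<nu>)" using \<phi> k\<psi> by simp
  finally show ?thesis .
qed

text \<open>Approximate subgradients at one point remain approximate subgradients nearby, so a
  countably valued selection suffices.\<close>

lemma approx_subgradient_selection:
  fixes \<psi> :: "'b::euclidean_space \<Rightarrow> real"
  assumes conv: "convex_on UNIV \<psi>" and e: "e > 0"
  obtains \<Delta> :: "'b \<Rightarrow> 'b" where "\<Delta> \<in> borel \<rightarrow>\<^sub>M borel" "\<forall>y1 y2. \<psi> y1 \<le> \<psi> y2 + e + \<Delta> y1 \<bullet> (y2 - y1)"
proof -
  have cont: "continuous_on UNIV \<psi>" by (rule convex_on_continuous[OF open_UNIV conv])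
  have pt: "\<exists>D. \<forall>y. \<psi> y0 < \<psi> y + e / 2 + D \<bullet> (y - y0)" for y0
  proof -
    \<comment> \<open>The point of the graph is lowered by \<open>e / 2\<close> to lie strictly
      outside the closed epigraph. Testing the separation at \<open>y0\<close> itself then shows
      \<open>b > 0\<close>, so the hyperplane is not vertical. In the sign convention of the
      constraint, the slope \<open>a /\<^sub>R b\<close> is minus an approximate
      subgradient.\<close>
    define S where "S = {z::'b \<times> real. \<psi> (fst z) \<le> snd z}"
    have "S = epigraph UNIV \<psi>" by (auto simp: S_def epigraph_def)
    then have "convex S" using conv by (simp add: convex_epigraph)
    moreover have "closed S" unfolding S_def
      by (intro closed_Collect_le continuous_intros continuous_on_compose2[OF cont]) auto
    moreover have "(y0, \<psi> y0 - e / 2) \<notin> S" using e by (simp add: S_def)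
    ultimately obtain ab \<beta> where "inner ab (y0, \<psi> y0 - e / 2) < \<beta>" "\<forall>z\<in>S. inner ab z > \<beta>"
      using separating_hyperplane_closed_point[of S] by blast
    moreover obtain a b where "ab = (a, b)" by (cases ab)
    ultimately have sep: "a \<bullet> y0 + b * (\<psi> y0 - e / 2) < a \<bullet> y + b * \<psi> y" for y
      by (auto simp: S_def intro: less_trans)
    have "b * (e / 2) > 0" using sep[of y0] by (simp add: algebra_simps)
    then have b: "b > 0" using e by (simp add: zero_less_mult_iff)
    have "\<psi> y0 < \<psi> y + e / 2 + (a /\<^sub>R b) \<bullet> (y - y0)" for y
    proof -
      have "b * ((a /\<^sub>R b) \<bullet> (y - y0)) = a \<bullet> (y - y0)" using b by simp
      then have "b * \<psi> y0 < b * (\<psi> y + e / 2 + (a /\<^sub>R b) \<bullet> (y - y0))"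
        using sep[of y] b by (simp only: distrib_left) (simp add: algebra_simps inner_diff_right)
      then show ?thesis using b by simp
    qed
    then show ?thesis by blast
  qed
  let ?P = "\<lambda>U. \<exists>D. \<forall>y1\<in>U. \<forall>y2. \<psi> y1 \<le> \<psi> y2 + e + D \<bullet> (y2 - y1)"
  have "\<exists>U. open U \<and> y0 \<in> U \<and> ?P U" for y0
  proof -
    obtain D where D: "\<And>y. \<psi> y0 < \<psi> y + e / 2 + D \<bullet> (y - y0)" using pt by blast
    \<comment> \<open>On this set moving the base point from \<open>y0\<close> to \<open>y1\<close>
      costs less than \<open>e / 2\<close>; with the \<open>e / 2\<close> already spent at
      \<open>y0\<close> this gives \<open>e\<close>.\<close>
    let ?U = "{y1. \<psi> y1 + D \<bullet> (y1 - y0) < \<psi> y0 + e / 2}"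
    have "open ?U" by (intro open_Collect_less continuous_intros cont)
    moreover have "y0 \<in> ?U" using e by simp
    moreover have "\<psi> y1 \<le> \<psi> y2 + e + D \<bullet> (y2 - y1)" if "y1 \<in> ?U" for y1 y2
      using that D[of y2] by (simp add: inner_diff_right)
    ultimately show ?thesis by blast
  qed
  then obtain U :: "nat \<Rightarrow> 'b set" where U: "\<forall>n. open (U n)" "\<forall>n. ?P (U n)" "(\<Union>n. U n) = UNIV"
    by (rule countable_open_cover[of ?P])
  then obtain D where D: "\<And>n y1 y2. y1 \<in> U n \<Longrightarrow> \<psi> y1 \<le> \<psi> y2 + e + D n \<bullet> (y2 - y1)" by metis
  \<comment> \<open>The first index of a covering set is measurable, hence so is the slope attached
    to it.\<close>
  define n where "n y = (LEAST n. y \<in> U n)" for y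
  have [measurable]: "U k \<in> sets borel" for k using U(1) by auto
  have "n \<in> borel \<rightarrow>\<^sub>M count_space UNIV" unfolding n_def by measurable
  then have "(\<lambda>y. D (n y)) \<in> borel \<rightarrow>\<^sub>M borel" by (rule measurable_compose) simp
  moreover have "y \<in> U (n y)" for y
  proof -
    have "y \<in> (\<Union>n. U n)" using U(3) by simp
    then obtain k where "y \<in> U k" by blast
    then show ?thesis unfolding n_def by (rule LeastI)
  qed
  ultimately show thesis using that[of "\<lambda>y. D (n y)"] D by blast
qed

text \<open>Approximate subgradients at the barycenter suffice, as their error is arbitrary.
  Nonnegativity of \<open>\<psi>\<close> turns the upper bound into domination and so gives
  integrability. The lemma carries moment bounds from \<open>\<nu>\<close> to the law of the
  barycenters.\<close>

lemma kernel_jensen: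
  fixes \<mu> :: "'a::topological_space measure" and \<nu> :: "'b::euclidean_space measure"
  assumes \<mu>: "prob_space \<mu>" "sets \<mu> = sets borel" and \<nu>: "sets \<nu> = sets borel" "integrable \<nu> norm"
    and \<pi>: "\<pi> \<in> couplings \<mu> \<nu>" and K: "disintegration \<mu> \<pi> K"
    and \<psi>: "integrable \<nu> \<psi>" "convex_on UNIV \<psi>" "\<And>y. 0 \<le> \<psi> y"
  shows "integrable \<mu> (\<lambda>x. \<psi> (barycenter (K x)))"
    "(\<integral>x. \<psi> (barycenter (K x)) \<partial>\<mu>) \<le> (\<integral>y. \<psi> y \<partial>\<nu>)"
proof -
  note b = coupling_kernel_bind[OF \<mu> \<nu>(1) \<pi> K]
  note k = kernel_integral[OF b \<nu>(1) \<psi>(1)]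
  have AE: "AE x in \<mu>. \<psi> (barycenter (K x)) \<le> (\<integral>y. \<psi> y \<partial>K x)"
    using AE_affine_minorant_le_integral_kernel[OF \<mu> \<nu> \<pi> K \<psi>(1)]
  proof eventually_elim
    case (elim x)
    show ?case
    proof (rule field_le_epsilon)
      fix e :: real assume "e > 0"
      then obtain \<Delta> :: "'b \<Rightarrow> 'b" where "\<forall>y1 y2. \<psi> y1 \<le> \<psi> y2 + e + \<Delta> y1 \<bullet> (y2 - y1)"
        using approx_subgradient_selection[OF \<psi>(2), of e] by blast
      then have "\<forall>y. \<psi> (barycenter (K x)) - e \<le> \<psi> y + \<Delta> (barycenter (K x)) \<bullet> (y - barycenter (K x))"
        by (auto simp: algebra_simps)
      from elim[rule_format, OF this[rule_format]]
      show "\<psi> (barycenter (K x)) \<le> (\<integral>y. \<psi> y \<partial>K x) + e" by simp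
    qed
  qed
  have "\<psi> \<in> borel_measurable borel"
    by (rule borel_measurable_continuous_onI[OF convex_on_continuous[OF open_UNIV \<psi>(2)]])
  from measurable_compose[OF measurable_barycenter_kernel[OF b(2)] this]
  have m: "(\<lambda>x. \<psi> (barycenter (K x))) \<in> borel_measurable \<mu>" .
  have "AE x in \<mu>. norm (\<psi> (barycenter (K x))) \<le> norm (\<integral>y. \<psi> y \<partial>K x)"
    using AE by eventually_elim (use \<psi>(3) in simp)
  with k(2) m show i: "integrable \<mu> (\<lambda>x. \<psi> (barycenter (K x)))"
    by (rule Bochner_Integration.integrable_bound)
  show "(\<integral>x. \<psi> (barycenter (K x)) \<partial>\<mu>) \<le> (\<integral>y. \<psi> y \<partial>\<nu>)"
    unfolding k(3)[symmetric] by (rule integral_mono_AE[OF i k(2) AE])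
qed

section \<open>Discretisation and stability\<close>

text \<open>The index \<^term>\<open>None\<close> carries the part of the space outside a large ball.\<close>

lemma fine_partition_of_unity:
  fixes R h :: real
  assumes R: "R \<ge> 0" and h: "h > 0"
  obtains J :: "'b::euclidean_space option set" and f :: "'b option \<Rightarrow> 'b \<Rightarrow> real" and z :: "'b option \<Rightarrow> 'b" where "finite J"
    "\<forall>i\<in>J. continuous_on UNIV (f i)" "\<forall>i\<in>J. \<forall>y. 0 \<le> f i y" "\<forall>y. (\<Sum>i\<in>J. f i y) = 1"
    "\<forall>y. (\<Sum>i\<in>J. f i y * norm (y - z i)) \<le> h + 2 * max 0 (norm y - R)"
    "\<forall>i\<in>J. norm (z i) \<le> 2 * R"
proof -
  \<comment> \<open>The net covers radius \<open>2 * R\<close> so that the outer function lives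
    where \<open>norm y > 2 * R\<close>. There the distance \<open>norm y\<close> to its centre 0 is
    at most \<open>2 * (norm y - R)\<close>, the origin of the factor 2 in the bound.\<close>
  obtain T where T: "T \<subseteq> cball (0::'b) (2 * R)" "finite T" "cball 0 (2 * R) \<subseteq> (\<Union>x\<in>T. ball x h)"
    using compactE_image[of "cball (0::'b) (2 * R)" "cball 0 (2 * R)" "\<lambda>x. ball x h"] h by force
  define J where "J = insert None (Some ` T)"
  define \<beta> :: "'b option \<Rightarrow> 'b \<Rightarrow> real" where
    "\<beta> i y = (case i of None \<Rightarrow> max 0 (norm y - 2 * R) | Some t \<Rightarrow> max 0 (h - dist t y))" for i y
  define S where "S y = (\<Sum>i\<in>J. \<beta> i y)" for y
  define f where "f i y = \<beta> i y / S y" for i y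
  define z where "z i = (case i of None \<Rightarrow> 0 | Some t \<Rightarrow> t)" for i :: "'b option"
  have J: "finite J" using T(2) by (simp add: J_def)
  have \<beta>0: "0 \<le> \<beta> i y" for i y by (simp add: \<beta>_def split: option.split)
  have \<beta>c: "continuous_on UNIV (\<beta> i)" for i
    unfolding \<beta>_def by (cases i) (auto intro!: continuous_intros)
  have S0: "S y > 0" for y
  proof -
    have "\<exists>i\<in>J. \<beta> i y > 0"
    proof (cases "norm y \<le> 2 * R")
      case True
      then obtain t where "t \<in> T" "dist t y < h" using T(3) by (force simp: subset_iff)
      then show ?thesis by (intro bexI[of _ "Some t"]) (auto simp: J_def \<beta>_def)
    next
      case False
      then show ?thesis by (intro bexI[of _ None]) (auto simp: J_def \<beta>_def)
    qed
    then show ?thesis unfolding S_def using J \<beta>0 by (metis sum_pos2)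
  qed
  have Sc: "continuous_on UNIV S" unfolding S_def by (intro continuous_on_sum \<beta>c)
  have f0: "0 \<le> f i y" for i y unfolding f_def using \<beta>0 S0[of y] by simp
  have f1: "(\<Sum>i\<in>J. f i y) = 1" for y
    unfolding f_def using S0[of y] by (simp add: sum_divide_distrib[symmetric] S_def)
  have fc: "continuous_on UNIV (f i)" for i
    unfolding f_def using S0 by (intro continuous_on_divide \<beta>c Sc) (auto simp: less_imp_neq[THEN not_sym])
  have "f i y * norm (y - z i) \<le> f i y * (h + 2 * max 0 (norm y - R))" for i y
  proof (cases "\<beta> i y = 0")
    case True
    then show ?thesis by (simp add: f_def)
  next
    case False
    have "norm (y - z i) \<le> h + 2 * max 0 (norm y - R)"
      using False h by (cases i) (auto simp: \<beta>_def z_def dist_norm norm_minus_commute max_def split: if_splits)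
    then show ?thesis using f0 by (rule mult_left_mono)
  qed
  then have "(\<Sum>i\<in>J. f i y * norm (y - z i)) \<le> (\<Sum>i\<in>J. f i y) * (h + 2 * max 0 (norm y - R))" for y
    unfolding sum_distrib_right by (intro sum_mono)
  then have near: "(\<Sum>i\<in>J. f i y * norm (y - z i)) \<le> h + 2 * max 0 (norm y - R)" for y
    by (simp only: f1 mult_1)
  have "norm (z i) \<le> 2 * R" if "i \<in> J" for i
    using that T(1) R by (auto simp: J_def z_def)
  then show thesis using that[of J f z] J fc f0 f1 near by blast
qed

lemma measurable_cost_map:
  fixes c :: "'a::second_countable_topology \<times> 'b::euclidean_space \<Rightarrow> real"
  assumes c: "continuous_on UNIV c" and \<mu>: "sets \<mu> = sets borel" and u: "u \<in> borel_measurable \<mu>"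
  shows "(\<lambda>x. c (x, u x)) \<in> borel_measurable \<mu>"
proof -
  have [measurable]: "c \<in> borel_measurable borel" by (rule borel_measurable_continuous_onI[OF c])
  have [measurable]: "(\<lambda>x. x) \<in> borel_measurable \<mu>" using measurable_ident_sets[OF \<mu>] .
  note [measurable] = u
  show ?thesis by measurable
qed

lemma tight_compact:
  fixes \<mu> :: "'a::polish_space measure"
  assumes \<mu>: "prob_space \<mu>" "sets \<mu> = sets borel" and e: "e > 0"
  obtains X where "compact X" "measure \<mu> (UNIV - X) < e"
proof -
  interpret prob_space \<mu> by fact
  have sp: "space \<mu> = UNIV" using sets_eq_imp_space_eq[OF \<mu>(2)] by simp
  have "emeasure \<mu> UNIV = (SUP K\<in>{K. K \<subseteq> UNIV \<and> compact K}. emeasure \<mu> K)"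
    by (rule inner_regular[OF \<mu>(2)]) auto
  then have "(SUP K\<in>{K. K \<subseteq> UNIV \<and> compact K}. emeasure \<mu> K) = 1" using emeasure_space_1 sp by simp
  moreover have "ennreal (1 - e) < 1" using e by (simp add: ennreal_less_one_iff)
  ultimately obtain K where K: "compact K" "ennreal (1 - e) < emeasure \<mu> K"
    by (metis (mono_tags, lifting) less_SUP_iff mem_Collect_eq)
  then have "1 - e < measure \<mu> K"
    by (metis emeasure_eq_measure ennreal_leI not_le)
  moreover have "K \<in> events" using K(1) \<mu>(2) by (simp add: borel_compact)
  ultimately have "measure \<mu> (UNIV - K) < e" using prob_compl[of K] sp by simp
  then show thesis using that K(1) by blast
qed

text \<open>Off an event of small probability, \<open>x\<close> lies in a compact set,
  \<open>u x\<close> in a ball, and \<open>v x\<close> near \<open>u x\<close>, where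
  \<open>c\<close> is uniformly continuous. The tolerance \<open>\<eta>\<close> depends on
  \<open>u\<close> only through the moment bound \<open>M\<close>; this matters because the maps to
  which it is applied are built after \<open>\<eta>\<close> has been fixed.\<close>

lemma cost_integral_stable:
  fixes \<mu> :: "'a::polish_space measure" and c :: "'a \<times> 'b::euclidean_space \<Rightarrow> real"
  assumes \<mu>: "prob_space \<mu>" "sets \<mu> = sets borel"
    and c_cont: "continuous_on UNIV c" and c_bound: "\<And>z. \<bar>c z\<bar> \<le> N" and e: "e > 0" and M: "M \<ge> 0"
  obtains \<eta> where "\<eta> > 0"
    "\<forall>u v. u \<in> borel_measurable \<mu> \<longrightarrow> v \<in> borel_measurable \<mu> \<longrightarrow> integrable \<mu> (\<lambda>x. norm (u x)) \<longrightarrow>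
      integrable \<mu> (\<lambda>x. norm (u x - v x)) \<longrightarrow> (\<integral>x. norm (u x) \<partial>\<mu>) \<le> M \<longrightarrow> (\<integral>x. norm (u x - v x) \<partial>\<mu>) \<le> \<eta> \<longrightarrow>
      (\<integral>x. c (x, v x) \<partial>\<mu>) \<le> (\<integral>x. c (x, u x) \<partial>\<mu>) + e"
proof -
  interpret prob_space \<mu> by fact
  have sp: "space \<mu> = UNIV" using sets_eq_imp_space_eq[OF \<mu>(2)] by simp
  have N: "0 \<le> N" using c_bound[of undefined] by linarith
  define W where "W = N + 1"
  have W: "W > 0" using N by (simp add: W_def)
  \<comment> \<open>Three exceptional events of weight \<open>d\<close> each, at cost
    \<open>2 * N\<close>, use at most half of \<open>e\<close>.\<close>
  define d where "d = e / (12 * W)"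
  have d: "d > 0" using e W by (auto simp: d_def)
  have dN: "2 * N * (3 * d) + e / 2 \<le> e"
  proof -
    have "12 * (N * d) \<le> 12 * (W * d)" using d by (simp add: W_def algebra_simps)
    also have "\<dots> = e" using W by (simp add: d_def)
    finally show ?thesis by simp
  qed
  obtain X where X: "compact X" "measure \<mu> (UNIV - X) < d" by (rule tight_compact[OF \<mu> d])
  \<comment> \<open>By Markov's inequality \<open>norm (u x)\<close> reaches \<open>B\<close> with
    probability at most \<open>M / B \<le> d\<close>.\<close>
  define B where "B = M / d + 1"
  have B: "B > 0" "M / B \<le> d" using M d by (auto simp: B_def field_simps add_pos_nonneg)
  have "uniformly_continuous_on (X \<times> cball 0 (B + 1)) c"
    using X(1) by (intro compact_uniformly_continuous continuous_on_subset[OF c_cont] compact_Times) auto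
  then obtain \<tau>' where \<tau>': "\<tau>' > 0" "\<And>z z'. z \<in> X \<times> cball 0 (B + 1) \<Longrightarrow> z' \<in> X \<times> cball 0 (B + 1) \<Longrightarrow> dist z' z < \<tau>' \<Longrightarrow> dist (c z') (c z) < e / 2"
    unfolding uniformly_continuous_on_def using e by (metis half_gt_zero)
  define \<tau> where "\<tau> = min 1 \<tau>'"
  \<comment> \<open>\<open>\<tau> \<le> 1\<close> keeps \<open>v x\<close> in the ball of radius
    \<open>B + 1\<close> whenever \<open>u x\<close> is in the one of radius
    \<open>B\<close>.\<close>
  have \<tau>: "\<tau> > 0" "\<tau> \<le> 1" "\<tau> \<le> \<tau>'" using \<tau>'(1) by (auto simp: \<tau>_def)
  show thesis
  proof (rule that[of "\<tau> * d"])
    show "\<tau> * d > 0" using \<tau> d by simp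
  next
    show "\<forall>u v. u \<in> borel_measurable \<mu> \<longrightarrow> v \<in> borel_measurable \<mu> \<longrightarrow> integrable \<mu> (\<lambda>x. norm (u x)) \<longrightarrow>
      integrable \<mu> (\<lambda>x. norm (u x - v x)) \<longrightarrow> (\<integral>x. norm (u x) \<partial>\<mu>) \<le> M \<longrightarrow> (\<integral>x. norm (u x - v x) \<partial>\<mu>) \<le> \<tau> * d \<longrightarrow>
      (\<integral>x. c (x, v x) \<partial>\<mu>) \<le> (\<integral>x. c (x, u x) \<partial>\<mu>) + e"
    proof (intro allI impI)
      fix u v :: "'a \<Rightarrow> 'b"
      assume um: "u \<in> borel_measurable \<mu>" and vm: "v \<in> borel_measurable \<mu>"
        and ui: "integrable \<mu> (\<lambda>x. norm (u x))" and uvi: "integrable \<mu> (\<lambda>x. norm (u x - v x))"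
        and uM: "(\<integral>x. norm (u x) \<partial>\<mu>) \<le> M" and uv: "(\<integral>x. norm (u x - v x) \<partial>\<mu>) \<le> \<tau> * d"
      have XC: "UNIV - X \<in> sets \<mu>" using sets.compl_sets[of X \<mu>] X(1) \<mu>(2) sp by (simp add: borel_compact)
      have ci: "integrable \<mu> (\<lambda>x. c (x, u x))" "integrable \<mu> (\<lambda>x. c (x, v x))"
        using measurable_cost_map[OF c_cont \<mu>(2) um] measurable_cost_map[OF c_cont \<mu>(2) vm] c_bound
        by (auto intro!: integrable_bounded finite_measure_axioms)
      \<comment> \<open>Markov's inequality inside the integrand: \<open>?E\<close> is at least 1 on
        the exceptional event, and its integral is at most \<open>3 * d\<close>.\<close>
      let ?E = "\<lambda>x. indicator (UNIV - X) x + norm (u x) / B + norm (u x - v x) / \<tau>"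
      have Ei: "integrable \<mu> ?E"
        using ui uvi XC by (auto intro!: integrable_real_indicator simp: less_top[symmetric])
      have le: "c (x, v x) \<le> c (x, u x) + (e / 2 + 2 * N * ?E x)" for x
      proof (cases "x \<in> X \<and> norm (u x) < B \<and> norm (u x - v x) < \<tau>")
        case True
        have "norm (v x) \<le> norm (u x) + norm (u x - v x)" by (metis add_diff_cancel_left' diff_add_cancel norm_minus_commute norm_triangle_sub)
        then have "norm (v x) \<le> B + 1" using True \<tau> by linarith
        moreover have "dist (x, v x) (x, u x) < \<tau>'"
          using True \<tau> by (simp add: dist_Pair_Pair dist_norm norm_minus_commute)
        ultimately have "dist (c (x, v x)) (c (x, u x)) < e / 2" using True by (intro \<tau>'(2)) auto
        then have "c (x, v x) \<le> c (x, u x) + e / 2" unfolding dist_real_def by linarith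
        moreover have "0 \<le> 2 * N * ?E x" using N B \<tau> by (intro mult_nonneg_nonneg add_nonneg_nonneg) auto
        ultimately show ?thesis by linarith
      next
        case False
        have "0 \<le> norm (u x) / B" "0 \<le> norm (u x - v x) / \<tau>" "0 \<le> (indicator (UNIV - X) x :: real)" using B \<tau> by auto
        moreover have "x \<notin> X \<or> 1 \<le> norm (u x) / B \<or> 1 \<le> norm (u x - v x) / \<tau>"
          using False B \<tau> by (auto simp: not_less)
        ultimately have "1 \<le> ?E x" by (auto simp: indicator_def)
        then have "2 * N * 1 \<le> 2 * N * ?E x" using N by (intro mult_left_mono) auto
        then show ?thesis using c_bound[of "(x, v x)"] c_bound[of "(x, u x)"] e by linarith
      qed
      have "(\<integral>x. c (x, v x) \<partial>\<mu>) \<le> (\<integral>x. c (x, u x) + (e / 2 + 2 * N * ?E x) \<partial>\<mu>)"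
        by (intro integral_mono ci le Bochner_Integration.integrable_add integrable_mult_right Ei) auto
      also have "\<dots> = (\<integral>x. c (x, u x) \<partial>\<mu>) + (e / 2 + 2 * N * (\<integral>x. ?E x \<partial>\<mu>))"
      proof -
        have "(\<integral>x. e / 2 + 2 * N * ?E x \<partial>\<mu>) = e / 2 + 2 * N * (\<integral>x. ?E x \<partial>\<mu>)"
          using Ei prob_space by (subst Bochner_Integration.integral_add) auto
        then show ?thesis using ci Ei by (subst Bochner_Integration.integral_add) auto
      qed
      also have "(\<integral>x. ?E x \<partial>\<mu>) = measure \<mu> (UNIV - X) + (\<integral>x. norm (u x) \<partial>\<mu>) / B + (\<integral>x. norm (u x - v x) \<partial>\<mu>) / \<tau>"
        using ui uvi XC by (simp add: less_top[symmetric])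
      also have "\<dots> \<le> d + d + d"
      proof (intro add_mono)
        have "(\<integral>x. norm (u x) \<partial>\<mu>) / B \<le> M / B" using uM B by (intro divide_right_mono) auto
        then show "(\<integral>x. norm (u x) \<partial>\<mu>) / B \<le> d" using B(2) by linarith
        show "(\<integral>x. norm (u x - v x) \<partial>\<mu>) / \<tau> \<le> d" using uv \<tau> by (simp add: pos_divide_le_eq mult.commute)
      qed (use X in simp)
      finally show "(\<integral>x. c (x, v x) \<partial>\<mu>) \<le> (\<integral>x. c (x, u x) \<partial>\<mu>) + e"
        using dN N by (smt (verit) mult_left_mono)
    qed
  qed
qed

section \<open>Strong duality\<close>

lemma integral_excess_tendsto_0:
  fixes f :: "'a \<Rightarrow> real"
  assumes f: "integrable M f" "\<And>x. 0 \<le> f x"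
  shows "(\<lambda>n. \<integral>x. max 0 (f x - real n) \<partial>M) \<longlonglongrightarrow> 0"
proof -
  have "(\<lambda>n. \<integral>x. max 0 (f x - real n) \<partial>M) \<longlonglongrightarrow> (\<integral>x. 0 \<partial>M)"
  proof (rule integral_dominated_convergence[where w=f])
    show "AE x in M. (\<lambda>n. max 0 (f x - real n)) \<longlonglongrightarrow> 0"
    proof (rule AE_I2, rule tendsto_eventually)
      fix x
      have "eventually (\<lambda>n. n \<ge> nat \<lceil>f x\<rceil>) sequentially" by (rule eventually_ge_at_top)
      then show "eventually (\<lambda>n. max 0 (f x - real n) = 0) sequentially"
        by eventually_elim linarith
    qed
    show "AE x in M. norm (max 0 (f x - real n)) \<le> f x" for n
      using f(2) by (intro AE_I2) simp
  qed (use f in auto)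
  then show ?thesis by simp
qed

lemma integral_excess_small:
  fixes f :: "'a \<Rightarrow> real"
  assumes "integrable M f" "\<And>x. 0 \<le> f x" "e > 0"
  obtains n0 where "\<forall>n\<ge>n0. (\<integral>x. max 0 (f x - real n) \<partial>M) < e"
  using order_tendstoD(2)[OF integral_excess_tendsto_0[OF assms(1,2)] assms(3)]
  by (auto simp: eventually_sequentially)

text \<open>The dual pair and the strategy come from \<open>penalised_duality\<close>, the coupling
  from \<open>strategy_rounding\<close>. The link is that the two penalties together cannot exceed
  roughly the range of the payoff, so large weights push the tail excess and the mismatches below
  what \<open>\<eta>\<close> allows.\<close>

lemma strong_duality_bounded:
  fixes \<mu> :: "'a::polish_space measure" and \<nu> :: "'b::euclidean_space measure" and c :: "'a \<times> 'b \<Rightarrow> real"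
  assumes \<mu>: "prob_space \<mu>" "sets \<mu> = sets borel" and atomless: "\<And>x. emeasure \<mu> {x} = 0"
    and \<nu>: "prob_space \<nu>" "sets \<nu> = sets borel" "integrable \<nu> norm"
    and c_cont: "continuous_on UNIV c" and c_bound: "\<And>z. \<bar>c z\<bar> \<le> N" and e: "e > 0"
  obtains \<pi> K \<phi> \<psi> C where "\<pi> \<in> couplings \<mu> \<nu>" "disintegration \<mu> \<pi> K"
    "continuous_on UNIV \<phi>" "\<forall>x. \<bar>\<phi> x\<bar> \<le> C"
    "continuous_on UNIV \<psi>" "convex_on UNIV \<psi>" "\<forall>y. \<bar>\<psi> y\<bar> \<le> C * (1 + norm y)"
    "\<forall>x y. c (x, y) \<le> \<phi> x + \<psi> y"
    "(\<integral>x. \<phi> x \<partial>\<mu>) + (\<integral>y. \<psi> y \<partial>\<nu>) \<le> (\<integral>x. c (x, barycenter (K x)) \<partial>\<mu>) + e"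
proof -
  interpret prob_space \<mu> by fact
  interpret N: prob_space \<nu> by fact
  have N0: "0 \<le> N" using c_bound[of undefined] by linarith
  have bm: "h \<in> borel_measurable \<nu>" if "continuous_on UNIV h" for h :: "'b \<Rightarrow> real"
    using borel_measurable_continuous_onI[OF that] \<nu>(2) by (simp cong: measurable_cong_sets)
  define M where "M = (\<integral>y. norm y \<partial>\<nu>)"
  have e4: "e / 4 > 0" using e by simp
  have M0: "0 \<le> M" by (simp add: M_def)
  obtain \<eta> where \<eta>: "\<eta> > 0"
    "\<forall>u v. u \<in> borel_measurable \<mu> \<longrightarrow> v \<in> borel_measurable \<mu> \<longrightarrow> integrable \<mu> (\<lambda>x. norm (u x)) \<longrightarrow>
      integrable \<mu> (\<lambda>x. norm (u x - v x)) \<longrightarrow> (\<integral>x. norm (u x) \<partial>\<mu>) \<le> M \<longrightarrow> (\<integral>x. norm (u x - v x) \<partial>\<mu>) \<le> \<eta> \<longrightarrow>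
      (\<integral>x. c (x, v x) \<partial>\<mu>) \<le> (\<integral>x. c (x, u x) \<partial>\<mu>) + e / 4"
    by (rule cost_integral_stable[OF \<mu> c_cont c_bound e4 M0])
  define W where "W = N + 1"
  have W: "W > 0" using N0 by (simp add: W_def)
  \<comment> \<open>Chosen so that \<open>2 * W / A = \<eta> / 8\<close>, where \<open>2 * W\<close>
    will bound the penalties.\<close>
  define A where "A = 16 * W / \<eta>"
  have A: "A > 0" using W \<eta>(1) by (simp add: A_def)
  define \<delta> where "\<delta> = min 1 (e / 4)"
  have \<delta>: "\<delta> > 0" "\<delta> \<le> 1" "\<delta> \<le> e / 4" using e by (auto simp: \<delta>_def)
  define h where "h = \<eta> / 8"
  have h: "h > 0" using \<eta>(1) by (simp add: h_def)
  \<comment> \<open>Below \<open>\<delta> / A\<close> the tail of \<open>\<nu>\<close> costs at most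
    \<open>\<delta>\<close> in value; below \<open>h\<close> it fits the budget for
    displacements.\<close>
  have "min (\<delta> / A) h > 0" using \<delta> A h by simp
  then obtain n0 where n0: "\<forall>n\<ge>n0. (\<integral>y. max 0 (norm y - real n) \<partial>\<nu>) < min (\<delta> / A) h"
    using integral_excess_small[OF \<nu>(3) norm_ge_zero] by blast
  define R where "R = real n0"
  have R: "R \<ge> 0" by (simp add: R_def)
  define g where "g y = max 0 (norm y - R)" for y :: 'b
  have g_cont: "continuous_on UNIV g" unfolding g_def by (intro continuous_intros)
  have g: "0 \<le> g y" "norm y - R \<le> g y" "g y \<le> norm y" for y using R by (auto simp: g_def)
  have gi: "integrable \<nu> g" unfolding g_def using \<nu>(3) by auto
  have "(\<integral>y. g y \<partial>\<nu>) < min (\<delta> / A) h" unfolding g_def R_def by (rule n0[rule_format]) simp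
  then have gA: "A * (\<integral>y. g y \<partial>\<nu>) \<le> \<delta>" and gh: "(\<integral>y. g y \<partial>\<nu>) \<le> h"
    using A by (auto simp: pos_less_divide_eq mult.commute)
  obtain J :: "'b option set" and f :: "'b option \<Rightarrow> 'b \<Rightarrow> real" and z :: "'b option \<Rightarrow> 'b" where J: "finite J"
    and f: "\<forall>i\<in>J. continuous_on UNIV (f i)" "\<forall>i\<in>J. \<forall>y. 0 \<le> f i y" "\<forall>y. (\<Sum>i\<in>J. f i y) = 1"
    and near: "\<forall>y. (\<Sum>i\<in>J. f i y * norm (y - z i)) \<le> h + 2 * max 0 (norm y - R)"
    and z: "\<forall>i\<in>J. norm (z i) \<le> 2 * R"
    by (rule fine_partition_of_unity[OF R h])
  have f1: "f i y \<le> 1" if "i \<in> J" for i y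
    using member_le_sum[of i J "\<lambda>i. f i y"] that J f(2,3) by auto
  define n where "n = real (card J)"
  have n: "n \<ge> 0" by (simp add: n_def)
  \<comment> \<open>The squares are converted by
    \<open>\<bar>m i\<bar> \<le> t + (m i)\<^sup>2 / t\<close>. With the factor
    \<open>R + 1\<close>, the summands \<open>t\<close> use at most \<open>\<eta> / 16\<close> in
    total, and \<open>L\<close> is large enough for the squares over \<open>t\<close> to use at most
    another \<open>\<eta> / 16\<close>.\<close>
  define t where "t = \<eta> / (16 * (R + 1) * (n + 1))"
  have t: "t > 0" using \<eta>(1) R n unfolding t_def by (intro divide_pos_pos mult_pos_pos) auto
  define L where "L = 16 * W * (R + 1) / (t * \<eta>)"
  have L: "L > 0" using W R t \<eta>(1) unfolding L_def by (intro divide_pos_pos mult_pos_pos) auto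
  obtain s \<phi> \<psi> C where s: "s \<in> strategies \<mu>"
    and \<phi>: "continuous_on UNIV \<phi>" "\<And>x. \<bar>\<phi> x\<bar> \<le> C"
    and \<psi>: "continuous_on UNIV \<psi>" "convex_on UNIV \<psi>" "\<And>y. \<bar>\<psi> y\<bar> \<le> C * (1 + norm y)"
    and le: "\<And>x y. c (x, y) \<le> \<phi> x + \<psi> y"
    and opt: "(\<integral>x. \<phi> x \<partial>\<mu>) + (\<integral>y. \<psi> y \<partial>\<nu>) \<le> (\<integral>x. c (x, bary (s x)) \<partial>\<mu>) - A * (\<integral>x. pexp (s x) g \<partial>\<mu>)
      + A * (\<integral>y. g y \<partial>\<nu>) - 2 * L * (\<Sum>i\<in>J. ((\<integral>x. pexp (s x) (f i) \<partial>\<mu>) - (\<integral>y. f i y \<partial>\<nu>))\<^sup>2) + \<delta>"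
  proof (rule penalised_duality[OF \<mu> atomless \<nu> c_cont c_bound g_cont g J, of f A L \<delta>])
    show "continuous_on UNIV (f i)" if "i \<in> J" for i using f(1) that by blast
    show "0 \<le> f i y" if "i \<in> J" for i y using f(2) that by blast
    show "f i y \<le> 1" if "i \<in> J" for i y using f1 that by blast
  qed (use A L \<delta> in auto)
  define m where "m i = (\<integral>x. pexp (s x) (f i) \<partial>\<mu>) - (\<integral>y. f i y \<partial>\<nu>)" for i
  define \<gamma> where "\<gamma> = (\<integral>x. pexp (s x) g \<partial>\<mu>)"
  have \<gamma>0: "0 \<le> \<gamma>" unfolding \<gamma>_def using g(1) by simp
  have \<phi>i: "integrable \<mu> \<phi>"
    using borel_measurable_continuous_onI[OF \<phi>(1)] \<mu>(2) \<phi>(2)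
    by (intro integrable_bounded[where K=C] finite_measure_axioms) (auto cong: measurable_cong_sets)
  have C0: "0 \<le> C" using \<phi>(2)[of undefined] by linarith
  have \<psi>i: "integrable \<nu> \<psi>"
  proof (rule Bochner_Integration.integrable_bound)
    show "integrable \<nu> (\<lambda>y. C * (1 + norm y))" using \<nu>(3) by auto
    show "AE y in \<nu>. norm (\<psi> y) \<le> norm (C * (1 + norm y))"
      using \<psi>(3) by (intro AE_I2) (metis abs_ge_self order_trans real_norm_def)
  qed (rule bm[OF \<psi>(1)])
  have dual_ge: "- N \<le> (\<integral>x. \<phi> x \<partial>\<mu>) + (\<integral>y. \<psi> y \<partial>\<nu>)"
  proof -
    have "- N \<le> \<phi> x + (\<integral>y. \<psi> y \<partial>\<nu>)" for x
    proof -
      have "- N \<le> \<phi> x + \<psi> y" for y using le[of x y] c_bound[of "(x, y)"] by linarith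
      then have "(\<integral>y. - N \<partial>\<nu>) \<le> (\<integral>y. \<phi> x + \<psi> y \<partial>\<nu>)" using \<psi>i by (intro integral_mono) auto
      then show ?thesis using \<psi>i N.prob_space by simp
    qed
    then have "(\<integral>x. - N \<partial>\<mu>) \<le> (\<integral>x. \<phi> x + (\<integral>y. \<psi> y \<partial>\<nu>) \<partial>\<mu>)" using \<phi>i by (intro integral_mono) auto
    then show ?thesis using \<phi>i prob_space by simp
  qed
  have cs: "integrable \<mu> (\<lambda>x. c (x, bary (s x)))"
    by (rule integrable_cost_strategy[OF finite_measure_axioms \<mu>(2) c_cont c_bound s])
  have "(\<integral>x. c (x, bary (s x)) \<partial>\<mu>) \<le> (\<integral>x. N \<partial>\<mu>)"
    using cs c_bound by (intro integral_mono) (auto simp: abs_le_iff)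
  then have csN: "(\<integral>x. c (x, bary (s x)) \<partial>\<mu>) \<le> N" using prob_space by simp
  have sq0: "0 \<le> (\<Sum>i\<in>J. (m i)\<^sup>2)" by (rule sum_nonneg) simp
  have A\<gamma>0: "0 \<le> A * \<gamma>" and Lsq0: "0 \<le> L * (\<Sum>i\<in>J. (m i)\<^sup>2)" using A L \<gamma>0 sq0 by auto
  \<comment> \<open>The dual value is at least \<open>- N\<close>, the payoff at most
    \<open>N\<close>, and the two errors at most 1 each, which leaves
    \<open>2 * N + 2 = 2 * W\<close> for the penalties.\<close>
  have opt': "A * \<gamma> + 2 * (L * (\<Sum>i\<in>J. (m i)\<^sup>2)) \<le> 2 * W"
    using opt dual_ge csN gA \<delta> unfolding m_def[symmetric] \<gamma>_def[symmetric] W_def by simp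
  have \<gamma>: "\<gamma> \<le> \<eta> / 8"
  proof -
    have "A * \<gamma> \<le> A * (\<eta> / 8)" using opt' Lsq0 \<eta>(1) unfolding A_def by simp
    then show ?thesis using A by simp
  qed
  have msum: "2 * R * (\<Sum>i\<in>J. \<bar>m i\<bar>) \<le> \<eta> / 4"
  proof -
    have "\<bar>m i\<bar> \<le> t + (m i)\<^sup>2 / t" for i
    proof -
      have "2 * \<bar>m i\<bar> * t \<le> (m i)\<^sup>2 + t\<^sup>2" using sum_squares_bound[of "\<bar>m i\<bar>" t] by simp
      moreover have "0 \<le> \<bar>m i\<bar> * t" using t by simp
      moreover have "(t + (m i)\<^sup>2 / t) * t = t\<^sup>2 + (m i)\<^sup>2" using t by (simp add: distrib_right power2_eq_square)
      ultimately have "\<bar>m i\<bar> * t \<le> (t + (m i)\<^sup>2 / t) * t" by linarith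
      then show ?thesis using t by simp
    qed
    then have "(\<Sum>i\<in>J. \<bar>m i\<bar>) \<le> (\<Sum>i\<in>J. t + (m i)\<^sup>2 / t)" by (intro sum_mono)
    also have "\<dots> = n * t + (\<Sum>i\<in>J. (m i)\<^sup>2) / t" by (simp add: sum.distrib n_def sum_divide_distrib)
    finally have 1: "(\<Sum>i\<in>J. \<bar>m i\<bar>) \<le> n * t + (\<Sum>i\<in>J. (m i)\<^sup>2) / t" .
    have "16 * (R + 1) * (n + 1) \<noteq> 0" using R n by simp
    from nonzero_eq_divide_eq[OF this, of t \<eta>] have "t * (16 * (R + 1) * (n + 1)) = \<eta>" unfolding t_def by blast
    then have nt: "16 * ((R + 1) * ((n + 1) * t)) = \<eta>" by (simp only: mult_ac)
    have "n * t \<le> (n + 1) * t" using t by simp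
    then have "(R + 1) * (n * t) \<le> (R + 1) * ((n + 1) * t)" using R by (intro mult_left_mono) auto
    then have 2: "(R + 1) * (n * t) \<le> \<eta> / 16" using nt by linarith
    have "L * (\<Sum>i\<in>J. (m i)\<^sup>2) \<le> W" using opt' A\<gamma>0 by linarith
    then have "(\<Sum>i\<in>J. (m i)\<^sup>2) \<le> W / L" using L by (simp add: pos_le_divide_eq mult.commute)
    also have "\<dots> = t * \<eta> / (16 * (R + 1))" using W by (simp add: L_def)
    finally have Q: "(\<Sum>i\<in>J. (m i)\<^sup>2) / t \<le> \<eta> / (16 * (R + 1))" using t by (simp add: pos_divide_le_eq mult.commute)
    have R1: "16 * (R + 1) > 0" using R by simp
    from Q have "(\<Sum>i\<in>J. (m i)\<^sup>2) / t * (16 * (R + 1)) \<le> \<eta>" unfolding pos_le_divide_eq[OF R1] .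
    moreover have "(\<Sum>i\<in>J. (m i)\<^sup>2) / t * (16 * (R + 1)) = 16 * ((R + 1) * ((\<Sum>i\<in>J. (m i)\<^sup>2) / t))"
      by (simp only: mult_ac)
    ultimately have 3: "(R + 1) * ((\<Sum>i\<in>J. (m i)\<^sup>2) / t) \<le> \<eta> / 16" by linarith
    have S0: "0 \<le> (\<Sum>i\<in>J. \<bar>m i\<bar>)" by (rule sum_nonneg) simp
    have "R * (\<Sum>i\<in>J. \<bar>m i\<bar>) \<le> (R + 1) * (\<Sum>i\<in>J. \<bar>m i\<bar>)" using S0 by (intro mult_right_mono) auto
    also have "\<dots> \<le> (R + 1) * (n * t + (\<Sum>i\<in>J. (m i)\<^sup>2) / t)" using 1 R by (intro mult_left_mono) auto
    also have "\<dots> = (R + 1) * (n * t) + (R + 1) * ((\<Sum>i\<in>J. (m i)\<^sup>2) / t)" by (rule distrib_left)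
    also have "\<dots> \<le> \<eta> / 8" using 2 3 by linarith
    finally show ?thesis by simp
  qed
  define \<epsilon> where "\<epsilon> y = h + 2 * g y" for y
  have \<epsilon>i: "integrable \<nu> \<epsilon>" unfolding \<epsilon>_def using gi by simp
  obtain \<pi> K where \<pi>: "\<pi> \<in> couplings \<mu> \<nu>" "disintegration \<mu> \<pi> K"
    and di: "integrable \<mu> (\<lambda>x. norm (barycenter (K x) - bary (s x)))"
    and dle: "(\<integral>x. norm (barycenter (K x) - bary (s x)) \<partial>\<mu>) \<le> (\<integral>y. \<epsilon> y \<partial>\<nu>) + (\<integral>x. pexp (s x) \<epsilon> \<partial>\<mu>)
      + 2 * R * (\<Sum>i\<in>J. \<bar>(\<integral>x. pexp (s x) (f i) \<partial>\<mu>) - (\<integral>y. f i y \<partial>\<nu>)\<bar>)"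
  proof (rule strategy_rounding[OF \<mu> \<nu> J, of f z \<epsilon> "2 * R" s])
    show "continuous_on UNIV (f i)" if "i \<in> J" for i using f(1) that by blast
    show "0 \<le> f i y" if "i \<in> J" for i y using f(2) that by blast
    show "(\<Sum>i\<in>J. f i y) = 1" for y using f(3) by blast
    show "(\<Sum>i\<in>J. f i y * norm (y - z i)) \<le> \<epsilon> y" for y using near unfolding \<epsilon>_def g_def by blast
    show "norm (z i) \<le> 2 * R" if "i \<in> J" for i using z that by blast
  qed (use \<epsilon>i s in auto)
  have "(\<integral>y. \<epsilon> y \<partial>\<nu>) = h + 2 * (\<integral>y. g y \<partial>\<nu>)" unfolding \<epsilon>_def using gi N.prob_space by simp
  moreover have "(\<integral>x. pexp (s x) \<epsilon> \<partial>\<mu>) = h + 2 * \<gamma>"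
  proof -
    have fins: "finite (set_pmf (s x))" for x using s by (simp add: strategies_def)
    have "pexp (s x) \<epsilon> = h + 2 * pexp (s x) g" for x
      unfolding \<epsilon>_def using integrable_measure_pmf_finite[OF fins[of x], of g] by (simp add: measure_pmf.prob_space)
    then show ?thesis unfolding \<gamma>_def using integrable_pexp_strategy[OF finite_measure_axioms s, of g] prob_space by simp
  qed
  \<comment> \<open>The budget: \<open>3 * \<eta> / 8\<close> for displacements under
    \<open>\<nu>\<close>, as much for those under the strategy, and \<open>\<eta> / 4\<close> for
    the weights.\<close>
  ultimately have d\<eta>: "(\<integral>x. norm (barycenter (K x) - bary (s x)) \<partial>\<mu>) \<le> \<eta>"
    using dle gh \<gamma> msum unfolding m_def[symmetric] h_def by linarith
  note bb = integral_norm_barycenter_le[OF \<mu> \<nu>(2,3) \<pi>]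
  have "(\<integral>x. c (x, bary (s x)) \<partial>\<mu>) \<le> (\<integral>x. c (x, barycenter (K x)) \<partial>\<mu>) + e / 4"
  proof (rule \<eta>(2)[rule_format, OF _ _ bb(1) di _ d\<eta>])
    show "(\<lambda>x. barycenter (K x)) \<in> borel_measurable \<mu>"
      by (rule measurable_barycenter_kernel[OF coupling_kernel_bind(2)[OF \<mu> \<nu>(2) \<pi>]])
    show "(\<lambda>x. bary (s x)) \<in> borel_measurable \<mu>" by (rule measurable_strategy[OF s]) simp
    show "(\<integral>x. norm (barycenter (K x)) \<partial>\<mu>) \<le> M" unfolding M_def by (rule bb(2))
  qed
  \<comment> \<open>Twice \<open>\<delta>\<close>, for the tail of \<open>\<nu>\<close> and for near
    maximality, plus \<open>e / 4\<close> for stability is at most \<open>3 * e / 4\<close>.\<close>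
  then have "(\<integral>x. \<phi> x \<partial>\<mu>) + (\<integral>y. \<psi> y \<partial>\<nu>) \<le> (\<integral>x. c (x, barycenter (K x)) \<partial>\<mu>) + e"
    using opt gA \<delta>(3) A\<gamma>0 Lsq0 e unfolding m_def[symmetric] \<gamma>_def[symmetric] by linarith
  with \<pi> \<phi> \<psi> le show thesis using that by blast
qed

section \<open>From bounded costs to costs of growth order \<open>r\<close>\<close>

lemma powr_one_plus_le:
  fixes d r :: real
  assumes "d \<ge> 0" "r \<ge> 1"
  shows "(1 + d) powr r \<le> 2 powr r * (1 + d powr r)"
proof -
  have "(1 + d) powr r \<le> (2 * max 1 d) powr r" using assms by (intro powr_mono2) auto
  also have "\<dots> = 2 powr r * max 1 d powr r" using assms by (simp add: powr_mult)
  also have "max 1 d powr r \<le> 1 + d powr r" by (auto simp: max_def)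
  finally show ?thesis by simp
qed

lemma integrable_one_plus_powr:
  fixes d :: "'a \<Rightarrow> real"
  assumes M: "prob_space M" and d: "integrable M (\<lambda>x. d x powr r)" "d \<in> borel_measurable M" "\<And>x. 0 \<le> d x" and r: "r \<ge> 1"
  shows "integrable M (\<lambda>x. (1 + d x) powr r)"
proof (rule Bochner_Integration.integrable_bound)
  interpret prob_space M by fact
  show "integrable M (\<lambda>x. 2 powr r * (1 + d x powr r))" using d(1) by auto
  show "(\<lambda>x. (1 + d x) powr r) \<in> borel_measurable M" using d(2) by measurable
  show "AE x in M. norm ((1 + d x) powr r) \<le> norm (2 powr r * (1 + d x powr r))"
    using powr_one_plus_le[OF d(3) r] by (intro AE_I2) (simp add: abs_mult)
qed

text \<open>The truncation error in \<open>y\<close> is measured by an increasing convex function of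
  the norm, so that it can be added to a convex \<open>\<psi>\<close> and controlled along
  barycenters by Jensen's inequality.\<close>

lemma convex_on_excess_powr:
  assumes r: "r \<ge> 1" and C: "C \<ge> (0::real)"
  shows "convex_on UNIV (\<lambda>y::'b::euclidean_space. C * max 0 ((1 + norm y) powr r - T))"
proof (rule convex_onI)
  fix t :: real and x y :: 'b
  assume t: "0 < t" "t < 1"
  have "norm ((1 - t) *\<^sub>R x + t *\<^sub>R y) \<le> (1 - t) * norm x + t * norm y"
    using t by (intro norm_triangle_le) simp
  then have "(1 + norm ((1 - t) *\<^sub>R x + t *\<^sub>R y)) powr r \<le> ((1 - t) *\<^sub>R (1 + norm x) + t *\<^sub>R (1 + norm y)) powr r"
    using r by (intro powr_mono2) (auto simp: algebra_simps)
  also have "\<dots> \<le> (1 - t) * (1 + norm x) powr r + t * (1 + norm y) powr r"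
    using t by (intro convex_onD[OF powr_convex[OF r]]) (auto simp: add_pos_nonneg)
  finally have "(1 + norm ((1 - t) *\<^sub>R x + t *\<^sub>R y)) powr r - T
      \<le> (1 - t) * ((1 + norm x) powr r - T) + t * ((1 + norm y) powr r - T)"
    by (simp add: algebra_simps)
  also have "\<dots> \<le> (1 - t) * max 0 ((1 + norm x) powr r - T) + t * max 0 ((1 + norm y) powr r - T)"
    using t by (intro add_mono mult_left_mono) auto
  finally have "max 0 ((1 + norm ((1 - t) *\<^sub>R x + t *\<^sub>R y)) powr r - T)
      \<le> (1 - t) * max 0 ((1 + norm x) powr r - T) + t * max 0 ((1 + norm y) powr r - T)"
    using t by simp
  then have "C * max 0 ((1 + norm ((1 - t) *\<^sub>R x + t *\<^sub>R y)) powr r - T)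
      \<le> C * ((1 - t) * max 0 ((1 + norm x) powr r - T) + t * max 0 ((1 + norm y) powr r - T))"
    using C by (rule mult_left_mono)
  then show "C * max 0 ((1 + norm ((1 - t) *\<^sub>R x + t *\<^sub>R y)) powr r - T)
      \<le> (1 - t) * (C * max 0 ((1 + norm x) powr r - T)) + t * (C * max 0 ((1 + norm y) powr r - T))"
    by (simp add: algebra_simps)
qed simp

text \<open>Clamping \<^term>\<open>c\<close> costs at most \<open>a x + b y\<close> with \<open>a\<close> and \<open>b\<close> of small
  integral; as \<open>b\<close> is convex, both sides of the duality change little.\<close>

lemma strong_duality:
  fixes \<mu> :: "'a::polish_space measure" and \<nu> :: "'b::euclidean_space measure" and c :: "'a \<times> 'b \<Rightarrow> real"
  assumes r: "r \<ge> 1"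
    and \<mu>: "prob_space \<mu>" "sets \<mu> = sets borel" and atomless: "\<And>x. emeasure \<mu> {x} = 0"
    and \<mu>r: "integrable \<mu> (\<lambda>x. (1 + dist x x0) powr r)"
    and \<nu>: "prob_space \<nu>" "sets \<nu> = sets borel" "integrable \<nu> norm"
    and \<nu>r: "integrable \<nu> (\<lambda>y. (1 + norm y) powr r)"
    and c_cont: "continuous_on UNIV c"
    and c_growth: "\<And>x y. \<bar>c (x, y)\<bar> \<le> C * ((1 + dist x x0) powr r + (1 + norm y) powr r)"
    and C: "C \<ge> 0" and e: "e > 0"
  obtains \<pi> K \<phi> \<psi> where "\<pi> \<in> couplings \<mu> \<nu>" "disintegration \<mu> \<pi> K"
    "continuous_on UNIV \<phi>" "\<exists>C. \<forall>x. \<bar>\<phi> x\<bar> \<le> C * (1 + dist x x0) powr r"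
    "continuous_on UNIV \<psi>" "convex_on UNIV \<psi>" "\<exists>C. \<forall>y. \<bar>\<psi> y\<bar> \<le> C * (1 + norm y) powr r"
    "\<forall>x y. c (x, y) \<le> \<phi> x + \<psi> y"
    "(\<integral>x. \<phi> x \<partial>\<mu>) + (\<integral>y. \<psi> y \<partial>\<nu>) \<le> (\<integral>x. c (x, barycenter (K x)) \<partial>\<mu>) + e"
proof -
  interpret prob_space \<mu> by fact
  interpret N: prob_space \<nu> by fact
  define G where "G x = (1 + dist x x0) powr r" for x
  define H where "H y = (1 + norm y) powr r" for y :: 'b
  have G1: "1 \<le> G x" for x unfolding G_def using r by (simp add: ge_one_powr_ge_zero)
  have H1: "1 + norm y \<le> H y" for y unfolding H_def using r powr_mono[of 1 r "1 + norm y"] by simp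
  have H0: "0 \<le> H y" for y by (simp add: H_def)
  have Gc: "continuous_on UNIV G" unfolding G_def
    using r by (intro continuous_on_powr' continuous_intros) auto
  have Gi: "integrable \<mu> G" and Hi: "integrable \<nu> H" using \<mu>r \<nu>r by (auto simp: G_def[abs_def] H_def[abs_def])
  have G0: "0 \<le> G x" for x by (simp add: G_def)
  \<comment> \<open>With excess integrals below \<open>d\<close>, \<open>a\<close> and
    \<open>b\<close> have integrals at most \<open>C * d \<le> e / 8\<close>.\<close>
  define d where "d = e / (8 * (C + 1))"
  have d: "d > 0" using e C by (auto simp: d_def)
  have Cd: "C * d \<le> e / 8" using e C unfolding d_def by (simp add: field_simps)
  obtain n1 where n1: "\<forall>n\<ge>n1. (\<integral>x. max 0 (G x - real n) \<partial>\<mu>) < d" by (rule integral_excess_small[OF Gi G0 d])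
  obtain n2 where n2: "\<forall>n\<ge>n2. (\<integral>y. max 0 (H y - real n) \<partial>\<nu>) < d" by (rule integral_excess_small[OF Hi H0 d])
  define T where "T = real (max n1 n2)"
  define a where "a x = C * max 0 (G x - T)" for x
  define b where "b y = C * max 0 (H y - T)" for y
  have ac: "continuous_on UNIV a" unfolding a_def by (intro continuous_intros Gc)
  have b_convex: "convex_on UNIV b" unfolding b_def H_def by (rule convex_on_excess_powr[OF r C])
  have bc: "continuous_on UNIV b" by (rule convex_on_continuous[OF open_UNIV b_convex])
  have ai: "integrable \<mu> a" and bi: "integrable \<nu> b" unfolding a_def b_def using Gi Hi by auto
  have a0: "0 \<le> a x" and b0: "0 \<le> b y" for x y using C by (auto simp: a_def b_def)
  have aI: "(\<integral>x. a x \<partial>\<mu>) \<le> e / 8"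
  proof -
    have "(\<integral>x. a x \<partial>\<mu>) = C * (\<integral>x. max 0 (G x - T) \<partial>\<mu>)" by (simp add: a_def)
    also have "\<dots> \<le> C * d" using n1[rule_format, of "max n1 n2"] C unfolding T_def by (intro mult_left_mono) auto
    finally show ?thesis using Cd by linarith
  qed
  have bI: "(\<integral>y. b y \<partial>\<nu>) \<le> e / 8"
  proof -
    have "(\<integral>y. b y \<partial>\<nu>) = C * (\<integral>y. max 0 (H y - T) \<partial>\<nu>)" by (simp add: b_def)
    also have "\<dots> \<le> C * d" using n2[rule_format, of "max n1 n2"] C unfolding T_def by (intro mult_left_mono) auto
    finally show ?thesis using Cd by linarith
  qed
  \<comment> \<open>The growth bound gives
    \<open>\<bar>c (x, y)\<bar> - N \<le> C * (G x - T) + C * (H y - T)\<close>, so clamping at this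
    level changes \<open>c\<close> by at most \<open>a x + b y\<close>.\<close>
  define N where "N = 2 * (C * T)"
  have N0: "0 \<le> N" using C by (simp add: N_def T_def)
  define c' where "c' z = max (- N) (min N (c z))" for z
  have c'c: "continuous_on UNIV c'" unfolding c'_def by (intro continuous_intros c_cont)
  have c'b: "\<bar>c' z\<bar> \<le> N" for z using N0 unfolding c'_def by auto
  have cc': "\<bar>c (x, y) - c' (x, y)\<bar> \<le> a x + b y" for x y
  proof -
    have "\<bar>c (x, y)\<bar> \<le> C * G x + C * H y" using c_growth[of x y] by (simp add: G_def H_def distrib_left)
    moreover have "C * (G x - T) \<le> a x" "C * (H y - T) \<le> b y"
      unfolding a_def b_def using C by (auto intro!: mult_left_mono)
    ultimately have "\<bar>c (x, y)\<bar> - N \<le> a x + b y" unfolding N_def by (simp add: right_diff_distrib)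
    then show ?thesis using a0[of x] b0[of y] N0 unfolding c'_def by linarith
  qed
  have e2: "e / 2 > 0" using e by simp
  obtain \<pi> K \<phi> \<psi> D where \<pi>: "\<pi> \<in> couplings \<mu> \<nu>" "disintegration \<mu> \<pi> K"
    and \<phi>: "continuous_on UNIV \<phi>" "\<forall>x. \<bar>\<phi> x\<bar> \<le> D"
    and \<psi>: "continuous_on UNIV \<psi>" "convex_on UNIV \<psi>" "\<forall>y. \<bar>\<psi> y\<bar> \<le> D * (1 + norm y)"
    and le: "\<forall>x y. c' (x, y) \<le> \<phi> x + \<psi> y"
    and opt: "(\<integral>x. \<phi> x \<partial>\<mu>) + (\<integral>y. \<psi> y \<partial>\<nu>) \<le> (\<integral>x. c' (x, barycenter (K x)) \<partial>\<mu>) + e / 2"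
    by (rule strong_duality_bounded[OF \<mu> atomless \<nu> c'c c'b e2])
  have D0: "0 \<le> D" using \<phi>(2)[rule_format, of undefined] by linarith
  have \<psi>H: "\<bar>\<psi> y\<bar> \<le> D * H y" for y
    using \<psi>(3)[rule_format, of y] mult_left_mono[OF H1 D0, of y] by linarith
  have \<phi>i: "integrable \<mu> \<phi>"
    using borel_measurable_continuous_onI[OF \<phi>(1)] \<mu>(2) \<phi>(2)
    by (intro integrable_bounded[where K=D] finite_measure_axioms) (auto cong: measurable_cong_sets)
  have \<psi>i: "integrable \<nu> \<psi>"
  proof (rule Bochner_Integration.integrable_bound)
    show "integrable \<nu> (\<lambda>y. D * H y)" using Hi by auto
    show "\<psi> \<in> borel_measurable \<nu>" using borel_measurable_continuous_onI[OF \<psi>(1)] \<nu>(2) by (simp cong: measurable_cong_sets)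
    show "AE y in \<nu>. norm (\<psi> y) \<le> norm (D * H y)"
      using \<psi>H by (intro AE_I2) (metis abs_ge_self order_trans real_norm_def)
  qed
  have bm: "(\<lambda>x. barycenter (K x)) \<in> borel_measurable \<mu>"
    by (rule measurable_barycenter_kernel[OF coupling_kernel_bind(2)[OF \<mu> \<nu>(2) \<pi>]])
  \<comment> \<open>The barycenters need not be distributed as \<open>\<nu>\<close>; convexity of
    \<open>b\<close> still bounds its integral along them by the one under
    \<open>\<nu>\<close>.\<close>
  note jensen = kernel_jensen[OF \<mu> \<nu>(2,3) \<pi> bi b_convex b0]
  have c'i: "integrable \<mu> (\<lambda>x. c' (x, barycenter (K x)))"
    by (rule integrable_bounded[OF finite_measure_axioms measurable_cost_map[OF c'c \<mu>(2) bm] c'b])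
  have ci: "integrable \<mu> (\<lambda>x. c (x, barycenter (K x)))"
  proof (rule Bochner_Integration.integrable_bound)
    show "integrable \<mu> (\<lambda>x. N + (a x + b (barycenter (K x))))" using ai jensen(1) by simp
    show "(\<lambda>x. c (x, barycenter (K x))) \<in> borel_measurable \<mu>" by (rule measurable_cost_map[OF c_cont \<mu>(2) bm])
    have "\<bar>c (x, y)\<bar> \<le> N + (a x + b y)" for x y using cc'[of x y] c'b[of "(x, y)"] by linarith
    then show "AE x in \<mu>. norm (c (x, barycenter (K x))) \<le> norm (N + (a x + b (barycenter (K x))))"
      by (intro AE_I2) (metis abs_ge_self order_trans real_norm_def)
  qed
  have "(\<integral>x. c' (x, barycenter (K x)) \<partial>\<mu>) \<le> (\<integral>x. c (x, barycenter (K x)) + (a x + b (barycenter (K x))) \<partial>\<mu>)"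
  proof (rule integral_mono[OF c'i])
    show "integrable \<mu> (\<lambda>x. c (x, barycenter (K x)) + (a x + b (barycenter (K x))))" using ci ai jensen(1) by simp
    show "c' (x, barycenter (K x)) \<le> c (x, barycenter (K x)) + (a x + b (barycenter (K x)))" for x
      using cc'[of x "barycenter (K x)"] by linarith
  qed
  also have "\<dots> = (\<integral>x. c (x, barycenter (K x)) \<partial>\<mu>) + ((\<integral>x. a x \<partial>\<mu>) + (\<integral>x. b (barycenter (K x)) \<partial>\<mu>))"
    using ci ai jensen(1) by simp
  finally have c'le: "(\<integral>x. c' (x, barycenter (K x)) \<partial>\<mu>) \<le> (\<integral>x. c (x, barycenter (K x)) \<partial>\<mu>) + e / 4"
    using aI bI jensen(2) by linarith
  define \<phi>' where "\<phi>' x = \<phi> x + a x" for x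
  define \<psi>' where "\<psi>' y = \<psi> y + b y" for y
  have CT: "C * max 0 (g - T) \<le> C * g" if "0 \<le> g" for g
    using C that by (intro mult_left_mono) (auto simp: T_def)
  show thesis
  proof (rule that[OF \<pi>, of \<phi>' \<psi>'])
    show "continuous_on UNIV \<phi>'" "continuous_on UNIV \<psi>'"
      unfolding \<phi>'_def \<psi>'_def by (intro continuous_intros \<phi>(1) \<psi>(1) ac bc)+
    show "convex_on UNIV \<psi>'" unfolding \<psi>'_def by (rule convex_on_add[OF \<psi>(2) b_convex])
    have "\<bar>\<phi>' x\<bar> \<le> (D + C) * G x" for x
    proof -
      have "\<bar>\<phi>' x\<bar> \<le> D + a x" unfolding \<phi>'_def using \<phi>(2)[rule_format, of x] a0[of x] by linarith
      also have "\<dots> \<le> D * G x + C * G x"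
        using mult_left_mono[OF G1 D0, of x] CT[OF G0, of x] unfolding a_def by linarith
      finally show ?thesis by (simp add: distrib_right)
    qed
    then show "\<exists>C. \<forall>x. \<bar>\<phi>' x\<bar> \<le> C * (1 + dist x x0) powr r" unfolding G_def by blast
    have "\<bar>\<psi>' y\<bar> \<le> (D + C) * H y" for y
    proof -
      have "\<bar>\<psi>' y\<bar> \<le> D * H y + C * H y"
        using \<psi>H[of y] b0[of y] CT[OF H0, of y] unfolding \<psi>'_def b_def by linarith
      then show ?thesis by (simp add: distrib_right)
    qed
    then show "\<exists>C. \<forall>y. \<bar>\<psi>' y\<bar> \<le> C * (1 + norm y) powr r" unfolding H_def by blast
    show "\<forall>x y. c (x, y) \<le> \<phi>' x + \<psi>' y"
    proof (intro allI)
      fix x y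
      show "c (x, y) \<le> \<phi>' x + \<psi>' y"
        using le[rule_format, of x y] cc'[of x y] unfolding \<phi>'_def \<psi>'_def by linarith
    qed
    have "(\<integral>x. \<phi>' x \<partial>\<mu>) + (\<integral>y. \<psi>' y \<partial>\<nu>) = (\<integral>x. \<phi> x \<partial>\<mu>) + (\<integral>y. \<psi> y \<partial>\<nu>) + ((\<integral>x. a x \<partial>\<mu>) + (\<integral>y. b y \<partial>\<nu>))"
      unfolding \<phi>'_def \<psi>'_def using \<phi>i ai \<psi>i bi by simp
    \<comment> \<open>Half of \<open>e\<close> stems from the clamped problem, a quarter from the
      change of the primal value, a quarter from adding \<open>a\<close> and \<open>b\<close> to the
      dual pair.\<close>
    then show "(\<integral>x. \<phi>' x \<partial>\<mu>) + (\<integral>y. \<psi>' y \<partial>\<nu>) \<le> (\<integral>x. c (x, barycenter (K x)) \<partial>\<mu>) + e"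
      using opt c'le aI bI by linarith
  qed
qed

section \<open>The cycle of inequalities between the three values\<close>

theorem theorem1p5:
  fixes r :: real and x0 :: "'a::polish_space"
    and \<mu> :: "'a measure" and \<nu> :: "'b::euclidean_space measure"
    and c :: "'a \<times> 'b \<Rightarrow> real"
  assumes r: "r \<ge> 1"
    and mu: "prob_space \<mu>" "sets \<mu> = sets borel" "\<forall>x. emeasure \<mu> {x} = 0"
      "integrable \<mu> (\<lambda>x. dist x x0 powr r)"
    and nu: "prob_space \<nu>" "sets \<nu> = sets borel" "integrable \<nu> (\<lambda>y. norm y powr r)"
    and c_cont: "continuous_on UNIV c"
    and c_growth: "\<exists>C. \<forall>x y. \<bar>c (x, y)\<bar> \<le> C * (1 + dist x x0 powr r + norm y powr r)"
  shows
    "((SUP v \<in> {\<integral> x. c (x, barycenter (K x)) \<partial>\<mu> | \<pi> K.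
                 \<pi> \<in> couplings \<mu> \<nu> \<and> disintegration \<mu> \<pi> K}. ereal v)
     = (INF v \<in> {(\<integral> x. \<phi> x \<partial>\<mu>) + (\<integral> y. \<psi> y \<partial>\<nu>) | \<phi> \<psi> \<Delta>.
                 continuous_on UNIV \<phi> \<and> continuous_on UNIV \<psi> \<and>
                 (\<exists>C. \<forall>x. \<bar>\<phi> x\<bar> \<le> C * (1 + dist x x0) powr r) \<and>
                 (\<exists>C. \<forall>y. \<bar>\<psi> y\<bar> \<le> C * (1 + norm y) powr r) \<and>
                 \<Delta> \<in> borel \<rightarrow>\<^sub>M (borel :: 'b measure) \<and>
                 (\<forall>x y1 y2. c (x, y1) \<le> \<phi> x + \<psi> y2 + \<Delta> y1 \<bullet> (y2 - y1))}. ereal v))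
     \<and> ((INF v \<in> {(\<integral> x. \<phi> x \<partial>\<mu>) + (\<integral> y. \<psi> y \<partial>\<nu>) | \<phi> \<psi> \<Delta>.
                 continuous_on UNIV \<phi> \<and> continuous_on UNIV \<psi> \<and>
                 (\<exists>C. \<forall>x. \<bar>\<phi> x\<bar> \<le> C * (1 + dist x x0) powr r) \<and>
                 (\<exists>C. \<forall>y. \<bar>\<psi> y\<bar> \<le> C * (1 + norm y) powr r) \<and>
                 \<Delta> \<in> borel \<rightarrow>\<^sub>M (borel :: 'b measure) \<and>
                 (\<forall>x y1 y2. c (x, y1) \<le> \<phi> x + \<psi> y2 + \<Delta> y1 \<bullet> (y2 - y1))}. ereal v)
     = (INF v \<in> {(\<integral> x. \<phi> x \<partial>\<mu>) + (\<integral> y. \<psi> y \<partial>\<nu>) | \<phi> \<psi>.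
                 continuous_on UNIV \<phi> \<and> continuous_on UNIV \<psi> \<and>
                 (\<exists>C. \<forall>x. \<bar>\<phi> x\<bar> \<le> C * (1 + dist x x0) powr r) \<and>
                 (\<exists>C. \<forall>y. \<bar>\<psi> y\<bar> \<le> C * (1 + norm y) powr r) \<and>
                 convex_on UNIV \<psi> \<and>
                 (\<forall>x y. c (x, y) \<le> \<phi> x + \<psi> y)}. ereal v))"
proof -
  interpret M: prob_space \<mu> by (rule mu(1))
  interpret N: prob_space \<nu> by (rule nu(1))
  let ?P = "{\<integral> x. c (x, barycenter (K x)) \<partial>\<mu> | \<pi> K. \<pi> \<in> couplings \<mu> \<nu> \<and> disintegration \<mu> \<pi> K}"
  let ?D1 = "{(\<integral> x. \<phi> x \<partial>\<mu>) + (\<integral> y. \<psi> y \<partial>\<nu>) | \<phi> \<psi> \<Delta>.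
                 continuous_on UNIV \<phi> \<and> continuous_on UNIV \<psi> \<and>
                 (\<exists>C. \<forall>x. \<bar>\<phi> x\<bar> \<le> C * (1 + dist x x0) powr r) \<and>
                 (\<exists>C. \<forall>y. \<bar>\<psi> y\<bar> \<le> C * (1 + norm y) powr r) \<and>
                 \<Delta> \<in> borel \<rightarrow>\<^sub>M (borel :: 'b measure) \<and>
                 (\<forall>x y1 y2. c (x, y1) \<le> \<phi> x + \<psi> y2 + \<Delta> y1 \<bullet> (y2 - y1))}"
  let ?D2 = "{(\<integral> x. \<phi> x \<partial>\<mu>) + (\<integral> y. \<psi> y \<partial>\<nu>) | \<phi> \<psi>.
                 continuous_on UNIV \<phi> \<and> continuous_on UNIV \<psi> \<and>
                 (\<exists>C. \<forall>x. \<bar>\<phi> x\<bar> \<le> C * (1 + dist x x0) powr r) \<and>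
                 (\<exists>C. \<forall>y. \<bar>\<psi> y\<bar> \<le> C * (1 + norm y) powr r) \<and>
                 convex_on UNIV \<psi> \<and>
                 (\<forall>x y. c (x, y) \<le> \<phi> x + \<psi> y)}"
  define p where "p = (SUP v\<in>?P. ereal v)"
  define d1 where "d1 = (INF v\<in>?D1. ereal v)"
  define d2 where "d2 = (INF v\<in>?D2. ereal v)"
  have m\<mu>: "h \<in> borel_measurable \<mu>" if "continuous_on UNIV h" for h :: "'a \<Rightarrow> real"
    using borel_measurable_continuous_onI[OF that] mu(2) by (simp cong: measurable_cong_sets)
  have m\<nu>: "h \<in> borel_measurable \<nu>" if "continuous_on UNIV h" for h :: "'b \<Rightarrow> real"
    using borel_measurable_continuous_onI[OF that] nu(2) by (simp cong: measurable_cong_sets)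
  have Gi: "integrable \<mu> (\<lambda>x. (1 + dist x x0) powr r)"
    by (rule integrable_one_plus_powr[OF mu(1) mu(4) _ _ r]) (auto intro!: m\<mu> continuous_intros)
  have Hi: "integrable \<nu> (\<lambda>y. (1 + norm y) powr r)"
    by (rule integrable_one_plus_powr[OF nu(1) nu(3) _ _ r]) (auto intro!: m\<nu> continuous_intros)
  have G1: "1 \<le> (1 + dist x x0) powr r" for x using r by (simp add: ge_one_powr_ge_zero)
  have H1: "1 + norm y \<le> (1 + norm y) powr r" for y :: 'b using r powr_mono[of 1 r "1 + norm y"] by simp
  have \<nu>1: "integrable \<nu> norm"
  proof (rule Bochner_Integration.integrable_bound[OF Hi])
    show "AE y in \<nu>. norm (norm y) \<le> norm ((1 + norm y) powr r)"
    proof (rule AE_I2)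
      fix y :: 'b show "norm (norm y) \<le> norm ((1 + norm y) powr r)" using H1[of y] by simp
    qed
  qed (auto intro!: m\<nu> continuous_intros)
  have \<phi>i: "integrable \<mu> \<phi>" if "continuous_on UNIV \<phi>" "\<exists>C. \<forall>x. \<bar>\<phi> x\<bar> \<le> C * (1 + dist x x0) powr r" for \<phi>
  proof -
    from that(2) obtain C where "\<forall>x. \<bar>\<phi> x\<bar> \<le> C * (1 + dist x x0) powr r" by blast
    then have "AE x in \<mu>. norm (\<phi> x) \<le> norm (C * (1 + dist x x0) powr r)"
      by (intro AE_I2) (metis abs_ge_self order_trans real_norm_def)
    with integrable_mult_right[OF Gi] m\<mu>[OF that(1)] show ?thesis
      by (rule Bochner_Integration.integrable_bound)
  qed
  have \<psi>i: "integrable \<nu> \<psi>" if "continuous_on UNIV \<psi>" "\<exists>C. \<forall>y. \<bar>\<psi> y\<bar> \<le> C * (1 + norm y) powr r" for \<psi>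
  proof -
    from that(2) obtain C where "\<forall>y. \<bar>\<psi> y\<bar> \<le> C * (1 + norm y) powr r" by blast
    then have "AE y in \<nu>. norm (\<psi> y) \<le> norm (C * (1 + norm y) powr r)"
      by (intro AE_I2) (metis abs_ge_self order_trans real_norm_def)
    with integrable_mult_right[OF Hi] m\<nu>[OF that(1)] show ?thesis
      by (rule Bochner_Integration.integrable_bound)
  qed
  obtain C where C: "\<And>x y. \<bar>c (x, y)\<bar> \<le> C * (1 + dist x x0 powr r + norm y powr r)" using c_growth by blast
  have C0: "0 \<le> C"
  proof -
    have "0 \<le> C * (1 + dist x0 x0 powr r + norm (0::'b) powr r)" using C[of x0 0] abs_ge_zero order_trans by blast
    then show ?thesis by simp
  qed
  \<comment> \<open>The growth bound is rewritten with the weights of the dual constraints, which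
    are at least 1.\<close>
  have growth: "\<bar>c (x, y)\<bar> \<le> (2 * C) * ((1 + dist x x0) powr r + (1 + norm y) powr r)" for x y
  proof -
    have "dist x x0 powr r \<le> (1 + dist x x0) powr r" "norm y powr r \<le> (1 + norm y) powr r"
      using r by (auto intro!: powr_mono2)
    then have "1 + dist x x0 powr r + norm y powr r \<le> 2 * ((1 + dist x x0) powr r + (1 + norm y) powr r)"
      using G1[of x] by (smt (verit) powr_ge_zero)
    from order_trans[OF C mult_left_mono[OF this C0]] show ?thesis by (simp add: mult.assoc mult.left_commute)
  qed
  have excess: "convex_on UNIV (\<lambda>y::'b. (1 + norm y) powr r)"
    using convex_on_excess_powr[OF r, of 1 0] by simp
  have "p \<le> d1"
    unfolding p_def d1_def
  proof (intro SUP_least INF_greatest)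
    fix v v' assume "v \<in> ?P" "v' \<in> ?D1"
    then obtain \<pi> K \<phi> \<psi> \<Delta> where v: "v = (\<integral>x. c (x, barycenter (K x)) \<partial>\<mu>)" "\<pi> \<in> couplings \<mu> \<nu>" "disintegration \<mu> \<pi> K"
      and v': "v' = (\<integral>x. \<phi> x \<partial>\<mu>) + (\<integral>y. \<psi> y \<partial>\<nu>)" "integrable \<mu> \<phi>" "integrable \<nu> \<psi>"
        "\<And>x y1 y2. c (x, y1) \<le> \<phi> x + \<psi> y2 + \<Delta> y1 \<bullet> (y2 - y1)"
      using \<phi>i \<psi>i by blast
    \<comment> \<open>Jensen's inequality for the weight itself makes the cost integrable along
      every disintegration, so that primal values are genuine integrals.\<close>
    note j = kernel_jensen[OF mu(1,2) nu(2) \<nu>1 v(2,3) Hi excess powr_ge_zero]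
    have "integrable \<mu> (\<lambda>x. c (x, barycenter (K x)))"
    proof (rule Bochner_Integration.integrable_bound)
      show "integrable \<mu> (\<lambda>x. (2 * C) * ((1 + dist x x0) powr r + (1 + norm (barycenter (K x))) powr r))"
        using Gi j(1) by auto
      show "(\<lambda>x. c (x, barycenter (K x))) \<in> borel_measurable \<mu>"
        by (rule measurable_cost_map[OF c_cont mu(2)
              measurable_barycenter_kernel[OF coupling_kernel_bind(2)[OF mu(1,2) nu(2) v(2,3)]]])
      show "AE x in \<mu>. norm (c (x, barycenter (K x)))
          \<le> norm ((2 * C) * ((1 + dist x x0) powr r + (1 + norm (barycenter (K x))) powr r))"
        using growth by (intro AE_I2) (metis abs_ge_self order_trans real_norm_def)
    qed
    from weak_duality[OF mu(1,2) nu(2) \<nu>1 v(2,3) v'(2,3) this v'(4)]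
    show "ereal v \<le> ereal v'" unfolding v(1) v'(1) by simp
  qed
  moreover have "d1 \<le> d2"
    unfolding d2_def
  proof (rule INF_greatest)
    fix v assume "v \<in> ?D2"
    then obtain \<phi> \<psi> where v: "v = (\<integral>x. \<phi> x \<partial>\<mu>) + (\<integral>y. \<psi> y \<partial>\<nu>)"
      and \<phi>: "continuous_on UNIV \<phi>" "\<exists>C. \<forall>x. \<bar>\<phi> x\<bar> \<le> C * (1 + dist x x0) powr r"
      and \<psi>: "continuous_on UNIV \<psi>" "\<exists>C. \<forall>y. \<bar>\<psi> y\<bar> \<le> C * (1 + norm y) powr r" "convex_on UNIV \<psi>"
      and le: "\<forall>x y. c (x, y) \<le> \<phi> x + \<psi> y" by blast
    show "d1 \<le> ereal v"
    proof (rule ereal_le_epsilon2)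
      \<comment> \<open>The error of the approximate subgradient is added to \<open>\<phi>\<close>;
        this keeps its growth class because the weight is at least 1, and raises the dual value by
        \<open>e\<close>.\<close>
      fix e :: real assume e: "0 < e"
      obtain \<Delta> :: "'b \<Rightarrow> 'b" where \<Delta>: "\<Delta> \<in> borel \<rightarrow>\<^sub>M borel" "\<forall>y1 y2. \<psi> y1 \<le> \<psi> y2 + e + \<Delta> y1 \<bullet> (y2 - y1)"
        by (rule approx_subgradient_selection[OF \<psi>(3) e])
      obtain B where B: "\<forall>x. \<bar>\<phi> x\<bar> \<le> B * (1 + dist x x0) powr r" using \<phi>(2) by blast
      have "\<bar>\<phi> x + e\<bar> \<le> (B + e) * (1 + dist x x0) powr r" for x
        using B[rule_format, of x] mult_left_mono[OF G1[of x], of e] e unfolding distrib_right by linarith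
      then have bound: "\<exists>B. \<forall>x. \<bar>\<phi> x + e\<bar> \<le> B * (1 + dist x x0) powr r" by blast
      have cont: "continuous_on UNIV (\<lambda>x. \<phi> x + e)" by (intro continuous_intros \<phi>(1))
      have feas: "\<forall>x y1 y2. c (x, y1) \<le> (\<phi> x + e) + \<psi> y2 + \<Delta> y1 \<bullet> (y2 - y1)"
      proof (intro allI)
        fix x y1 y2
        show "c (x, y1) \<le> (\<phi> x + e) + \<psi> y2 + \<Delta> y1 \<bullet> (y2 - y1)"
          using le[rule_format, of x y1] \<Delta>(2)[rule_format, of y1 y2] by linarith
      qed
      have "(\<integral>x. \<phi> x + e \<partial>\<mu>) + (\<integral>y. \<psi> y \<partial>\<nu>) \<in> ?D1"
        using cont bound \<psi>(1,2) \<Delta>(1) feas by blast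
      then have "d1 \<le> ereal ((\<integral>x. \<phi> x + e \<partial>\<mu>) + (\<integral>y. \<psi> y \<partial>\<nu>))" unfolding d1_def by (rule INF_lower)
      also have "(\<integral>x. \<phi> x + e \<partial>\<mu>) = (\<integral>x. \<phi> x \<partial>\<mu>) + e" using \<phi>i[OF \<phi>] M.prob_space by simp
      finally show "d1 \<le> ereal v + ereal e" unfolding v by (simp add: add.commute add.left_commute)
    qed
  qed
  moreover have "d2 \<le> p"
  proof (rule ereal_le_epsilon2)
    fix e :: real assume e: "0 < e"
    have "0 \<le> 2 * C" using C0 by simp
    obtain \<pi> K \<phi> \<psi> where \<pi>: "\<pi> \<in> couplings \<mu> \<nu>" "disintegration \<mu> \<pi> K"
      and f: "continuous_on UNIV \<phi>" "\<exists>C. \<forall>x. \<bar>\<phi> x\<bar> \<le> C * (1 + dist x x0) powr r"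
        "continuous_on UNIV \<psi>" "convex_on UNIV \<psi>" "\<exists>C. \<forall>y. \<bar>\<psi> y\<bar> \<le> C * (1 + norm y) powr r"
        "\<forall>x y. c (x, y) \<le> \<phi> x + \<psi> y"
      and opt: "(\<integral>x. \<phi> x \<partial>\<mu>) + (\<integral>y. \<psi> y \<partial>\<nu>) \<le> (\<integral>x. c (x, barycenter (K x)) \<partial>\<mu>) + e"
      by (rule strong_duality[OF r mu(1,2) mu(3)[rule_format] Gi nu(1,2) \<nu>1 Hi c_cont growth \<open>0 \<le> 2 * C\<close> e])
    have "(\<integral>x. \<phi> x \<partial>\<mu>) + (\<integral>y. \<psi> y \<partial>\<nu>) \<in> ?D2" using f by blast
    then have "d2 \<le> ereal ((\<integral>x. \<phi> x \<partial>\<mu>) + (\<integral>y. \<psi> y \<partial>\<nu>))" unfolding d2_def by (rule INF_lower)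
    also have "\<dots> \<le> ereal (\<integral>x. c (x, barycenter (K x)) \<partial>\<mu>) + ereal e" using opt by simp
    also have "\<dots> \<le> p + ereal e"
    proof (rule add_right_mono)
      have "(\<integral>x. c (x, barycenter (K x)) \<partial>\<mu>) \<in> ?P" using \<pi> by blast
      then show "ereal (\<integral>x. c (x, barycenter (K x)) \<partial>\<mu>) \<le> p" unfolding p_def by (rule SUP_upper)
    qed
    finally show "d2 \<le> p + ereal e" .
  qed
  ultimately have "p = d1" "d1 = d2" by auto
  then show ?thesis unfolding p_def d1_def d2_def by blast
qed

end
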